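(* Let $n>3$, let $(x_i)_{i\in\mathbb{Z}_n}$ be a cyclic sequence of points in $\mathbb{R}^d$ with $x_i\neq x_j$ for $i\ne j$, and suppose that its piecewise linear interpolation $\gamma:S^1\to\mathbb{R}^d$ is a topological embedding. Then, for every degree $i$, the persistent homology of $\mathcal{T}_\gamma$ is tame: for every $t\in\mathbb{R}$, the homology $H_i(\{w\in\mathbf{F}_2(S^1):\mathcal{T}_\gamma(w)\le t\})$ with coefficients in a field is finite dimensional, and the persistence diagram of the persistence module $t\mapsto H_i(\{w:\mathcal{T}_\gamma(w)\le t\})$ is finite.
   Context: $\mathbf{F}_2(S^1)$ is the set of non-empty subsets of $S^1$ of cardinality at most $2$, with the quotient topology from $S^1\times S^1$. $\mathcal{T}_\gamma(\{z_1,z_2\})=\tfrac12\|\gamma(z_1)-\gamma(z_2)\|^2$. Piecewise linear interpolation: $u_i=x_{i+1}-x_i$ (indices mod $n$), $l_i=\|u_i\|$, $L=\sum_i l_i$, $L_i=\sum_{j<i}l_j/L$, and $\gamma(e^{2\pi\mathrm{i}t})=\frac{L}{l_i}(t-L_i)u_i+x_i$ for $t\in[L_i,L_{i+1}]$. Persistence diagram of a module $(V^t,v_s^t)$ with $r_s^t=\mathrm{rank}\,v_s^t$ finite for $s<t$: the multiset of points $(b,d)$, $-\infty\le b<d\le\infty$, in which $(b,d)$ has multiplicity the minimum, over rectangles $[a,b']\times[c,d']$ with $a<b'<c<d'$ containing $(b,d)$ in the interior relative to the extended plane, of $r_{b'}^{c}-r_a^{c}-r_{b'}^{d'}+r_a^{d'}$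 (vector spaces at $\pm\infty$ being $0$). *)

theory Defs
  imports
    "HOL-Analysis.Analysis"
    "HOL-Homology.Homology"
    "Jordan_Normal_Form.VS_Connect"
begin

section \<open>Quotient topologies and the space of subsets of cardinality at most two\<close>

definition quotient_topology :: "'a topology \<Rightarrow> ('a \<Rightarrow> 'b) \<Rightarrow> 'b topology" where
  "quotient_topology X f =
     topology (\<lambda>U. U \<subseteq> f ` topspace X \<and> openin X {x \<in> topspace X. f x \<in> U})"

lemma openin_quotient_topology:
  "openin (quotient_topology X f) U \<longleftrightarrow>
     U \<subseteq> f ` topspace X \<and> openin X {x \<in> topspace X. f x \<in> U}"
proof -
  have "istopology (\<lambda>U. U \<subseteq> f ` topspace X \<and> openin X {x \<in> topspace X. f x \<in> U})"
    unfolding istopology_def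
  proof (intro conjI allI impI; (elim conjE)?)
    fix S T assume "openin X {x \<in> topspace X. f x \<in> S}" "openin X {x \<in> topspace X. f x \<in> T}"
    moreover have "{x \<in> topspace X. f x \<in> S \<inter> T} =
        {x \<in> topspace X. f x \<in> S} \<inter> {x \<in> topspace X. f x \<in> T}" by auto
    ultimately show "openin X {x \<in> topspace X. f x \<in> S \<inter> T}" by auto
  next
    fix K assume K: "\<forall>U\<in>K. U \<subseteq> f ` topspace X \<and> openin X {x \<in> topspace X. f x \<in> U}"
    have "{x \<in> topspace X. f x \<in> \<Union>K} = (\<Union>U\<in>K. {x \<in> topspace X. f x \<in> U})" by auto
    with K show "openin X {x \<in> topspace X. f x \<in> \<Union>K}" by auto
  qed auto
  then show ?thesis by (simp add: quotient_topology_def)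
qed

lemma topspace_quotient_topology [simp]: "topspace (quotient_topology X f) = f ` topspace X"
proof -
  have "{x \<in> topspace X. f x \<in> f ` topspace X} = topspace X" by auto
  then have "openin (quotient_topology X f) (f ` topspace X)"
    by (simp add: openin_quotient_topology)
  then show ?thesis
    by (metis openin_quotient_topology openin_subset openin_topspace subset_antisym)
qed

lemma quotient_map_quotient_topology: "quotient_map X (quotient_topology X f) f"
  by (simp add: quotient_map_def openin_quotient_topology)

definition F2 :: "'a topology \<Rightarrow> 'a set topology" where
  "F2 X = quotient_topology (prod_topology X X) (\<lambda>(x, y). {x, y})"

lemma topspace_F2:
  "topspace (F2 X) = {w. w \<subseteq> topspace X \<and> w \<noteq> {} \<and> finite w \<and> card w \<le> 2}"
proof -
  have "(\<exists>x y. x \<in> topspace X \<and> y \<in> topspace X \<and> w = {x, y})"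
    if w: "w \<subseteq> topspace X" "w \<noteq> {}" "finite w" "card w \<le> 2" for w
  proof -
    have "card w \<noteq> 0" using w by simp
    then consider "card w = 1" | "card w = 2" using w(4) by linarith
    then show ?thesis
    proof cases
      case 1
      then obtain x where "w = {x}" using card_1_singletonE by blast
      then show ?thesis using w by (intro exI[of _ x]) auto
    next
      case 2
      then obtain x y where "w = {x, y}" by (meson card_2_iff)
      then show ?thesis using w by blast
    qed
  qed
  then have "{w. w \<subseteq> topspace X \<and> w \<noteq> {} \<and> finite w \<and> card w \<le> 2}
      \<subseteq> (\<lambda>(x, y). {x, y}) ` (topspace X \<times> topspace X)" by blast
  moreover have "card {x, y} \<le> 2" for x y :: 'a
    by (simp add: card_insert_if)
  ultimately show ?thesis
    by (auto simp: F2_def)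
qed

definition circle :: "complex topology" where
  "circle = top_of_set (sphere 0 1)"


section \<open>The function \<open>T\<^sub>\<gamma>\<close> and piecewise linear interpolation\<close>

definition T_fun :: "('a \<Rightarrow> 'b::real_normed_vector) \<Rightarrow> 'a set \<Rightarrow> real" where
  "T_fun \<gamma> w = (THE r. \<exists>z\<^sub>1 z\<^sub>2. w = {z\<^sub>1, z\<^sub>2} \<and> r = (norm (\<gamma> z\<^sub>1 - \<gamma> z\<^sub>2))\<^sup>2 / 2)"

lemma T_fun_eq: "T_fun \<gamma> {z\<^sub>1, z\<^sub>2} = (norm (\<gamma> z\<^sub>1 - \<gamma> z\<^sub>2))\<^sup>2 / 2"
  unfolding T_fun_def
  by (rule the_equality) (auto simp: doubleton_eq_iff norm_minus_commute)

text \<open>The cyclic sequence is given by the values of \<^term>\<open>x\<close> on \<open>{..<n}\<close>.\<close>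

definition edge_vec :: "nat \<Rightarrow> (nat \<Rightarrow> 'a::real_normed_vector) \<Rightarrow> nat \<Rightarrow> 'a" where
  "edge_vec n x i = x (Suc i mod n) - x i"

definition edge_len :: "nat \<Rightarrow> (nat \<Rightarrow> 'a::real_normed_vector) \<Rightarrow> nat \<Rightarrow> real" where
  "edge_len n x i = norm (edge_vec n x i)"

definition total_len :: "nat \<Rightarrow> (nat \<Rightarrow> 'a::real_normed_vector) \<Rightarrow> real" where
  "total_len n x = (\<Sum>i<n. edge_len n x i)"

definition knot :: "nat \<Rightarrow> (nat \<Rightarrow> 'a::real_normed_vector) \<Rightarrow> nat \<Rightarrow> real" where
  "knot n x i = (\<Sum>j<i. edge_len n x j) / total_len n x"

text \<open>That this is well defined is the lemma \<open>pl_interpolation_eq\<close> below.\<close>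

definition pl_interpolation :: "nat \<Rightarrow> (nat \<Rightarrow> 'a::real_normed_vector) \<Rightarrow> complex \<Rightarrow> 'a" where
  "pl_interpolation n x z = (THE y. \<exists>i<n. \<exists>t\<in>{knot n x i..knot n x (Suc i)}.
      z = exp (2 * of_real pi * \<i> * of_real t) \<and>
      y = (total_len n x / edge_len n x i * (t - knot n x i)) *\<^sub>R edge_vec n x i + x i)"

context
  fixes n :: nat and x :: "nat \<Rightarrow> 'a::real_normed_vector"
  assumes n: "n > 1" and inj: "inj_on x {..<n}"
begin

lemma edge_len_pos: "i < n \<Longrightarrow> edge_len n x i > 0"
proof -
  assume i: "i < n"
  have "Suc i mod n \<noteq> i"
    using i n by (cases "Suc i = n") auto
  moreover have "Suc i mod n < n" using n by simp
  ultimately have "x (Suc i mod n) \<noteq> x i"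
    using inj i by (metis inj_onD lessThan_iff)
  then show ?thesis by (simp add: edge_len_def edge_vec_def)
qed

lemma total_len_pos: "total_len n x > 0"
  unfolding total_len_def using n edge_len_pos by (intro sum_pos) auto

lemma knot_Suc: "knot n x (Suc i) = knot n x i + edge_len n x i / total_len n x"
  by (simp add: knot_def add_divide_distrib)

lemma knot_0: "knot n x 0 = 0"
  by (simp add: knot_def)

lemma knot_n: "knot n x n = 1"
  using total_len_pos by (simp add: knot_def total_len_def)

lemma knot_mono: "i \<le> j \<Longrightarrow> knot n x i \<le> knot n x j"
  using total_len_pos unfolding knot_def
  by (intro divide_right_mono sum_mono2) (auto simp: edge_len_def)

lemma knot_less: "i < j \<Longrightarrow> i < n \<Longrightarrow> knot n x i < knot n x j"
proof -
  assume "i < j" "i < n"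
  have "0 < edge_len n x i / total_len n x"
    using edge_len_pos[OF \<open>i < n\<close>] total_len_pos by simp
  then show ?thesis
    using knot_mono[of "Suc i" j] \<open>i < j\<close> unfolding knot_Suc by simp
qed

lemma pl_interpolation_eq:
  assumes i: "i < n" and t: "t \<in> {knot n x i..knot n x (Suc i)}"
  shows "pl_interpolation n x (exp (2 * of_real pi * \<i> * of_real t)) =
    (total_len n x / edge_len n x i * (t - knot n x i)) *\<^sub>R edge_vec n x i + x i"
proof -
  define g where "g i t =
    (total_len n x / edge_len n x i * (t - knot n x i)) *\<^sub>R edge_vec n x i + x i" for i t
  have start: "g i (knot n x i) = x i" for i by (simp add: g_def)
  have stop: "g i (knot n x (Suc i)) = x (Suc i mod n)" if "i < n" for i
    using edge_len_pos[OF that] total_len_pos by (simp add: g_def knot_Suc edge_vec_def)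
  have same: "g i t = g j t"
    if "i < j" "j < n" "t \<in> {knot n x i..knot n x (Suc i)}" "t \<in> {knot n x j..knot n x (Suc j)}"
    for i j t
  proof -
    have le: "knot n x (Suc i) \<le> knot n x j" using that knot_mono by simp
    then have eq: "knot n x (Suc i) = knot n x j" "t = knot n x j" using that by auto
    have "\<not> Suc i < j" using knot_less[of "Suc i" j] eq(1) that(2) by auto
    then have j: "j = Suc i" using that(1) by simp
    have "g i (knot n x j) = x (Suc i mod n)"
      using stop[of i] that(1,2) unfolding eq(1) by simp
    moreover have "x (Suc i mod n) = x j" using j that(2) by simp
    ultimately show ?thesis unfolding eq(2) using start[of j] by simp
  qed
  have same': "g i t = g j t"
    if "i < n" "j < n" "t \<in> {knot n x i..knot n x (Suc i)}" "t \<in> {knot n x j..knot n x (Suc j)}"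
    for i j t
  proof (cases i j rule: linorder_cases)
    case less show ?thesis using that by (intro same[OF less]) auto
  next
    case equal then show ?thesis by simp
  next
    case greater show ?thesis using that by (intro same[OF greater, symmetric]) auto
  qed
  have ends: "g i 0 = g j 1"
    if "i < n" "j < n" "0 \<in> {knot n x i..knot n x (Suc i)}" "1 \<in> {knot n x j..knot n x (Suc j)}"
    for i j
  proof -
    have "0 \<in> {knot n x 0..knot n x (Suc 0)}"
      using knot_mono[of 0 "Suc 0"] by (simp add: knot_0)
    then have "g i 0 = g 0 0" using that n by (intro same') auto
    moreover have "1 \<in> {knot n x (n - 1)..knot n x (Suc (n - 1))}"
      using knot_mono[of "n - 1" n] n by (simp add: knot_n)
    then have "g j 1 = g (n - 1) 1" using that n by (intro same') auto
    moreover have "g 0 0 = x 0" using start[of 0] by (simp add: knot_0)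
    moreover have "g (n - 1) 1 = x 0" using stop[of "n - 1"] n by (simp add: knot_n)
    ultimately show ?thesis by (simp only:)
  qed
  have range: "0 \<le> s \<and> s \<le> 1" if "i < n" "s \<in> {knot n x i..knot n x (Suc i)}" for i s
    using that knot_mono[of 0 i] knot_mono[of "Suc i" n] by (auto simp: knot_0 knot_n)
  have uniq: "g j s = g i t"
    if j: "j < n" and s: "s \<in> {knot n x j..knot n x (Suc j)}"
      and eq: "exp (2 * of_real pi * \<i> * of_real t) = exp (2 * of_real pi * \<i> * complex_of_real s)"
    for j s
  proof -
    obtain k :: int where k: "2 * of_real pi * \<i> * of_real t =
        2 * of_real pi * \<i> * of_real s + (of_int (2 * k) * pi) * \<i>"
      using eq by (auto simp: exp_eq)
    have "Im (2 * of_real pi * \<i> * of_real t) =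
        Im (2 * of_real pi * \<i> * of_real s + (of_int (2 * k) * pi) * \<i>)"
      by (simp only: k)
    then have "2 * pi * t = 2 * pi * (s + of_int k)" by (simp add: algebra_simps)
    then have ts: "t = s + of_int k" by simp
    have b: "0 \<le> s" "s \<le> 1" "0 \<le> t" "t \<le> 1" using range i t j s by auto
    then have "-1 \<le> k" "k \<le> 1" using ts by linarith+
    then consider "k = 0" | "k = 1" | "k = -1" by linarith
    then show ?thesis
    proof cases
      case 1 then have "s = t" using ts by simp
      then show ?thesis using same'[OF j i, of t] t s by simp
    next
      case 2 then have "s = 0" "t = 1" using b ts by auto
      then show ?thesis using ends[OF j i] t s by (simp only:)
    next
      case 3 then have "s = 1" "t = 0" using b ts by auto
      then show ?thesis using ends[OF i j, symmetric] t s by (simp only:)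
    qed
  qed
  show ?thesis
    unfolding pl_interpolation_def g_def[symmetric]
  proof (rule the_equality)
    show "\<exists>j<n. \<exists>s\<in>{knot n x j..knot n x (Suc j)}.
        exp (2 * of_real pi * \<i> * of_real t) = exp (2 * of_real pi * \<i> * complex_of_real s) \<and>
        g i t = g j s"
      using i t by blast
  next
    fix y
    assume "\<exists>j<n. \<exists>s\<in>{knot n x j..knot n x (Suc j)}.
        exp (2 * of_real pi * \<i> * of_real t) = exp (2 * of_real pi * \<i> * complex_of_real s) \<and>
        y = g j s"
    then obtain j s where "j < n" "s \<in> {knot n x j..knot n x (Suc j)}"
        "exp (2 * of_real pi * \<i> * of_real t) = exp (2 * of_real pi * \<i> * complex_of_real s)"
        "y = g j s" by blast
    then show "y = g i t" using uniq[of j s] by (simp only:)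
  qed
qed

end


section \<open>Singular homology with coefficients in a field\<close>

text \<open>The library has singular chains with integer coefficients only
  (\<^typ>\<open>'a chain\<close>); here the coefficients are in a field \<open>'k\<close>, the simplices and
  faces being those of the library.\<close>

type_synonym ('a, 'k) kchain = "((nat \<Rightarrow> real) \<Rightarrow> 'a) \<Rightarrow>\<^sub>0 'k"

definition kscale :: "'k \<Rightarrow> ('b \<Rightarrow>\<^sub>0 'k) \<Rightarrow> ('b \<Rightarrow>\<^sub>0 'k::field)" where
  "kscale a = Poly_Mapping.map ((*) a)"

definition kchains :: "nat \<Rightarrow> 'a topology \<Rightarrow> ('a, 'k::field) kchain set" where
  "kchains p X = {c. Poly_Mapping.keys c \<subseteq> singular_simplex_set p X}"

definition kboundary :: "nat \<Rightarrow> ('a, 'k::field) kchain \<Rightarrow> ('a, 'k) kchain" where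
  "kboundary p c = (if p = 0 then 0 else
     (\<Sum>f\<in>Poly_Mapping.keys c. \<Sum>k\<le>p.
        Poly_Mapping.single (singular_face p k f) ((-1) ^ k * Poly_Mapping.lookup c f)))"

definition kcycles :: "nat \<Rightarrow> 'a topology \<Rightarrow> ('a, 'k::field) kchain set" where
  "kcycles p X = {c \<in> kchains p X. kboundary p c = 0}"

definition kboundaries :: "nat \<Rightarrow> 'a topology \<Rightarrow> ('a, 'k::field) kchain set" where
  "kboundaries p X = kboundary (Suc p) ` kchains (Suc p) X"

definition kcoset :: "('b \<Rightarrow>\<^sub>0 'k::field) set \<Rightarrow> ('b \<Rightarrow>\<^sub>0 'k) \<Rightarrow> ('b \<Rightarrow>\<^sub>0 'k) set" where
  "kcoset B z = {z + b |b. b \<in> B}"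

text \<open>The quotient vector space \<open>Z / B\<close>, for subspaces \<open>B \<subseteq> Z\<close>. A module record extends a
  ring record, whose multiplicative part plays no role. Adding \<open>B\<close> in the scalar
  multiplication makes \<open>0 \<cdot> U\<close> the coset \<open>B\<close> and not \<open>{0}\<close>.\<close>

definition kquotient ::
  "('b \<Rightarrow>\<^sub>0 'k::field) set \<Rightarrow> ('b \<Rightarrow>\<^sub>0 'k) set \<Rightarrow> ('k, ('b \<Rightarrow>\<^sub>0 'k) set) module" where
  "kquotient Z B =
     \<lparr>carrier = kcoset B ` Z, mult = undefined, one = undefined, zero = B,
      add = (\<lambda>U V. {u + v |u v. u \<in> U \<and> v \<in> V}),
      smult = (\<lambda>a U. {kscale a u + b |u b. u \<in> U \<and> b \<in> B})\<rparr>"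

definition khomology ::
  "nat \<Rightarrow> 'a topology \<Rightarrow> ('k::field, ('a, 'k) kchain set) module" where
  "khomology p X = kquotient (kcycles p X) (kboundaries p X)"

text \<open>The map induced in homology by the inclusion of a subspace into \<open>Y\<close>: the class of a
  cycle is sent to the class in \<open>Y\<close> of the same cycle.\<close>

definition khomology_incl ::
  "nat \<Rightarrow> 'a topology \<Rightarrow> ('a, 'k::field) kchain set \<Rightarrow> ('a, 'k) kchain set" where
  "khomology_incl p Y U = {u + b |u b. u \<in> U \<and> b \<in> kboundaries p Y}"


section \<open>Persistence diagrams\<close>

text \<open>A persistence module is a family \<open>V\<close> of vector spaces over the field \<open>'k\<close> and a family
  \<open>v\<close> of linear maps \<open>v s t\<close> from \<open>V s\<close> to \<open>V t\<close>, for \<open>s \<le> t\<close>. The spaces at \<open>\<plusminus>\<infinity>\<close> are zero, so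
  that the rank of a map from or to one of them is zero.\<close>

definition persistence_rank ::
  "(real \<Rightarrow> ('k::field, 'v) module) \<Rightarrow> (real \<Rightarrow> real \<Rightarrow> 'v \<Rightarrow> 'v) \<Rightarrow> ereal \<Rightarrow> ereal \<Rightarrow> nat" where
  "persistence_rank V v s t =
     (if \<bar>s\<bar> = \<infinity> \<or> \<bar>t\<bar> = \<infinity> then 0
      else let s' = real_of_ereal s; t' = real_of_ereal t
           in vectorspace.dim class_ring ((V t')\<lparr>carrier := v s' t' ` carrier (V s')\<rparr>))"

text \<open>The diagram as a multiset, that is, its multiplicity function. The topology on
  \<^typ>\<open>ereal \<times> ereal\<close> is that of the extended plane, so a rectangle with \<open>a = -\<infinity>\<close> or
  \<open>d' = \<infinity>\<close> may contain points at infinity in its interior.\<close>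

definition persistence_diagram ::
  "(real \<Rightarrow> ('k::field, 'v) module) \<Rightarrow> (real \<Rightarrow> real \<Rightarrow> 'v \<Rightarrow> 'v) \<Rightarrow> ereal \<times> ereal \<Rightarrow> nat" where
  "persistence_diagram V v q =
     (let r = (\<lambda>s t. int (persistence_rank V v s t)) in
      if fst q < snd q
      then LEAST m. \<exists>a b' c d'. a < b' \<and> b' < c \<and> c < d' \<and>
             q \<in> interior ({a..b'} \<times> {c..d'}) \<and>
             int m = r b' c - r a c - r b' d' + r a d'
      else 0)"

definition sublevel_space :: "'a topology \<Rightarrow> ('a \<Rightarrow> real) \<Rightarrow> real \<Rightarrow> 'a topology" where
  "sublevel_space X f t = subtopology X {w \<in> topspace X. f w \<le> t}"

definition sublevel_homology ::
  "nat \<Rightarrow> 'a topology \<Rightarrow> ('a \<Rightarrow> real) \<Rightarrow> real \<Rightarrow> ('k::field, ('a, 'k) kchain set) module" where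
  "sublevel_homology p X f t = khomology p (sublevel_space X f t)"

definition sublevel_map ::
  "nat \<Rightarrow> 'a topology \<Rightarrow> ('a \<Rightarrow> real) \<Rightarrow> real \<Rightarrow> real
     \<Rightarrow> ('a, 'k::field) kchain set \<Rightarrow> ('a, 'k) kchain set" where
  "sublevel_map p X f s t = khomology_incl p (sublevel_space X f t)"

end

theory Submission
  imports Defs
begin

text \<open>Write \<open>\<F>\<^sub>2(S\<^sup>1)\<close> as a quotient of the triangle \<open>0 \<le> a \<le> b \<le> 1\<close>, which the knots divide
  into rectangles and smaller triangles. On each of these cells \<open>\<gamma>(a) - \<gamma>(b)\<close> is affine, so the
  sublevel sets of \<open>\<T>\<^sub>\<gamma>\<close> are convex. Call critical the minima of \<open>\<T>\<^sub>\<gamma>\<close> over the cells, the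
  edges and the vertices. If there is no critical value in \<open>(s, t]\<close>, then a cell or edge that meets the
  \<open>t\<close>-sublevel set also meets the \<open>s\<close>-sublevel set, and one retracts the former onto the latter,
  first on the edges and then, by Dugundji's extension theorem, on the cells; the straight-line
  homotopy is compatible with the gluing. So the homology changes at finitely many values only,
  which bounds the diagram. Moreover every sublevel set is a retract of a neighbourhood of itself in
  \<open>\<F>\<^sub>2(S\<^sup>1)\<close>, hence of an open set of \<open>\<complex>\<^sup>2\<close>, hence of a finite union of balls, whose
  homology is finite dimensional by Mayer--Vietoris.\<close>


section \<open>Chains with coefficients in a field\<close>

text \<open>Inside a cell the boundary of a sublevel set is in general curved and moves with the
  level, so finite dimensionality is obtained from neighbourhood retracts and not by counting cells.
  For this the intervals \<open>{s<..t}\<close> free of critical values are open at the bottom: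
  \<open>s\<close> may be critical itself, and every level is reached by retracting from a slightly
  higher one. The obstacle is the gluing of the side \<open>a = 0\<close> of the triangle to the
  side \<open>b = 1\<close>, with all three corners going to one point. Both sides are grid lines
  over knots, and the retraction of a grid line is chosen as a function of the point of the loop
  over that knot, not of the knot; the parameters 0 and 1 then receive the same retraction. Vertices
  must stay fixed, which is why their values count as critical. Convexity of the sublevel sets of a
  cell is used twice: it makes them targets for Dugundji's theorem, and it keeps the straight-line
  homotopy below level \<open>t\<close>. In the diagram, a coordinate that is not critical can be
  enclosed in a rectangle whose alternating sum of ranks vanishes, so all points lie on a finite
  grid.\<close>

lemma lookup_kscale [simp]: "Poly_Mapping.lookup (kscale a c) f = a * Poly_Mapping.lookup c f"
  by (simp add: kscale_def Poly_Mapping.map.rep_eq when_def)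

interpretation kchain_space: vector_space "kscale :: 'k::field \<Rightarrow> ('b \<Rightarrow>\<^sub>0 'k) \<Rightarrow> ('b \<Rightarrow>\<^sub>0 'k)"
  by unfold_locales (auto intro!: poly_mapping_eqI simp: lookup_add algebra_simps)

definition kemb :: "('b \<Rightarrow>\<^sub>0 int) \<Rightarrow> ('b \<Rightarrow>\<^sub>0 'k::field)" where
  "kemb = Poly_Mapping.map of_int"

lemma lookup_kemb [simp]: "Poly_Mapping.lookup (kemb c) f = of_int (Poly_Mapping.lookup c f)"
  by (simp add: kemb_def Poly_Mapping.map.rep_eq when_def)

lemma kemb_add: "kemb (a + b) = kemb a + kemb b"
  by (rule poly_mapping_eqI) (simp add: lookup_add)

lemma kemb_diff: "kemb (a - b) = kemb a - kemb b"
  by (rule poly_mapping_eqI) (simp add: lookup_minus)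

lemma kemb_0 [simp]: "kemb 0 = 0"
  by (rule poly_mapping_eqI) simp

lemma kemb_frag_of: "kemb (frag_of f) = Poly_Mapping.single f 1"
  by (rule poly_mapping_eqI) (simp add: lookup_single when_def)

lemma kemb_sum: "kemb (sum g I) = (\<Sum>i\<in>I. kemb (g i))"
  by (induction I rule: infinite_finite_induct) (auto simp: kemb_add)

lemma kemb_cmul: "kemb (frag_cmul a c) = kscale (of_int a) (kemb c)"
  by (rule poly_mapping_eqI) simp

lemma kscale_single: "kscale a (Poly_Mapping.single f b) = Poly_Mapping.single f (a * b)"
  by (rule poly_mapping_eqI) (simp add: lookup_single when_def)

lemma kchain_eq_sum:
  "(\<Sum>f\<in>Poly_Mapping.keys c. Poly_Mapping.single f (Poly_Mapping.lookup c f)) = c"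
  by (rule poly_mapping_eqI)
    (auto simp: lookup_sum lookup_single when_def in_keys_iff intro!: sum.neutral)

text \<open>The \<open>k\<close>-linear extension of an additive map of integral chains; it transports the natural
  chain maps and chain homotopies of the library to coefficients in \<open>k\<close>.\<close>

definition klin :: "(('b \<Rightarrow>\<^sub>0 int) \<Rightarrow> ('c \<Rightarrow>\<^sub>0 int)) \<Rightarrow> ('b \<Rightarrow>\<^sub>0 'k) \<Rightarrow> ('c \<Rightarrow>\<^sub>0 'k::field)" where
  "klin \<phi> c = (\<Sum>f\<in>Poly_Mapping.keys c. kscale (Poly_Mapping.lookup c f) (kemb (\<phi> (frag_of f))))"

lemma klin_superset:
  assumes "finite F" "Poly_Mapping.keys c \<subseteq> F"
  shows "klin \<phi> c = (\<Sum>f\<in>F. kscale (Poly_Mapping.lookup c f) (kemb (\<phi> (frag_of f))))"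
  unfolding klin_def using assms
  by (intro sum.mono_neutral_left) (auto simp: in_keys_iff)

lemma klin_add: "klin \<phi> (a + b) = klin \<phi> a + klin \<phi> b"
proof -
  let ?F = "Poly_Mapping.keys a \<union> Poly_Mapping.keys b"
  have "finite ?F" "Poly_Mapping.keys (a + b) \<subseteq> ?F"
    using keys_add[of a b] by auto
  then show ?thesis
    by (simp add: klin_superset[of ?F] lookup_add kchain_space.scale_left_distrib sum.distrib)
qed

lemma klin_scale: "klin \<phi> (kscale r a) = kscale r (klin \<phi> a)"
proof -
  have "Poly_Mapping.keys (kscale r a) \<subseteq> Poly_Mapping.keys a"
    by (auto simp: in_keys_iff)
  then show ?thesis
    by (simp add: klin_superset[of "Poly_Mapping.keys a"] kchain_space.scale_sum_right)
qed

interpretation klin: Vector_Spaces.linear kscale kscale "klin \<phi>"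
  by unfold_locales (auto simp: klin_add klin_scale)

lemma klin_single_1: "klin \<phi> (Poly_Mapping.single f 1) = kemb (\<phi> (frag_of f))"
  by (simp add: klin_def)

lemma klin_kemb:
  assumes "Modules.additive \<phi>"
  shows "klin \<phi> (kemb c) = kemb (\<phi> c)"
proof -
  interpret \<phi>: Modules.additive \<phi> by fact
  have "c \<in> {c. Poly_Mapping.keys c \<subseteq> UNIV}" by simp
  then have "Poly_Mapping.keys c \<subseteq> UNIV" by simp
  then show ?thesis
  proof (induction c rule: frag_induction)
    case (one f) then show ?case by (simp add: kemb_frag_of klin_single_1)
  next
    case (diff a b) then show ?case by (simp add: kemb_diff klin.diff \<phi>.diff diff)
  qed (simp_all add: \<phi>.zero klin.zero)
qed

text \<open>Only the outer map must be additive: \<phi> is evaluated on generators alone, whereas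
  \<psi> is applied to the chains \<phi> (\<open>frag_of f\<close>), where \<open>klin_kemb\<close>
  is needed.\<close>

lemma klin_compose:
  assumes "Modules.additive \<psi>"
  shows "klin \<psi> (klin \<phi> c) = klin (\<lambda>c. \<psi> (\<phi> c)) c"
  by (simp add: klin_def[of \<phi>] klin_def[of "\<lambda>c. \<psi> (\<phi> c)"] klin.sum klin.scale klin_kemb[OF assms])

text \<open>Identities between natural chain maps are available only for chains of simplices of a
  given space; this reduces an identity over the field to the simplices that occur in
  \<open>c\<close>.\<close>

lemma klin_cong:
  assumes "\<And>f. f \<in> Poly_Mapping.keys c \<Longrightarrow> \<phi> (frag_of f) = \<psi> (frag_of f)"
  shows "klin \<phi> c = klin \<psi> c"
  unfolding klin_def using assms by (intro sum.cong) auto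

lemma klin_plus: "klin (\<lambda>c. \<phi> c + \<psi> c) c = klin \<phi> c + klin \<psi> c"
  by (simp add: klin_def kemb_add kchain_space.scale_right_distrib sum.distrib)

lemma klin_minus: "klin (\<lambda>c. \<phi> c - \<psi> c) c = klin \<phi> c - klin \<psi> c"
  by (simp add: klin_def kemb_diff kchain_space.scale_right_diff_distrib sum_subtractf)

lemma klin_ident: "klin (\<lambda>c. c) c = c"
  by (simp add: klin_def kemb_frag_of kscale_single kchain_eq_sum)

lemma keys_klin:
  assumes "f \<in> Poly_Mapping.keys (klin \<phi> c)"
  shows "\<exists>g\<in>Poly_Mapping.keys c. f \<in> Poly_Mapping.keys (\<phi> (frag_of g))"
proof (rule ccontr)
  assume "\<not> ?thesis"
  then have "Poly_Mapping.lookup (klin \<phi> c) f = 0"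
    by (auto simp: klin_def lookup_sum in_keys_iff intro!: sum.neutral)
  with assms show False by (simp add: in_keys_iff)
qed

section \<open>The boundary operator, cycles and boundaries over the field\<close>

lemma kboundary_eq_klin: "kboundary p = klin (chain_boundary p)"
proof
  fix c :: "('a, 'k::field) kchain"
  show "kboundary p c = klin (chain_boundary p) c"
  proof (cases "p = 0")
    case True
    then show ?thesis by (simp add: kboundary_def klin_def chain_boundary_def)
  next
    case False
    have "Poly_Mapping.single (singular_face p k f) ((-1) ^ k * Poly_Mapping.lookup c f) =
       kscale (Poly_Mapping.lookup c f) (kscale (of_int ((-1) ^ k)) (kemb (frag_of (singular_face p k f))))"
      for k f
      by (simp add: kemb_frag_of kscale_single mult.commute)
    then show ?thesis using False
      by (simp add: kboundary_def klin_def chain_boundary_of kemb_sum kemb_cmul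
          kchain_space.scale_sum_right)
  qed
qed

lemma additive_chain_boundary: "Modules.additive (chain_boundary p)"
  by (simp add: Modules.additive_def chain_boundary_add)

lemma additive_chain_map: "Modules.additive (chain_map p g)"
  by (simp add: Modules.additive_def chain_map_add)

lemma additive_if_diff:
  fixes h :: "'a::ab_group_add \<Rightarrow> 'b::ab_group_add"
  assumes "\<And>a b. h (a - b) = h a - h b"
  shows "Modules.additive h"
proof
  fix a b
  have "h 0 = 0" using assms[of 0 0] by simp
  then have "h (- b) = - h b" using assms[of 0 b] by simp
  then show "h (a + b) = h a + h b" using assms[of a "- b"] by simp
qed

lemma subspace_kchains: "kchain_space.subspace (kchains p X :: ('a, 'k::field) kchain set)"
proof -
  have "a + b \<in> kchains p X" if "a \<in> kchains p X" "b \<in> kchains p X" for a b :: "('a, 'k) kchain"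
    using that Poly_Mapping.keys_add[of a b] by (auto simp: kchains_def)
  moreover have "kscale r a \<in> kchains p X" if "a \<in> kchains p X" for r and a :: "('a, 'k) kchain"
  proof -
    have "Poly_Mapping.keys (kscale r a) \<subseteq> Poly_Mapping.keys a"
      by (auto simp: in_keys_iff)
    then show ?thesis using that by (auto simp: kchains_def)
  qed
  moreover have "0 \<in> kchains p X" by (simp add: kchains_def)
  ultimately show ?thesis by (simp add: kchain_space.subspace_def)
qed

lemma klin_in_kchains:
  assumes "c \<in> kchains p X"
    and "\<And>f. singular_simplex p X f \<Longrightarrow> singular_chain q Y (\<phi> (frag_of f))"
  shows "klin \<phi> c \<in> kchains q Y"
  using assms keys_klin[of _ \<phi> c] unfolding kchains_def singular_chain_def by blast

interpretation kboundary: Vector_Spaces.linear kscale kscale "kboundary p"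
  unfolding kboundary_eq_klin by unfold_locales

lemma kboundary_in_kchains: "c \<in> kchains (Suc p) X \<Longrightarrow> kboundary (Suc p) c \<in> kchains p X"
  unfolding kboundary_eq_klin
  by (erule klin_in_kchains) (simp add: singular_chain_boundary_alt singular_chain_of)

lemma subspace_kcycles: "kchain_space.subspace (kcycles p X)"
  using subspace_kchains[of p X]
  by (auto simp: kchain_space.subspace_def kcycles_def kboundary.add kboundary.scale kboundary.zero)

lemma subspace_kboundaries: "kchain_space.subspace (kboundaries p X)"
  unfolding kboundaries_def by (rule kboundary.subspace_image[OF subspace_kchains])

lemma kboundary_kboundary: "c \<in> kchains (Suc p) X \<Longrightarrow> kboundary p (kboundary (Suc p) c) = 0"
proof -
  assume c: "c \<in> kchains (Suc p) X"
  have "kboundary p (kboundary (Suc p) c) = klin (\<lambda>c. chain_boundary p (chain_boundary (Suc p) c)) c"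
    by (simp add: kboundary_eq_klin klin_compose additive_chain_boundary)
  also have "\<dots> = klin (\<lambda>c. 0) c"
  proof (rule klin_cong)
    fix f assume "f \<in> Poly_Mapping.keys c"
    then have "singular_chain (Suc p) X (frag_of f)"
      using c by (auto simp: kchains_def singular_chain_of)
    then show "chain_boundary p (chain_boundary (Suc p) (frag_of f)) = 0"
      by (rule chain_boundary_boundary_alt)
  qed
  finally show ?thesis by (simp add: klin_def)
qed

lemma kboundaries_subset_kcycles: "kboundaries p X \<subseteq> kcycles p X"
  by (auto simp: kboundaries_def kcycles_def kboundary_in_kchains kboundary_kboundary)

lemma kchains_mono:
  "S \<subseteq> T \<Longrightarrow> kchains p (subtopology X S) \<subseteq> kchains p (subtopology X T)"
  using singular_simplex_mono[of p X S _ T] by (auto simp: kchains_def)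

lemma kcycles_mono:
  "S \<subseteq> T \<Longrightarrow> kcycles p (subtopology X S) \<subseteq> kcycles p (subtopology X T)"
  using kchains_mono[of S T p X] by (auto simp: kcycles_def)

lemma kboundaries_mono:
  "S \<subseteq> T \<Longrightarrow> kboundaries p (subtopology X S) \<subseteq> kboundaries p (subtopology X T)"
  using kchains_mono[of S T "Suc p" X] by (auto simp: kboundaries_def)

text \<open>On a cycle the term that involves the boundary of \<open>z\<close> vanishes after linear
  extension, so the difference is the boundary of \<open>klin (h p) z\<close>. For
  \<open>q = 0\<close> the truncated index \<open>q - 1\<close> does no harm, because
  \<open>chain_boundary 0\<close> is zero.\<close>

lemma chain_homotopic_imp_kboundaries:
  assumes z: "z \<in> kcycles p X"
    and add: "\<And>q. Modules.additive (h q)"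
    and h: "\<And>q c. singular_chain q X c \<Longrightarrow> singular_chain (Suc q) Y (h q c)"
    and bd: "\<And>q c. singular_chain q X c \<Longrightarrow>
       chain_boundary (Suc q) (h q c) + h (q - 1) (chain_boundary q c) = \<phi> q c - \<psi> q c"
  shows "klin (\<phi> p) z - klin (\<psi> p) z \<in> kboundaries p Y"
proof -
  have zc: "z \<in> kchains p X" and z0: "klin (chain_boundary p) z = 0"
    using z by (auto simp: kcycles_def kboundary_eq_klin)
  have sing: "singular_chain p X (frag_of f)" if "f \<in> Poly_Mapping.keys z" for f
    using that zc by (auto simp: kchains_def singular_chain_of)
  have "klin (\<phi> p) z - klin (\<psi> p) z = klin (\<lambda>c. \<phi> p c - \<psi> p c) z"
    by (simp add: klin_minus)
  also have "\<dots> = klin (\<lambda>c. chain_boundary (Suc p) (h p c) + h (p - 1) (chain_boundary p c)) z"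
    using bd[OF sing] by (intro klin_cong) simp
  also have "\<dots> = kboundary (Suc p) (klin (h p) z) + klin (h (p - 1)) (klin (chain_boundary p) z)"
    by (simp add: klin_plus kboundary_eq_klin klin_compose additive_chain_boundary add)
  also have "\<dots> = kboundary (Suc p) (klin (h p) z)"
    by (simp add: z0 klin.zero)
  finally show ?thesis
    using klin_in_kchains[OF zc, of "Suc p" Y "h p"] h
    by (auto simp: kboundaries_def singular_chain_of)
qed

section \<open>Chain maps induced by continuous functions\<close>

definition kmap :: "nat \<Rightarrow> ('a \<Rightarrow> 'b) \<Rightarrow> ('a, 'k::field) kchain \<Rightarrow> ('b, 'k) kchain" where
  "kmap p g = klin (chain_map p g)"

interpretation kmap: Vector_Spaces.linear kscale kscale "kmap p g"
  unfolding kmap_def by unfold_locales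

lemma kmap_in_kchains:
  "c \<in> kchains p X \<Longrightarrow> continuous_map X Y g \<Longrightarrow> kmap p g c \<in> kchains p Y"
  unfolding kmap_def
  by (erule klin_in_kchains) (simp add: singular_chain_of singular_simplex_simplex_map)

lemma kboundary_kmap:
  assumes "c \<in> kchains p X"
  shows "kboundary p (kmap p g c) = kmap (p - 1) g (kboundary p c)"
proof -
  have "klin (\<lambda>c. chain_boundary p (chain_map p g c)) c =
        klin (\<lambda>c. chain_map (p - 1) g (chain_boundary p c)) c"
  proof (rule klin_cong)
    fix f assume "f \<in> Poly_Mapping.keys c"
    then have "singular_chain p X (frag_of f)"
      using assms by (auto simp: kchains_def singular_chain_of)
    then show "chain_boundary p (chain_map p g (frag_of f)) =
        chain_map (p - 1) g (chain_boundary p (frag_of f))"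
      using chain_boundary_chain_map[of p X "frag_of f" g] by simp
  qed
  then show ?thesis
    by (simp add: kmap_def kboundary_eq_klin klin_compose additive_chain_boundary additive_chain_map)
qed

lemma kmap_in_kcycles:
  "c \<in> kcycles p X \<Longrightarrow> continuous_map X Y g \<Longrightarrow> kmap p g c \<in> kcycles p Y"
  by (auto simp: kcycles_def kmap_in_kchains kboundary_kmap kmap.zero)

lemma kmap_in_kboundaries:
  assumes "c \<in> kboundaries p X" "continuous_map X Y g"
  shows "kmap p g c \<in> kboundaries p Y"
proof -
  obtain d where d: "d \<in> kchains (Suc p) X" "c = kboundary (Suc p) d"
    using assms(1) by (auto simp: kboundaries_def)
  then have "kmap p g c = kboundary (Suc p) (kmap (Suc p) g d)"
    by (simp add: kboundary_kmap)
  then show ?thesis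
    using kmap_in_kchains[OF d(1) assms(2)] by (auto simp: kboundaries_def)
qed

lemma kmap_compose: "kmap p g (kmap p f c) = kmap p (g \<circ> f) c"
  unfolding kmap_def chain_map_compose by (simp add: klin_compose additive_chain_map comp_def)

lemma kmap_ident:
  assumes "c \<in> kchains p X" "\<And>x. x \<in> topspace X \<Longrightarrow> g x = x"
  shows "kmap p g c = c"
proof -
  have "klin (chain_map p g) c = klin (\<lambda>c. c) c"
  proof (rule klin_cong)
    fix f assume "f \<in> Poly_Mapping.keys c"
    then have "singular_chain p X (frag_of f)"
      using assms by (auto simp: kchains_def singular_chain_of)
    then show "chain_map p g (frag_of f) = frag_of f"
      using assms(2) by (rule chain_map_id_gen)
  qed
  then show ?thesis by (simp add: kmap_def klin_ident)
qed


section \<open>Homotopy invariance\<close>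

lemma homologous_const_contractible_space:
  assumes "contractible_space X" "topspace X \<noteq> {}" "singular_relcycle p X {} c"
  shows "\<exists>a\<in>topspace X. homologous_rel p X {} c (chain_map p (\<lambda>x. a) c)"
proof -
  obtain a where a: "homotopic_with (\<lambda>x. True) X X id (\<lambda>x. a)"
    using assms(1) by (auto simp: contractible_space_def)
  then have "continuous_map X X (\<lambda>x. a)"
    using homotopic_with_imp_continuous_maps by blast
  then have "a \<in> topspace X" using assms(2) by auto
  moreover have "homologous_rel p X {} (chain_map p id c) (chain_map p (\<lambda>x. a) c)"
    using a assms(3) by (intro homotopic_imp_homologous_rel_chain_maps) auto
  moreover have "chain_map p id c = c"
    using assms(3) chain_map_ident unfolding singular_cycle by blast
  ultimately show ?thesis by auto
qed

text \<open>The contraction makes the cycle homologous to one in a one-point space, where every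
  cycle of positive degree bounds. This is the acyclicity of the models.\<close>

lemma singular_boundary_contractible_space:
  assumes "contractible_space X" "singular_relcycle p X {} c" "p \<noteq> 0"
  shows "singular_relboundary p X {} c"
proof (cases "topspace X = {}")
  case True
  then have "c = 0" using assms(2) by (simp add: singular_cycle singular_chain_empty)
  then show ?thesis by simp
next
  case False
  then obtain a where a: "a \<in> topspace X" "homologous_rel p X {} c (chain_map p (\<lambda>x. a) c)"
    using homologous_const_contractible_space[OF assms(1) False assms(2)] by blast
  have "singular_relcycle p (subtopology X {a}) {} (chain_map p (\<lambda>x. a) c)"
    using a(1) by (intro singular_relcycle_chain_map[OF assms(2)]) auto
  moreover have "topspace (subtopology X {a}) = {a}" using a(1) by auto
  ultimately have "singular_relboundary p (subtopology X {a}) {} (chain_map p (\<lambda>x. a) c)"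
    using assms(3) by (subst singular_boundary_eq_cycle_singleton) auto
  then have "singular_relboundary p X {} (chain_map p (\<lambda>x. a) c)"
    using singular_boundary_mono[of "{a}" "topspace X" p X] a(1) by simp
  from singular_relboundary_add[OF this a(2)[unfolded homologous_rel_def]]
  show ?thesis by simp
qed

section \<open>Cylinders over simplices as acyclic models\<close>

abbreviation simplex_space :: "nat \<Rightarrow> (nat \<Rightarrow> real) topology" where
  "simplex_space p \<equiv> subtopology (powertop_real UNIV) (standard_simplex p)"

text \<open>The universal \<open>p\<close>-simplex: every singular simplex \<open>f\<close> is its
  image under \<open>f\<close>, so a natural construction is determined by its value here.\<close>

definition ident_simplex :: "nat \<Rightarrow> (nat \<Rightarrow> real) chain" where
  "ident_simplex p = frag_of (restrict id (standard_simplex p))"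

abbreviation cylinder :: "'a topology \<Rightarrow> (real \<times> 'a) topology" where
  "cylinder X \<equiv> prod_topology (top_of_set {0..1}) X"

lemma contractible_simplex_space: "contractible_space (simplex_space p)"
proof -
  define a :: "nat \<Rightarrow> real" where "a = (\<lambda>j. if j = 0 then 1 else 0)"
  have a: "a \<in> standard_simplex p" unfolding a_def by simp
  define h where "h = (\<lambda>(t::real, x::nat \<Rightarrow> real). \<lambda>i. (1 - t) * x i + t * a i)"
  have comp: "continuous_map (cylinder (simplex_space p)) euclideanreal (\<lambda>z. (1 - fst z) * snd z i + fst z * a i)" for i
  proof -
    have "continuous_map (cylinder (simplex_space p)) euclideanreal fst"
      by (metis continuous_map_fst continuous_map_into_fulltopology)
    moreover have "continuous_map (cylinder (simplex_space p)) (powertop_real UNIV) snd"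
      by (metis continuous_map_snd continuous_map_into_fulltopology)
    then have "continuous_map (cylinder (simplex_space p)) euclideanreal (\<lambda>z. snd z i)"
      by (simp add: continuous_map_componentwise_UNIV)
    ultimately show ?thesis
      by (intro continuous_map_add continuous_map_real_mult continuous_map_diff) auto
  qed
  have "continuous_map (cylinder (simplex_space p)) (simplex_space p) h"
    unfolding continuous_map_in_subtopology continuous_map_componentwise_UNIV
    using comp a by (auto simp: h_def case_prod_unfold convex_standard_simplex)
  then have "homotopic_with (\<lambda>x. True) (simplex_space p) (simplex_space p) id (\<lambda>x. a)"
    unfolding homotopic_with_def by (intro exI[of _ h]) (auto simp: h_def)
  then show ?thesis by (auto simp: contractible_space_def)
qed

lemma contractible_cylinder_simplex_space: "contractible_space (cylinder (simplex_space p))"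
  by (simp add: contractible_space_prod_topology contractible_simplex_space convex_imp_contractible)

lemma singular_chain_ident_simplex: "singular_chain p (simplex_space p) (ident_simplex p)"
  by (simp add: ident_simplex_def singular_chain_of singular_simplex_def continuous_map_eq[OF continuous_map_id])

lemma chain_map_ident_simplex:
  "singular_simplex p X f \<Longrightarrow> chain_map p f (ident_simplex p) = frag_of f"
  unfolding ident_simplex_def by (rule singular_simplex_chain_map_id)

text \<open>The natural operator with value \<open>T\<close> on the universal simplex; its value on
  \<open>f\<close> is forced to be the image of \<open>T\<close> under the map of cylinders induced
  by \<open>f\<close>.\<close>

definition prism :: "(real \<times> (nat \<Rightarrow> real)) chain \<Rightarrow> nat \<Rightarrow> 'a chain \<Rightarrow> (real \<times> 'a) chain" where
  "prism T p = frag_extend (\<lambda>f. chain_map (Suc p) (map_prod id f) T)"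

lemma prism_diff: "prism T p (a - b) = prism T p a - prism T p b"
  by (simp add: prism_def frag_extend_diff)

lemma prism_0 [simp]: "prism T p 0 = 0"
  by (simp add: prism_def)

lemma continuous_map_prod_id:
  "continuous_map X Y g \<Longrightarrow> continuous_map (cylinder X) (cylinder Y) (map_prod id g)"
  by (auto simp: continuous_map_pairwise o_def map_prod_def case_prod_unfold
      intro: continuous_map_fst continuous_map_compose[OF continuous_map_snd, unfolded o_def])

context
  fixes T :: "(real \<times> (nat \<Rightarrow> real)) chain" and p :: nat
  assumes T: "singular_chain (Suc p) (cylinder (simplex_space p)) T"
begin

lemma singular_chain_prism:
  assumes "singular_chain p X c"
  shows "singular_chain (Suc p) (cylinder X) (prism T p c)"
  unfolding prism_def
proof (rule singular_chain_extend)
  fix f assume "f \<in> Poly_Mapping.keys c"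
  then have "continuous_map (simplex_space p) X f"
    using assms by (auto simp: singular_chain_def singular_simplex_def)
  then show "singular_chain (Suc p) (cylinder X) (chain_map (Suc p) (map_prod id f) T)"
    by (intro singular_chain_chain_map[OF T] continuous_map_prod_id)
qed

text \<open>Naturality in the space. Since \<open>simplex_map p g f\<close> agrees with the
  composite of \<open>g\<close> and \<open>f\<close> only on the standard simplex, the argument uses
  that \<open>T\<close> lives in the cylinder over it.\<close>

lemma chain_map_prism:
  "chain_map (Suc p) (map_prod id g) (prism T p c) = prism T p (chain_map p g c)"
  using subset_UNIV
proof (induction c rule: frag_induction)
  case (one f)
  have "chain_map (Suc p) (map_prod id g \<circ> map_prod id f) T =
        chain_map (Suc p) (map_prod id (simplex_map p g f)) T"
    by (rule chain_map_eq[OF T]) (auto simp: simplex_map_def)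
  then show ?case by (simp add: prism_def chain_map_compose id_def)
qed (auto simp: prism_diff chain_map_diff)

end

text \<open>Both sides are natural, so the formula for a simplex \<open>f\<close> is the image under
  \<open>f\<close> of the formula \<open>eq\<close> for the universal simplex.\<close>

lemma chain_boundary_prism:
  assumes T: "singular_chain (Suc (p - 1)) (cylinder (simplex_space (p - 1))) T"
    and T': "singular_chain (Suc p) (cylinder (simplex_space p)) T'"
    and eq: "chain_boundary (Suc p) T' = chain_map p (Pair 1) (ident_simplex p) -
      chain_map p (Pair 0) (ident_simplex p) - prism T (p - 1) (chain_boundary p (ident_simplex p))"
    and c: "singular_chain p X c"
  shows "chain_boundary (Suc p) (prism T' p c) =
      chain_map p (Pair 1) c - chain_map p (Pair 0) c - prism T (p - 1) (chain_boundary p c)"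
  using c[unfolded singular_chain_def]
proof (induction c rule: frag_induction)
  case (one f)
  then have f: "singular_simplex p X f" by simp
  have end_map: "chain_map p (map_prod id f) (chain_map p (Pair u) (ident_simplex p)) =
      chain_map p (Pair u) (frag_of f)" for u :: real
  proof -
    have "map_prod id f \<circ> Pair u = Pair u \<circ> f" by auto
    then show ?thesis
      using chain_map_ident_simplex[OF f] by (metis chain_map_compose comp_apply)
  qed
  have "chain_map p (map_prod id f) (prism T (p - 1) (chain_boundary p (ident_simplex p))) =
      prism T (p - 1) (chain_boundary p (frag_of f))"
  proof (cases "p = 0")
    \<comment> \<open>The identity \<open>Suc (p - 1) = p\<close> fails here, but the boundary in
      degree 0 is zero.\<close>
    case True
    then show ?thesis by (simp add: chain_boundary_def)
  next
    case False
    then have "chain_map p (map_prod id f) (prism T (p - 1) (chain_boundary p (ident_simplex p))) =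
       prism T (p - 1) (chain_map (p - 1) f (chain_boundary p (ident_simplex p)))"
      using chain_map_prism[OF T, of f] by simp
    also have "chain_map (p - 1) f (chain_boundary p (ident_simplex p)) = chain_boundary p (frag_of f)"
      using chain_boundary_chain_map[OF singular_chain_ident_simplex, of p f]
        chain_map_ident_simplex[OF f] by simp
    finally show ?thesis .
  qed
  moreover have "chain_boundary (Suc p) (prism T' p (frag_of f)) =
      chain_map p (map_prod id f) (chain_boundary (Suc p) T')"
    using chain_boundary_chain_map[OF T', of "map_prod id f"] by (simp add: prism_def)
  ultimately show ?case
    by (simp only: eq chain_map_diff end_map)
next
  case (diff a b)
  then show ?case
    by (simp add: prism_diff chain_boundary_diff chain_map_diff)
qed simp

text \<open>The library's homotopy invariance theorem only says that two integral cycles are homologous,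
  whereas \<open>k\<close>-linear extension needs a natural chain homotopy. It is built by acyclic models: \<open>T'\<close>
  is a chain in the contractible cylinder over the \<open>p\<close>-simplex whose boundary is prescribed by the
  choice \<open>T\<close> one dimension below.\<close>

definition prism_step :: "nat \<Rightarrow> (real \<times> (nat \<Rightarrow> real)) chain \<Rightarrow> (real \<times> (nat \<Rightarrow> real)) chain \<Rightarrow> bool" where
  "prism_step p T T' \<longleftrightarrow> singular_chain (Suc p) (cylinder (simplex_space p)) T' \<and>
     chain_boundary (Suc p) T' = chain_map p (Pair 1) (ident_simplex p) -
       chain_map p (Pair 0) (ident_simplex p) - prism T (p - 1) (chain_boundary p (ident_simplex p))"

lemma continuous_map_Pair_cylinder:
  "u \<in> {0..1} \<Longrightarrow> continuous_map X (cylinder X) (Pair u)"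
  by (simp add: continuous_map_pairwise o_def)

text \<open>A cycle of degree 0 in a contractible space need not bound. This one does: it is a
  difference of two simplices with the same image under a constant map, hence homologous to
  0.\<close>

lemma prism_step_0: "\<exists>T'. prism_step 0 0 T'"
proof -
  let ?X = "cylinder (simplex_space 0)"
  let ?c = "chain_map 0 (Pair 1) (ident_simplex 0) - chain_map 0 (Pair 0) (ident_simplex 0)
    :: (real \<times> (nat \<Rightarrow> real)) chain"
  have "singular_chain 0 ?X ?c"
    by (intro singular_chain_diff singular_chain_chain_map[OF singular_chain_ident_simplex]
        continuous_map_Pair_cylinder) auto
  then have "singular_relcycle 0 ?X {} ?c"
    by (simp add: singular_cycle chain_boundary_def)
  moreover have "topspace ?X \<noteq> {}" using nonempty_standard_simplex by auto
  ultimately obtain a where "homologous_rel 0 ?X {} ?c (chain_map 0 (\<lambda>x. a) ?c)"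
    using homologous_const_contractible_space[OF contractible_cylinder_simplex_space] by blast
  moreover have "chain_map 0 (\<lambda>x. a) ?c = 0"
  proof -
    have "simplex_map 0 (\<lambda>x. a) (simplex_map 0 (Pair u) (restrict id (standard_simplex 0))) =
        (\<lambda>x\<in>standard_simplex 0. a)" for u :: real
      by (auto simp: simplex_map_def)
    then show ?thesis by (simp add: chain_map_diff ident_simplex_def del: id_apply restrict_apply)
  qed
  ultimately have "singular_relboundary 0 ?X {} ?c"
    by (simp add: homologous_rel_def)
  then show ?thesis
    unfolding prism_step_def singular_boundary by (auto simp: chain_boundary_def)
qed

text \<open>The prescribed boundary is a cycle by the prism formula for \<open>T\<close>, which in
  turn refers to \<open>T0\<close>; having positive degree in a contractible space, it
  bounds.\<close>

lemma prism_step_Suc: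
  assumes T: "prism_step p T0 T" and T0: "singular_chain (Suc (p - 1)) (cylinder (simplex_space (p - 1))) T0"
  shows "\<exists>T'. prism_step (Suc p) T T'"
proof -
  let ?X = "cylinder (simplex_space (Suc p))"
  let ?i = "ident_simplex (Suc p)"
  let ?c = "chain_map (Suc p) (Pair 1) ?i - chain_map (Suc p) (Pair 0) ?i -
      prism T p (chain_boundary (Suc p) ?i) :: (real \<times> (nat \<Rightarrow> real)) chain"
  note i = singular_chain_ident_simplex[of "Suc p"]
  have di: "singular_chain p (simplex_space (Suc p)) (chain_boundary (Suc p) ?i)"
    by (rule singular_chain_boundary_alt[OF i])
  have Tc: "singular_chain (Suc p) (cylinder (simplex_space p)) T"
    using T by (simp add: prism_step_def)
  have "singular_chain (Suc p) ?X ?c"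
    by (intro singular_chain_diff singular_chain_chain_map[OF i] singular_chain_prism[OF Tc di]
        continuous_map_Pair_cylinder) auto
  moreover have "chain_boundary (Suc p) ?c = 0"
  proof -
    have "chain_boundary (Suc p) (prism T p (chain_boundary (Suc p) ?i)) =
       chain_map p (Pair 1) (chain_boundary (Suc p) ?i) - chain_map p (Pair 0) (chain_boundary (Suc p) ?i)
       - prism T0 (p - 1) (chain_boundary p (chain_boundary (Suc p) ?i))"
      using T by (intro chain_boundary_prism[OF T0 Tc _ di]) (simp add: prism_step_def)
    also have "chain_boundary p (chain_boundary (Suc p) ?i) = 0"
      by (rule chain_boundary_boundary_alt[OF i])
    finally show ?thesis
      using chain_boundary_chain_map[OF i, of "Pair 1 :: _ \<Rightarrow> real \<times> _"]
        chain_boundary_chain_map[OF i, of "Pair 0 :: _ \<Rightarrow> real \<times> _"]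
      by (simp add: chain_boundary_diff)
  qed
  ultimately have "singular_relboundary (Suc p) ?X {} ?c"
    by (intro singular_boundary_contractible_space contractible_cylinder_simplex_space)
      (auto simp: singular_cycle)
  then show ?thesis
    unfolding prism_step_def singular_boundary by auto
qed

lemma prism_exists:
  obtains P where "\<And>p. singular_chain (Suc p) (cylinder (simplex_space p)) (P p)"
    and "\<And>p X c. singular_chain p X c \<Longrightarrow> chain_boundary (Suc p) (prism (P p) p c) =
      chain_map p (Pair 1) c - chain_map p (Pair 0) c - prism (P (p - 1)) (p - 1) (chain_boundary p c)"
proof -
  \<comment> \<open>The choice of the next chain needs the boundary formula of the present one, so
    the invariant remembers that \<open>T\<close> was itself obtained from some
    \<open>T0\<close>.\<close>
  define Q where "Q = (\<lambda>p T. \<exists>T0. prism_step p T0 T \<and>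
      singular_chain (Suc (p - 1)) (cylinder (simplex_space (p - 1))) T0)"
  have "\<exists>P. \<forall>p. Q p (P p) \<and> prism_step (Suc p) (P p) (P (Suc p))"
  proof (rule dependent_nat_choice)
    show "\<exists>T. Q 0 T"
      using prism_step_0 unfolding Q_def by (meson singular_chain_0)
  next
    fix T p assume "Q p T"
    then obtain T' where T': "prism_step (Suc p) T T'"
      unfolding Q_def using prism_step_Suc by blast
    moreover have "singular_chain (Suc p) (cylinder (simplex_space p)) T"
      using \<open>Q p T\<close> by (auto simp: Q_def prism_step_def)
    ultimately show "\<exists>T'. Q (Suc p) T' \<and> prism_step (Suc p) T T'"
      by (auto simp: Q_def)
  qed
  then obtain P where P: "\<And>p. Q p (P p)" "\<And>p. prism_step (Suc p) (P p) (P (Suc p))"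
    by blast
  have sing: "singular_chain (Suc p) (cylinder (simplex_space p)) (P p)" for p
    using P(1)[of p] by (auto simp: Q_def prism_step_def)
  have bd: "chain_boundary (Suc p) (P p) = chain_map p (Pair 1) (ident_simplex p) -
      chain_map p (Pair 0) (ident_simplex p) - prism (P (p - 1)) (p - 1) (chain_boundary p (ident_simplex p))" for p
  proof (cases p)
    \<comment> \<open>The truncated index makes the formula for \<open>P 0\<close> refer to
      \<open>P 0\<close> itself; the prism is evaluated at the zero boundary, so any predecessor
      gives the same value.\<close>
    case 0
    then show ?thesis using P(1)[of 0] by (auto simp: Q_def prism_step_def chain_boundary_def)
  next
    case (Suc q)
    then show ?thesis using P(2)[of q] by (simp add: prism_step_def)
  qed
  show thesis
    by (rule that[OF sing]) (rule chain_boundary_prism[OF sing sing bd])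
qed

text \<open>The chain homotopy is the natural prism into the cylinder over \<open>X\<close>,
  followed by the chain map of the homotopy.\<close>

proposition homotopic_with_imp_kboundaries:
  assumes "homotopic_with (\<lambda>h. True) X Y f g" and z: "z \<in> kcycles p X"
  shows "kmap p g z - kmap p f z \<in> kboundaries p Y"
proof -
  obtain h where h: "continuous_map (cylinder X) Y h"
    and h0: "\<And>x. h (0, x) = f x" and h1: "\<And>x. h (1, x) = g x"
    using assms(1) unfolding homotopic_with_def by blast
  obtain P where P: "\<And>p. singular_chain (Suc p) (cylinder (simplex_space p)) (P p)"
    and bd: "\<And>p X c. singular_chain p X c \<Longrightarrow> chain_boundary (Suc p) (prism (P p) p c) =
      chain_map p (Pair 1) c - chain_map p (Pair 0) c -
      prism (P (p - 1)) (p - 1) (chain_boundary p (c :: 'a chain))"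
    using prism_exists by metis
  have hf: "h \<circ> Pair 0 = f" and hg: "h \<circ> Pair 1 = g"
    using h0 h1 by auto
  show ?thesis unfolding kmap_def
  proof (rule chain_homotopic_imp_kboundaries[OF z,
        where h = "\<lambda>q c. chain_map (Suc q) h (prism (P q) q c)"
          and \<phi> = "\<lambda>q. chain_map q g" and \<psi> = "\<lambda>q. chain_map q f"])
    show "Modules.additive (\<lambda>c. chain_map (Suc q) h (prism (P q) q c))" for q
      by (rule additive_if_diff) (simp add: prism_diff chain_map_diff)
  next
    fix q and c :: "'a chain" assume c: "singular_chain q X c"
    have ends: "chain_map q h (chain_map q (Pair 1) c) = chain_map q g c"
      "chain_map q h (chain_map q (Pair 0) c) = chain_map q f c"
      by (metis hg chain_map_compose comp_apply) (metis hf chain_map_compose comp_apply)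
    show "singular_chain (Suc q) Y (chain_map (Suc q) h (prism (P q) q c))"
      by (rule singular_chain_chain_map[OF singular_chain_prism[OF P c] h])
    have "chain_boundary (Suc q) (chain_map (Suc q) h (prism (P q) q c)) =
        chain_map q h (chain_boundary (Suc q) (prism (P q) q c))"
      using chain_boundary_chain_map[OF singular_chain_prism[OF P c], of h] by simp
    also have "\<dots> = chain_map q g c - chain_map q f c -
        chain_map q h (prism (P (q - 1)) (q - 1) (chain_boundary q c))"
      by (simp add: bd[OF c] chain_map_diff ends)
    finally have *: "chain_boundary (Suc q) (chain_map (Suc q) h (prism (P q) q c)) =
      chain_map q g c - chain_map q f c - chain_map q h (prism (P (q - 1)) (q - 1) (chain_boundary q c))" .
    \<comment> \<open>The degrees \<open>q\<close> and \<open>Suc (q - 1)\<close> differ only at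
      \<open>q = 0\<close>, where the chain is zero.\<close>
    have "chain_map q h (prism (P (q - 1)) (q - 1) (chain_boundary q c)) =
        chain_map (Suc (q - 1)) h (prism (P (q - 1)) (q - 1) (chain_boundary q c))"
      by (cases q) (auto simp: chain_boundary_def)
    with * show "chain_boundary (Suc q) (chain_map (Suc q) h (prism (P q) q c)) +
        chain_map (Suc (q - 1)) h (prism (P (q - 1)) (q - 1) (chain_boundary q c)) =
        chain_map q g c - chain_map q f c"
      by simp
  qed
qed


section \<open>Finitely generated homology\<close>

text \<open>Finite dimensionality of \<open>Z / B\<close>, said with spans in the ambient space of
  chains so that no quotient has to be formed.\<close>

definition fin_gen_mod :: "('b \<Rightarrow>\<^sub>0 'k::field) set \<Rightarrow> ('b \<Rightarrow>\<^sub>0 'k) set \<Rightarrow> bool" where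
  "fin_gen_mod Z B \<longleftrightarrow> (\<exists>S. finite S \<and> S \<subseteq> Z \<and> Z \<subseteq> kchain_space.span (S \<union> B))"

text \<open>The generators \<open>S\<close> may lie outside \<open>C\<close> and are exchanged for
  elements of \<open>C\<close> one at a time: if \<open>s\<close> cannot be dropped, some
  \<open>c\<close> in \<open>C\<close> has a nonzero coefficient \<open>l\<close> at
  \<open>s\<close>, and subtracting \<open>m / l\<close> times \<open>c\<close> removes
  \<open>s\<close> from any element with coefficient \<open>m\<close>.\<close>

lemma fin_gen_mod_subspace:
  assumes "finite S" "kchain_space.subspace C" "C \<subseteq> kchain_space.span (S \<union> B)"
  shows "fin_gen_mod C B"
  using assms
proof (induction S arbitrary: C rule: finite_induct)
  case empty
  then show ?case by (auto simp: fin_gen_mod_def intro!: exI[of _ "{}"])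
next
  case (insert s S)
  let ?C = "C \<inter> kchain_space.span (S \<union> B)"
  have "fin_gen_mod ?C B"
    using insert.prems by (intro insert.IH kchain_space.subspace_inter) auto
  then obtain S' where S': "finite S'" "S' \<subseteq> ?C" "?C \<subseteq> kchain_space.span (S' \<union> B)"
    by (auto simp: fin_gen_mod_def)
  show ?case
  proof (cases "C \<subseteq> kchain_space.span (S \<union> B)")
    case True
    then show ?thesis using S' by (auto simp: fin_gen_mod_def intro!: exI[of _ S'])
  next
    case False
    then obtain c where c: "c \<in> C" "c \<notin> kchain_space.span (S \<union> B)" by auto
    have Cs: "x \<in> kchain_space.span (insert s (S \<union> B))" if "x \<in> C" for x
      using insert.prems(2) that by auto
    obtain l where l: "c - kscale l s \<in> kchain_space.span (S \<union> B)"
      using Cs[OF c(1)] by (auto simp: kchain_space.span_breakdown_eq)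
    have "l \<noteq> 0" using l c(2) by auto
    have "x \<in> kchain_space.span (insert c S' \<union> B)" if x: "x \<in> C" for x
    proof -
      obtain m where m: "x - kscale m s \<in> kchain_space.span (S \<union> B)"
        using Cs[OF x] by (auto simp: kchain_space.span_breakdown_eq)
      have eq: "x - kscale (m / l) c = (x - kscale m s) - kscale (m / l) (c - kscale l s)"
        using \<open>l \<noteq> 0\<close> by (simp add: kchain_space.scale_right_diff_distrib)
      have "x - kscale (m / l) c \<in> kchain_space.span (S \<union> B)"
        unfolding eq by (intro kchain_space.span_diff kchain_space.span_scale l m)
      moreover have "x - kscale (m / l) c \<in> C"
        using insert.prems(1) x c(1)
        by (intro kchain_space.subspace_diff kchain_space.subspace_scale)
      ultimately have "x - kscale (m / l) c \<in> kchain_space.span (S' \<union> B)"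
        using S'(3) by blast
      then show ?thesis by (auto simp: kchain_space.span_breakdown_eq)
    qed
    then show ?thesis
      using S' c(1) unfolding fin_gen_mod_def
      by (intro exI[of _ "insert c S'"]) auto
  qed
qed

definition fin_khomology :: "'k::field itself \<Rightarrow> nat \<Rightarrow> 'a topology \<Rightarrow> bool" where
  "fin_khomology _ p X \<longleftrightarrow>
     fin_gen_mod (kcycles p X :: ('a, 'k::field) kchain set) (kboundaries p X)"

lemma fin_khomologyI:
  fixes S :: "('a, 'k::field) kchain set"
  assumes "finite S" "kcycles p X \<subseteq> kchain_space.span (S \<union> kboundaries p X)"
  shows "fin_khomology TYPE('k::field) p X"
  unfolding fin_khomology_def using fin_gen_mod_subspace[OF assms(1) subspace_kcycles assms(2)] .

lemma fin_khomologyE: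
  assumes "fin_khomology TYPE('k::field) p X"
  obtains S :: "('a, 'k::field) kchain set"
  where "finite S" "S \<subseteq> kcycles p X" "kcycles p X \<subseteq> kchain_space.span (S \<union> kboundaries p X)"
  using assms by (auto simp: fin_khomology_def fin_gen_mod_def)

section \<open>Small chains and the Mayer--Vietoris argument\<close>

lemma kchain_split:
  fixes c :: "'b \<Rightarrow>\<^sub>0 'k::field"
  assumes "Poly_Mapping.keys c \<subseteq> S \<union> T"
  obtains a b where "c = a + b" "Poly_Mapping.keys a \<subseteq> S" "Poly_Mapping.keys b \<subseteq> T"
proof
  let ?s = "\<lambda>f. Poly_Mapping.single f (Poly_Mapping.lookup c f)"
  show "c = (\<Sum>f\<in>Poly_Mapping.keys c \<inter> S. ?s f) + (\<Sum>f\<in>Poly_Mapping.keys c - S. ?s f)"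
    by (subst sum.Int_Diff[symmetric]) (auto simp: kchain_eq_sum)
  show "Poly_Mapping.keys (\<Sum>f\<in>Poly_Mapping.keys c \<inter> S. ?s f) \<subseteq> S"
    using keys_sum[of ?s "Poly_Mapping.keys c \<inter> S"] by (auto split: if_splits)
  show "Poly_Mapping.keys (\<Sum>f\<in>Poly_Mapping.keys c - S. ?s f) \<subseteq> T"
    using keys_sum[of ?s "Poly_Mapping.keys c - S"] assms by (auto split: if_splits)
qed

text \<open>Iterated barycentric subdivision makes all simplices small, and its natural chain
  homotopy to the identity, extended linearly, keeps the homology class.\<close>

lemma kcycle_split_open_cover:
  fixes z :: "('a, 'k::field) kchain"
  assumes "openin X U" "openin X V" "topspace X \<subseteq> U \<union> V" and z: "z \<in> kcycles p X"
  obtains a b where "a \<in> kchains p (subtopology X U)" "b \<in> kchains p (subtopology X V)"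
    "kboundary p (a + b) = 0" "z - (a + b) \<in> kboundaries p X"
proof -
  have sing: "singular_chain p X (frag_of f)" if "f \<in> Poly_Mapping.keys z" for f
    using that z unfolding kcycles_def kchains_def singular_chain_of by blast
  \<comment> \<open>The subdivision theorem concerns integral chains, so it is applied to each
    simplex of \<open>z\<close> separately; the maximum \<open>N\<close> of the bounds then serves
    for all of them.\<close>
  have "\<exists>n. \<forall>m g. n \<le> m \<and> g \<in> Poly_Mapping.keys ((singular_subdivision p ^^ m) (frag_of f)) \<longrightarrow>
      (\<exists>W\<in>{U, V}. g \<in> standard_simplex p \<rightarrow> W)" if f: "f \<in> Poly_Mapping.keys z" for f
  proof -
    obtain n where "\<And>m g. n \<le> m \<Longrightarrow> g \<in> Poly_Mapping.keys ((singular_subdivision p ^^ m) (frag_of f)) \<Longrightarrow>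
        \<exists>W\<in>{U, V}. g \<in> standard_simplex p \<rightarrow> W"
      by (rule sufficient_iterated_singular_subdivision_exists[of "{U, V}" X p "frag_of f"])
        (use assms(1-3) sing[OF f] in auto)
    then show ?thesis by blast
  qed
  then obtain n where n: "\<And>f m g. f \<in> Poly_Mapping.keys z \<Longrightarrow> n f \<le> m \<Longrightarrow>
      g \<in> Poly_Mapping.keys ((singular_subdivision p ^^ m) (frag_of f)) \<Longrightarrow>
      \<exists>W\<in>{U, V}. g \<in> standard_simplex p \<rightarrow> W"
    by metis
  define N where "N = Max (insert 0 (n ` Poly_Mapping.keys z))"
  have N: "n f \<le> N" if "f \<in> Poly_Mapping.keys z" for f
    using that by (auto simp: N_def)
  let ?z = "klin (singular_subdivision p ^^ N) z"
  have "?z - klin (\<lambda>c. c) z \<in> kboundaries p X"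
  proof -
    obtain h where h: "\<And>p c1 c2. h p (c1 - c2) = h p c1 - h p (c2 :: 'a chain)"
      "\<And>p X c. singular_chain p X c \<Longrightarrow> singular_chain (Suc p) X (h p c)"
      "\<And>p X c. singular_chain p X c \<Longrightarrow> chain_boundary (Suc p) (h p c) +
         h (p - Suc 0) (chain_boundary p c) = (singular_subdivision p ^^ N) c - c"
      using chain_homotopic_iterated_singular_subdivision[of N] by metis
    show ?thesis
      by (rule chain_homotopic_imp_kboundaries[OF z, where h = h
            and \<phi> = "\<lambda>q. singular_subdivision q ^^ N" and \<psi> = "\<lambda>q c. c"])
        (auto intro!: additive_if_diff h(1,2) simp: h(3)[simplified])
  qed
  then have hom: "z - ?z \<in> kboundaries p X"
    using kchain_space.subspace_neg[OF subspace_kboundaries] by (fastforce simp: klin_ident)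
  then have zc: "?z \<in> kcycles p X"
    using kchain_space.subspace_diff[OF subspace_kcycles z, of "z - ?z"] kboundaries_subset_kcycles
    by fastforce
  have "Poly_Mapping.keys ?z \<subseteq>
      singular_simplex_set p (subtopology X U) \<union> singular_simplex_set p (subtopology X V)"
  proof
    fix g assume g: "g \<in> Poly_Mapping.keys ?z"
    then have gs: "singular_simplex p X g" using zc by (auto simp: kcycles_def kchains_def)
    obtain f where "f \<in> Poly_Mapping.keys z"
        "g \<in> Poly_Mapping.keys ((singular_subdivision p ^^ N) (frag_of f))"
      using keys_klin[OF g] by blast
    then have "\<exists>W\<in>{U, V}. g \<in> standard_simplex p \<rightarrow> W" using n[OF _ N] by blast
    then show "g \<in> singular_simplex_set p (subtopology X U) \<union> singular_simplex_set p (subtopology X V)"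
      using gs by (auto simp: singular_simplex_subtopology)
  qed
  then obtain a b where "?z = a + b"
      "Poly_Mapping.keys a \<subseteq> singular_simplex_set p (subtopology X U)"
      "Poly_Mapping.keys b \<subseteq> singular_simplex_set p (subtopology X V)"
    by (rule kchain_split)
  then show thesis
    using that[of a b] hom zc by (auto simp: kchains_def kcycles_def)
qed

lemma kchains_subtopology_Int:
  "kchains p (subtopology X U) \<inter> kchains p (subtopology X V) = kchains p (subtopology X (U \<inter> V))"
proof -
  have "singular_simplex_set p (subtopology X (U \<inter> V)) =
      singular_simplex_set p (subtopology X U) \<inter> singular_simplex_set p (subtopology X V)"
    by (auto simp: singular_simplex_subtopology)
  then show ?thesis by (auto simp: kchains_def)
qed

lemma kchains_subtopology_le: "kchains p (subtopology X U) \<subseteq> kchains p X"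
  by (auto simp: kchains_def singular_simplex_subtopology)

lemma kboundaries_subtopology_le: "kboundaries p (subtopology X U) \<subseteq> kboundaries p X"
  using kchains_subtopology_le[of "Suc p" X U] by (auto simp: kboundaries_def)

text \<open>Exactness in the middle of the Mayer--Vietoris sequence: classes killed by the
  connecting map come from \<open>U\<close> and \<open>V\<close>, and the image of the connecting
  map is a subspace of the finite-dimensional homology of the intersection one degree lower. In
  degree 0 the two halves of a split chain are already cycles.\<close>

lemma fin_khomology_open_Un:
  assumes U: "openin X U" and V: "openin X V" and UV: "topspace X \<subseteq> U \<union> V"
    and fU: "fin_khomology TYPE('k::field) p (subtopology X U)"
    and fV: "fin_khomology TYPE('k::field) p (subtopology X V)"
    and fI: "fin_khomology TYPE('k::field) (p - 1) (subtopology X (U \<inter> V))"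
  shows "fin_khomology TYPE('k::field) p (X :: 'a topology)"
proof -
  obtain SU :: "('a, 'k) kchain set" where SU: "finite SU"
      "kcycles p (subtopology X U) \<subseteq> kchain_space.span (SU \<union> kboundaries p (subtopology X U))"
    using fin_khomologyE[OF fU] by metis
  obtain SV :: "('a, 'k) kchain set" where SV: "finite SV"
      "kcycles p (subtopology X V) \<subseteq> kchain_space.span (SV \<union> kboundaries p (subtopology X V))"
    using fin_khomologyE[OF fV] by metis
  have "SU \<union> kboundaries p (subtopology X U) \<subseteq> SU \<union> SV \<union> S \<union> kboundaries p X"
    "SV \<union> kboundaries p (subtopology X V) \<subseteq> SU \<union> SV \<union> S \<union> kboundaries p X" for S
    using kboundaries_subtopology_le[of p X U] kboundaries_subtopology_le[of p X V] by blast+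
  then have spU: "kcycles p (subtopology X U) \<subseteq> kchain_space.span (SU \<union> SV \<union> S \<union> kboundaries p X)"
    and spV: "kcycles p (subtopology X V) \<subseteq> kchain_space.span (SU \<union> SV \<union> S \<union> kboundaries p X)" for S
    using SU(2) SV(2) kchain_space.span_mono by (blast, blast)
  show ?thesis
  proof (cases p)
    case 0
    have "kcycles p X \<subseteq> kchain_space.span (SU \<union> SV \<union> {} \<union> kboundaries p X :: ('a, 'k) kchain set)"
    proof
      fix z :: "('a, 'k) kchain" assume "z \<in> kcycles p X"
      then obtain a b where ab: "a \<in> kchains p (subtopology X U)" "b \<in> kchains p (subtopology X V)"
          "z - (a + b) \<in> kboundaries p X"
        using kcycle_split_open_cover[OF U V UV] by metis
      then have "a \<in> kcycles p (subtopology X U)" "b \<in> kcycles p (subtopology X V)"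
        using 0 by (auto simp: kcycles_def kboundary_def)
      then have "a \<in> kchain_space.span (SU \<union> SV \<union> {} \<union> kboundaries p X)"
          "b \<in> kchain_space.span (SU \<union> SV \<union> {} \<union> kboundaries p X)"
        using spU spV by blast+
      then have "(z - (a + b)) + (a + b) \<in> kchain_space.span (SU \<union> SV \<union> {} \<union> kboundaries p X)"
        using ab(3) by (intro kchain_space.span_add) (auto intro: kchain_space.span_base)
      then show "z \<in> kchain_space.span (SU \<union> SV \<union> {} \<union> kboundaries p X)" by simp
    qed
    then show ?thesis using SU(1) SV(1) by (intro fin_khomologyI) auto
  next
    case (Suc q)
    let ?I = "subtopology X (U \<inter> V)"
    define pairs :: "(('a, 'k) kchain \<times> ('a, 'k) kchain) set" where
      "pairs = {(a, b). a \<in> kchains p (subtopology X U) \<and> b \<in> kchains p (subtopology X V) \<and>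
         kboundary p (a + b) = 0}"
    \<comment> \<open>Representatives of the image of the connecting map: if \<open>a + b\<close> is
      a cycle, the boundary of \<open>a\<close> is minus that of \<open>b\<close> and so lies in the
      intersection.\<close>
    define C where "C = (\<lambda>(a, b). kboundary p a) ` pairs"
    have "C \<subseteq> kcycles q ?I"
    proof
      fix c assume "c \<in> C"
      then obtain a b where ab: "a \<in> kchains p (subtopology X U)" "b \<in> kchains p (subtopology X V)"
          "kboundary p (a + b) = 0" "c = kboundary p a"
        by (auto simp: C_def pairs_def)
      have "c \<in> kchains q (subtopology X U)"
        using kboundary_in_kchains[of a q] ab Suc by simp
      moreover have "c = kscale (- 1) (kboundary p b)"
        using ab(3,4) by (simp add: kboundary.add eq_neg_iff_add_eq_0)
      then have "c \<in> kchains q (subtopology X V)"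
        using kboundary_in_kchains[of b q] ab(2) Suc kchain_space.subspace_scale[OF subspace_kchains]
        by blast
      ultimately have "c \<in> kchains q ?I"
        using kchains_subtopology_Int by blast
      moreover have "kboundary q c = 0"
        using kboundary_kboundary ab Suc by blast
      ultimately show "c \<in> kcycles q ?I" by (simp add: kcycles_def)
    qed
    moreover have "kchain_space.subspace C"
    proof -
      have add: "kboundary p (a + a' + (b + b')) = kboundary p (a + b) + kboundary p (a' + b')"
        for a b a' b' :: "('a, 'k) kchain"
        by (simp add: kboundary.add)
      have scale: "kboundary p (kscale r a + kscale r b) = kscale r (kboundary p (a + b))"
        for r and a b :: "('a, 'k) kchain"
        by (simp add: kboundary.add kboundary.scale kchain_space.scale_right_distrib)
      have p: "(0, 0) \<in> pairs"
        "\<And>x y. x \<in> pairs \<Longrightarrow> y \<in> pairs \<Longrightarrow> (fst x + fst y, snd x + snd y) \<in> pairs"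
        "\<And>r x. x \<in> pairs \<Longrightarrow> (kscale r (fst x), kscale r (snd x)) \<in> pairs"
        by (auto simp: pairs_def add scale kboundary.zero subspace_kchains
            intro: kchain_space.subspace_add kchain_space.subspace_scale kchain_space.subspace_0)
      show ?thesis unfolding kchain_space.subspace_def C_def
      proof (intro conjI ballI allI)
        show "0 \<in> (\<lambda>(a, b). kboundary p a) ` pairs"
          using p(1) by (auto simp: image_iff kboundary.zero intro!: bexI[of _ "(0, 0)"])
      next
        fix x y assume "x \<in> (\<lambda>(a, b). kboundary p a) ` pairs" "y \<in> (\<lambda>(a, b). kboundary p a) ` pairs"
        then obtain u v where "u \<in> pairs" "v \<in> pairs" "x = kboundary p (fst u)" "y = kboundary p (fst v)"
          by auto
        then show "x + y \<in> (\<lambda>(a, b). kboundary p a) ` pairs"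
          using p(2)[of u v] by (auto simp: image_iff kboundary.add intro: bexI[rotated])
      next
        fix r x assume "x \<in> (\<lambda>(a, b). kboundary p a) ` pairs"
        then obtain u where "u \<in> pairs" "x = kboundary p (fst u)" by auto
        then show "kscale r x \<in> (\<lambda>(a, b). kboundary p a) ` pairs"
          using p(3)[of u r] by (auto simp: image_iff kboundary.scale intro: bexI[rotated])
      qed
    qed
    moreover obtain SI :: "('a, 'k) kchain set" where "finite SI"
      "kcycles q ?I \<subseteq> kchain_space.span (SI \<union> kboundaries q ?I)"
      using fin_khomologyE[OF fI] Suc by (metis diff_Suc_1)
    ultimately have "fin_gen_mod C (kboundaries q ?I)"
      using fin_gen_mod_subspace by (metis (no_types, lifting) order_trans)
    then obtain S where S: "finite S" "S \<subseteq> C" "C \<subseteq> kchain_space.span (S \<union> kboundaries q ?I)"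
      by (auto simp: fin_gen_mod_def)
    have "\<forall>s\<in>S. \<exists>u. u \<in> pairs \<and> kboundary p (fst u) = s"
      using S(2) by (fastforce simp: C_def)
    then obtain f where f: "\<And>s. s \<in> S \<Longrightarrow> f s \<in> pairs" "\<And>s. s \<in> S \<Longrightarrow> kboundary p (fst (f s)) = s"
      by metis
    \<comment> \<open>Cycles of \<open>X\<close> that the connecting map sends to the generators
      \<open>S\<close>; the generators for \<open>U\<close> and \<open>V\<close> account for its
      kernel.\<close>
    define T where "T = (\<lambda>s. fst (f s) + snd (f s)) ` S"
    let ?sp = "kchain_space.span (SU \<union> SV \<union> T \<union> kboundaries p X)"
    have "kcycles p X \<subseteq> ?sp"
    proof
      fix z :: "('a, 'k) kchain" assume "z \<in> kcycles p X"
      then obtain a b where ab: "a \<in> kchains p (subtopology X U)" "b \<in> kchains p (subtopology X V)"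
          "kboundary p (a + b) = 0" "z - (a + b) \<in> kboundaries p X"
        using kcycle_split_open_cover[OF U V UV] by metis
      then have "kboundary p a \<in> C" by (force simp: C_def pairs_def)
      then obtain x y where xy: "kboundary p a = x + y" "x \<in> kchain_space.span S"
          "y \<in> kchain_space.span (kboundaries q ?I)"
        using S(3) by (auto simp: kchain_space.span_Un)
      then have "y \<in> kboundaries q ?I"
        using kchain_space.span_eq_iff subspace_kboundaries by blast
      then obtain e where e: "e \<in> kchains p ?I" "y = kboundary p e"
        using Suc by (auto simp: kboundaries_def)
      obtain u where u: "x = (\<Sum>s\<in>S. kscale (u s) s)"
        using xy(2) by (auto simp: kchain_space.span_finite[OF S(1)])
      \<comment> \<open>Correction of the splitting. Subtracting the combination
        \<open>a0 + b0\<close> of the chosen lifts leaves halves whose boundaries are plus and minus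
        \<open>y\<close>, and moving \<open>e\<close> from one half to the other makes each of them
        a cycle.\<close>
      define a0 where "a0 = (\<Sum>s\<in>S. kscale (u s) (fst (f s)))"
      define b0 where "b0 = (\<Sum>s\<in>S. kscale (u s) (snd (f s)))"
      have fU: "fst (f s) \<in> kchains p (subtopology X U)" and fV: "snd (f s) \<in> kchains p (subtopology X V)"
        and f0: "kboundary p (fst (f s)) + kboundary p (snd (f s)) = 0" if "s \<in> S" for s
        using f(1)[OF that] by (auto simp: pairs_def kboundary.add)
      have eU: "e \<in> kchains p (subtopology X U)" and eV: "e \<in> kchains p (subtopology X V)"
        using e(1) kchains_subtopology_Int by blast+
      have a0: "a0 \<in> kchains p (subtopology X U)" "kboundary p a0 = x"
        unfolding a0_def u using fU f(2)
        by (auto intro!: kchain_space.subspace_sum kchain_space.subspace_scale subspace_kchains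
            simp: kboundary.sum kboundary.scale)
      have "kboundary p a0 + kboundary p b0 = (\<Sum>s\<in>S. kscale (u s) 0)"
        unfolding a0_def b0_def
        by (simp only: kboundary.sum kboundary.scale flip: sum.distrib kchain_space.scale_right_distrib)
          (intro sum.cong refl, simp add: f0)
      then have b0: "b0 \<in> kchains p (subtopology X V)" "kboundary p b0 = - x"
        using fV a0(2) unfolding b0_def
        by (auto intro!: kchain_space.subspace_sum kchain_space.subspace_scale subspace_kchains
            simp: eq_neg_iff_add_eq_0 add.commute)
      have "a - a0 - e \<in> kcycles p (subtopology X U)"
        unfolding kcycles_def using ab(1) a0 eU e(2) xy(1)
        by (auto intro!: kchain_space.subspace_diff subspace_kchains simp: kboundary.diff)
      moreover have "kboundary p b = - (x + y)"
        using ab(3) xy(1) by (simp add: kboundary.add add_eq_0_iff)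
      then have "b - b0 + e \<in> kcycles p (subtopology X V)"
        unfolding kcycles_def using ab(2) b0 eV e(2)
        by (auto intro!: kchain_space.subspace_add kchain_space.subspace_diff subspace_kchains
            simp: kboundary.diff kboundary.add)
      moreover have "a0 + b0 \<in> ?sp"
      proof -
        have "a0 + b0 = (\<Sum>s\<in>S. kscale (u s) (fst (f s) + snd (f s)))"
          by (simp add: a0_def b0_def sum.distrib kchain_space.scale_right_distrib)
        also have "\<dots> \<in> ?sp"
          by (intro kchain_space.span_sum kchain_space.span_scale kchain_space.span_base)
            (auto simp: T_def)
        finally show ?thesis .
      qed
      moreover have "z - (a + b) \<in> ?sp" using ab(4) by (auto intro: kchain_space.span_base)
      ultimately have "(z - (a + b)) + ((a0 + b0) + ((a - a0 - e) + (b - b0 + e))) \<in> ?sp"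
        using spU[of T] spV[of T] by (meson kchain_space.span_add subsetD)
      then show "z \<in> ?sp" by simp
    qed
    then show ?thesis using SU(1) SV(1) S(1) by (intro fin_khomologyI) (auto simp: T_def)
  qed
qed

text \<open>Every cycle is homologous to its image under a constant map, a multiple of the single
  constant simplex \<open>s\<close>. That simplex need not be a cycle; \<open>fin_khomologyI\<close>
  asks only for a finite spanning set in the space of all chains.\<close>

lemma fin_khomology_contractible_space:
  fixes X :: "'a topology"
  assumes "contractible_space X"
  shows "fin_khomology TYPE('k::field) p X"
proof -
  obtain a where "homotopic_with (\<lambda>x. True) X X id (\<lambda>x. a)"
    using assms by (auto simp: contractible_space_def)
  then have hom: "homotopic_with (\<lambda>x. True) X X (\<lambda>x. a) id"
    by (rule homotopic_with_symD)
  define s :: "('a, 'k) kchain" where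
    "s = Poly_Mapping.single (restrict (\<lambda>x. a) (standard_simplex p)) 1"
  have "z \<in> kchain_space.span ({s} \<union> kboundaries p X)" if z: "z \<in> kcycles p X" for z
  proof -
    have "simplex_map p (\<lambda>x. a) f = restrict (\<lambda>x. a) (standard_simplex p)" for f :: "_ \<Rightarrow> 'a"
      by (auto simp: simplex_map_def)
    then have "kmap p (\<lambda>x. a) z = (\<Sum>f\<in>Poly_Mapping.keys z. kscale (Poly_Mapping.lookup z f) s)"
      by (simp add: kmap_def klin_def s_def kemb_frag_of)
    also have "\<dots> \<in> kchain_space.span ({s} \<union> kboundaries p X)"
      by (intro kchain_space.span_sum kchain_space.span_scale kchain_space.span_base) auto
    finally have 1: "kmap p (\<lambda>x. a) z \<in> kchain_space.span ({s} \<union> kboundaries p X)" .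
    have "kmap p id z - kmap p (\<lambda>x. a) z \<in> kboundaries p X"
      by (rule homotopic_with_imp_kboundaries[OF hom z])
    moreover have "kmap p id z = z"
      using z by (intro kmap_ident) (auto simp: kcycles_def)
    ultimately have "z - kmap p (\<lambda>x. a) z \<in> kchain_space.span ({s} \<union> kboundaries p X)"
      by (auto intro: kchain_space.span_base)
    from kchain_space.span_add[OF this 1] show ?thesis by simp
  qed
  then show ?thesis by (intro fin_khomologyI[of "{s}"]) auto
qed

lemma fin_khomology_Union_convex_open:
  fixes \<C> :: "'e::real_normed_vector set set"
  assumes "finite \<C>" "\<And>C. C \<in> \<C> \<Longrightarrow> open C \<and> convex C"
  shows "fin_khomology TYPE('k::field) p (top_of_set (\<Union>\<C>))"
proof -
  \<comment> \<open>The extra convex open set \<open>K\<close> closes the induction: the overlap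
    with a new member \<open>B\<close> has the same form with \<open>K \<inter> B\<close> for
    \<open>K\<close>. The degree also varies, because Mayer--Vietoris lowers it.\<close>
  have "fin_khomology TYPE('k::field) p (top_of_set (K \<inter> \<Union>\<C>))" if "open K" "convex K" for K
    using assms that
  proof (induction \<C> arbitrary: p K rule: finite_induct)
    case empty
    then show ?case by (intro fin_khomology_contractible_space) simp
  next
    case (insert B \<C>)
    let ?X = "top_of_set (K \<inter> \<Union>(insert B \<C>))"
    have B: "open B" "convex B" using insert.prems by auto
    have op: "open (K \<inter> \<Union>\<C>)" "open (K \<inter> B)" using insert.prems by auto
    have sub: "subtopology ?X (K \<inter> \<Union>\<C>) = top_of_set (K \<inter> \<Union>\<C>)"
      "subtopology ?X (K \<inter> B) = top_of_set (K \<inter> B)"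
      "subtopology ?X ((K \<inter> \<Union>\<C>) \<inter> (K \<inter> B)) = top_of_set ((K \<inter> B) \<inter> \<Union>\<C>)"
      unfolding subtopology_subtopology by (auto intro!: arg_cong[of _ _ top_of_set])
    show ?case
    proof (rule fin_khomology_open_Un[of _ "K \<inter> \<Union>\<C>" "K \<inter> B"])
      show "openin ?X (K \<inter> \<Union>\<C>)" "openin ?X (K \<inter> B)"
        using op by (auto simp: openin_open intro: exI[of _ "K \<inter> \<Union>\<C>"] exI[of _ "K \<inter> B"])
      show "fin_khomology TYPE('k::field) p (subtopology ?X (K \<inter> \<Union>\<C>))"
        unfolding sub using insert by auto
      show "fin_khomology TYPE('k::field) p (subtopology ?X (K \<inter> B))"
        unfolding sub using insert.prems B
        by (intro fin_khomology_contractible_space) (simp add: convex_Int convex_imp_contractible)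
      show "fin_khomology TYPE('k::field) (p - 1) (subtopology ?X ((K \<inter> \<Union>\<C>) \<inter> (K \<inter> B)))"
        unfolding sub using insert B by (intro insert.IH) (auto simp: convex_Int)
    qed auto
  qed
  from this[of UNIV] show ?thesis by simp
qed

text \<open>A compact retract of an open set is also a retract of a finite union of balls.\<close>

lemma fin_khomology_open_retract:
  fixes X :: "'a topology" and U :: "'e::real_normed_vector set"
  assumes X: "compact_space X" and U: "open U"
    and i: "continuous_map X (top_of_set U) i" and r: "continuous_map (top_of_set U) X r"
    and ri: "\<And>x. x \<in> topspace X \<Longrightarrow> r (i x) = x"
  shows "fin_khomology TYPE('k::field) p X"
proof -
  have iU: "i ` topspace X \<subseteq> U" using i by (auto simp: continuous_map_def)
  have "compactin euclidean (i ` topspace X)"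
    using image_compactin[of X "topspace X" euclidean i] X i
    by (simp add: compact_space_def continuous_map_in_subtopology)
  then have comp: "compact (i ` topspace X)" by simp
  have "\<forall>y\<in>i ` topspace X. \<exists>e>0. ball y e \<subseteq> U"
    using U iU by (meson open_contains_ball subsetD)
  then obtain e where e: "\<And>y. y \<in> i ` topspace X \<Longrightarrow> e y > 0 \<and> ball y (e y) \<subseteq> U"
    by metis
  have "i ` topspace X \<subseteq> (\<Union>y\<in>i ` topspace X. ball y (e y))"
    using e by fastforce
  from compactE_image[OF comp _ this]
  obtain Y where Y: "Y \<subseteq> i ` topspace X" "finite Y" "i ` topspace X \<subseteq> (\<Union>y\<in>Y. ball y (e y))"
    by auto
  define W where "W = \<Union>((\<lambda>y. ball y (e y)) ` Y)"
  have WU: "W \<subseteq> U" using e Y(1) unfolding W_def by blast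
  have iW: "continuous_map X (top_of_set W) i"
    using i Y(3) by (auto simp: continuous_map_in_subtopology W_def)
  have rW: "continuous_map (top_of_set W) X r"
    using r WU by (metis continuous_map_from_subtopology subtopology_subtopology inf.absorb_iff2)
  have "fin_khomology TYPE('k::field) p (top_of_set W)"
    unfolding W_def using Y(2) by (intro fin_khomology_Union_convex_open) auto
  then obtain S :: "('e, 'k) kchain set" where S: "finite S"
      "kcycles p (top_of_set W) \<subseteq> kchain_space.span (S \<union> kboundaries p (top_of_set W))"
    by (auto elim: fin_khomologyE)
  have "z \<in> kchain_space.span (kmap p r ` S \<union> kboundaries p X)" if z: "z \<in> kcycles p X" for z
  proof -
    have "kmap p i z \<in> kchain_space.span (S \<union> kboundaries p (top_of_set W))"
      using S(2) kmap_in_kcycles[OF z iW] by blast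
    then have "kmap p r (kmap p i z) \<in> kchain_space.span (kmap p r ` (S \<union> kboundaries p (top_of_set W)))"
      by (simp only: kmap.span_image) blast
    also have "\<dots> \<subseteq> kchain_space.span (kmap p r ` S \<union> kboundaries p X)"
      using kmap_in_kboundaries[OF _ rW] by (intro kchain_space.span_mono) auto
    also have "kmap p r (kmap p i z) = z"
      using z ri unfolding kmap_compose by (intro kmap_ident) (auto simp: kcycles_def)
    finally show ?thesis .
  qed
  then show ?thesis using S(1) by (intro fin_khomologyI[of "kmap p r ` S"]) auto
qed

text \<open>The inclusion of \<open>X\<close> into \<open>Y\<close> induces a bijection on homology,
  said on representatives: first surjectivity, then injectivity.\<close>

definition kincl_iso :: "'k::field itself \<Rightarrow> nat \<Rightarrow> 'a topology \<Rightarrow> 'a topology \<Rightarrow> bool" where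
  "kincl_iso _ p X Y \<longleftrightarrow>
     (\<forall>z \<in> kcycles p Y :: ('a, 'k::field) kchain set. \<exists>z'\<in>kcycles p X. z - z' \<in> kboundaries p Y) \<and>
     (kcycles p X \<inter> kboundaries p Y :: ('a, 'k::field) kchain set) \<subseteq> kboundaries p X"

text \<open>The homotopy from \<open>r\<close> to the identity gives surjectivity. For injectivity,
  \<open>r\<close> carries a bounding chain in \<open>Y\<close> into \<open>X\<close> and leaves a
  cycle of \<open>X\<close> unchanged.\<close>

lemma kincl_iso_deformation_retract:
  assumes r: "continuous_map Y X r" "\<And>x. x \<in> topspace X \<Longrightarrow> r x = x"
    and XY: "continuous_map X Y id" and hom: "homotopic_with (\<lambda>h. True) Y Y r id"
  shows "kincl_iso TYPE('k::field) p X (Y :: 'a topology)"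
  unfolding kincl_iso_def
proof (intro conjI ballI subsetI)
  fix z :: "('a, 'k) kchain" assume z: "z \<in> kcycles p Y"
  have "kmap p id z = z" using z by (intro kmap_ident) (auto simp: kcycles_def)
  then have "z - kmap p r z \<in> kboundaries p Y"
    using homotopic_with_imp_kboundaries[OF hom z] by simp
  then show "\<exists>z'\<in>kcycles p X. z - z' \<in> kboundaries p Y"
    using kmap_in_kcycles[OF z r(1)] by blast
next
  fix z :: "('a, 'k) kchain" assume z: "z \<in> kcycles p X \<inter> kboundaries p Y"
  then have "kmap p r z = z" using r(2) by (intro kmap_ident) (auto simp: kcycles_def)
  moreover have "kmap p r z \<in> kboundaries p X"
    using z r(1) by (intro kmap_in_kboundaries) auto
  ultimately show "z \<in> kboundaries p X" by simp
qed


section \<open>Subquotients and persistence diagrams\<close>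

lemma kcoset_eq_iff:
  assumes "kchain_space.subspace B"
  shows "kcoset B u = kcoset B v \<longleftrightarrow> u - v \<in> B"
proof
  have "u + 0 \<in> kcoset B u"
    unfolding kcoset_def using kchain_space.subspace_0[OF assms] by blast
  moreover assume "kcoset B u = kcoset B v"
  ultimately have "u \<in> kcoset B v" by simp
  then show "u - v \<in> B" by (auto simp: kcoset_def)
next
  assume uv: "u - v \<in> B"
  have "u + b = v + ((u - v) + b)" "v + b = u + (b - (u - v))" for b by simp_all
  then show "kcoset B u = kcoset B v"
    using kchain_space.subspace_add[OF assms uv] kchain_space.subspace_diff[OF assms _ uv]
    unfolding kcoset_def by blast
qed

lemma kcoset_0: "kcoset B 0 = B"
  by (auto simp: kcoset_def)

lemma kcoset_add:
  assumes "kchain_space.subspace B"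
  shows "{u + v |u v. u \<in> kcoset B x \<and> v \<in> kcoset B y} = kcoset B (x + y)"
proof -
  have "(x + b) + (y + b') = (x + y) + (b + b')" "(x + y) + b = (x + b) + (y + 0)" for b b'
    by simp_all
  then show ?thesis
    using kchain_space.subspace_add[OF assms] kchain_space.subspace_0[OF assms]
    unfolding kcoset_def by blast
qed

lemma kcoset_scale:
  assumes "kchain_space.subspace B"
  shows "{kscale a u + b |u b. u \<in> kcoset B x \<and> b \<in> B} = kcoset B (kscale a x)"
proof -
  have "kscale a (x + b) + b' = kscale a x + (kscale a b + b')" "kscale a x + b = kscale a (x + 0) + b"
    for b b' by (simp_all add: kchain_space.scale_right_distrib)
  then show ?thesis
    using kchain_space.subspace_add[OF assms] kchain_space.subspace_0[OF assms]
      kchain_space.subspace_scale[OF assms]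
    unfolding kcoset_def by blast
qed

lemma kcoset_incl:
  assumes "kchain_space.subspace B'" "B \<subseteq> B'" "kchain_space.subspace B"
  shows "{u + b |u b. u \<in> kcoset B x \<and> b \<in> B'} = kcoset B' x"
proof -
  have "(x + b) + b' = x + (b + b')" "x + b = (x + 0) + b" for b b'
    by simp_all
  then show ?thesis
    using kchain_space.subspace_add[OF assms(1)] kchain_space.subspace_0[OF assms(3)] assms(2)
    unfolding kcoset_def by blast
qed

text \<open>Passage from subspaces of the type of chains to the carrier-based vector spaces in which
  \<open>fin_dim\<close> and \<open>dim\<close> are expressed.\<close>

locale ksubquotient =
  fixes Z B :: "('b \<Rightarrow>\<^sub>0 'k::field) set"
  assumes Z: "kchain_space.subspace Z" and B: "kchain_space.subspace B" and BZ: "B \<subseteq> Z"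
begin

lemma kquotient_simps [simp]:
  "carrier (kquotient Z B) = kcoset B ` Z" "\<zero>\<^bsub>kquotient Z B\<^esub> = kcoset B 0"
  "kcoset B x \<oplus>\<^bsub>kquotient Z B\<^esub> kcoset B y = kcoset B (x + y)"
  "a \<odot>\<^bsub>kquotient Z B\<^esub> kcoset B x = kcoset B (kscale a x)"
  by (simp_all add: kquotient_def kcoset_0 kcoset_add[OF B] kcoset_scale[OF B])

lemma vectorspace_kquotient: "vectorspace class_ring (kquotient Z B)"
proof -
  have "abelian_group (kquotient Z B)"
  proof (rule abelian_groupI)
    show "\<exists>y\<in>carrier (kquotient Z B). y \<oplus>\<^bsub>kquotient Z B\<^esub> x = \<zero>\<^bsub>kquotient Z B\<^esub>"
      if x: "x \<in> carrier (kquotient Z B)" for x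
    proof -
      obtain z where "z \<in> Z" "x = kcoset B z" using x by auto
      then show ?thesis
        using kchain_space.subspace_neg[OF Z] by (intro bexI[of _ "kcoset B (- z)"]) auto
    qed
  qed (auto simp: add_ac intro: kchain_space.subspace_add[OF Z] kchain_space.subspace_0[OF Z])
  then have "module class_ring (kquotient Z B)"
    by (intro moduleI class_cring.is_cring)
      (auto simp: class_ring_simps kchain_space.scale_left_distrib kchain_space.scale_right_distrib
        intro: kchain_space.subspace_scale[OF Z])
  then show ?thesis
    by (intro vectorspace.intro class_field)
qed

lemma fin_dim_kquotient:
  assumes "fin_gen_mod Z B"
  shows "vectorspace.fin_dim class_ring (kquotient Z B)"
proof -
  interpret V: vectorspace class_ring "kquotient Z B" by (rule vectorspace_kquotient)
  obtain S where S: "finite S" "S \<subseteq> Z" "Z \<subseteq> kchain_space.span (S \<union> B)"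
    using assms by (auto simp: fin_gen_mod_def)
  let ?A = "kcoset B ` S"
  have A: "?A \<subseteq> carrier (kquotient Z B)" using S(2) by auto
  have sm: "submodule class_ring (V.span ?A) (kquotient Z B)"
    by (rule V.span_is_submodule[OF A])
  have "kcoset B z \<in> V.span ?A" if "z \<in> kchain_space.span (S \<union> B)" for z
    using that
  proof (induction rule: kchain_space.span_induct)
    case base
    show ?case unfolding mem_Collect_eq kchain_space.subspace_def
      using submodule.zero_closed[OF sm] submodule.m_closed[OF sm] submodule.smult_closed[OF sm]
      by (auto simp: class_ring_simps simp flip: kquotient_simps(3,4))
  next
    case (step z)
    show ?case
    proof (cases "z \<in> S")
      case True
      then show ?thesis using V.in_own_span[OF A] by auto
    next
      case False
      then have "kcoset B z = kcoset B 0" using step by (auto simp: kcoset_eq_iff[OF B])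
      then show ?thesis using submodule.zero_closed[OF sm] by simp
    qed
  qed
  then have "V.gen_set ?A"
    using S(3) V.span_is_subset2[OF A] by auto
  then show ?thesis
    unfolding V.fin_dim_def using S(1) A by blast
qed

end

text \<open>The hypotheses \<open>inj\<close> and \<open>surj\<close> say that the map from
  \<open>Z / B\<close> to \<open>Z' / B'\<close> induced by the inclusion is bijective.\<close>

lemma kquotient_incl_dim_eq:
  assumes "ksubquotient Z B" "ksubquotient Z' B'" "Z \<subseteq> Z'" "B \<subseteq> B'"
    and inj: "Z \<inter> B' \<subseteq> B" and surj: "Z' \<subseteq> {z + b |z b. z \<in> Z \<and> b \<in> B'}"
    and fin: "fin_gen_mod Z B"
  shows "vectorspace.dim class_ring (kquotient Z B) = vectorspace.dim class_ring (kquotient Z' B')"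
proof -
  interpret ZB: ksubquotient Z B by fact
  interpret ZB': ksubquotient Z' B' by fact
  interpret V: vectorspace class_ring "kquotient Z B" by (rule ZB.vectorspace_kquotient)
  interpret V': vectorspace class_ring "kquotient Z' B'" by (rule ZB'.vectorspace_kquotient)
  define T where "T U = {u + b |u b. u \<in> U \<and> b \<in> B'}" for U
  have T: "T (kcoset B z) = kcoset B' z" for z
    unfolding T_def by (rule kcoset_incl[OF ZB'.B assms(4) ZB.B])
  have "T \<in> module_hom class_ring (kquotient Z B) (kquotient Z' B')"
    using assms(3) by (auto simp: module_hom_def T class_ring_simps)
  then interpret linear_map class_ring "kquotient Z B" "kquotient Z' B'" T
    by unfold_locales
  show ?thesis
  proof (rule dim_eq)
    show "V.fin_dim" by (rule ZB.fin_dim_kquotient[OF fin])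
    show "inj_on T (carrier (kquotient Z B))"
      using inj kchain_space.subspace_diff[OF ZB.Z]
      by (auto simp: inj_on_def T kcoset_eq_iff[OF ZB.B] kcoset_eq_iff[OF ZB'.B])
    have "kcoset B' (z + b) = kcoset B' z" if "b \<in> B'" for z b
      using that by (simp add: kcoset_eq_iff[OF ZB'.B])
    then have "kcoset B' ` Z' \<subseteq> kcoset B' ` Z"
      using surj by fastforce
    then have "kcoset B' ` Z = kcoset B' ` Z'"
      using assms(3) by blast
    then show "T ` carrier (kquotient Z B) = carrier (kquotient Z' B')"
      by (simp add: T image_image)
  qed
qed

lemma ksubquotient_khomology: "ksubquotient (kcycles p X) (kboundaries p X)"
  by unfold_locales (auto intro: subspace_kcycles subspace_kboundaries subsetD[OF kboundaries_subset_kcycles])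

lemma fin_dim_khomology:
  assumes "fin_khomology TYPE('k::field) p X"
  shows "vectorspace.fin_dim (class_ring :: 'k ring) (khomology p X)"
  unfolding khomology_def
  by (rule ksubquotient.fin_dim_kquotient[OF ksubquotient_khomology])
    (use assms in \<open>simp add: fin_khomology_def\<close>)

section \<open>Persistence modules of sublevel sets that change at finitely many levels\<close>

context
  fixes X :: "'a topology" and f :: "'a \<Rightarrow> real" and p :: nat and C :: "real set"
  assumes fin: "\<And>t. fin_khomology TYPE('k::field) p (sublevel_space X f t)"
    and finC: "finite C"
    and iso: "\<And>s t. s < t \<Longrightarrow> {s<..t} \<inter> C = {} \<Longrightarrow>
      kincl_iso TYPE('k::field) p (sublevel_space X f s) (sublevel_space X f t)"
begin

abbreviation (input) Zt :: "real \<Rightarrow> ('a, 'k::field) kchain set" where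
  "Zt t \<equiv> kcycles p (sublevel_space X f t)"

abbreviation (input) Bt :: "real \<Rightarrow> ('a, 'k::field) kchain set" where
  "Bt t \<equiv> kboundaries p (sublevel_space X f t)"

text \<open>The image of the homology at level \<open>s\<close> in that at level \<open>t\<close> is
  \<open>Wt s t\<close> modulo \<open>Bt t\<close>, so the rank is the dimension of this
  subquotient.\<close>

abbreviation (input) Wt :: "real \<Rightarrow> real \<Rightarrow> ('a, 'k::field) kchain set" where
  "Wt s t \<equiv> {z + b |z b. z \<in> Zt s \<and> b \<in> Bt t}"

lemma sublevel_kcycles_mono: "s \<le> t \<Longrightarrow> Zt s \<subseteq> Zt t"
  unfolding sublevel_space_def by (rule kcycles_mono) auto

lemma sublevel_kboundaries_mono: "s \<le> t \<Longrightarrow> Bt s \<subseteq> Bt t"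
  unfolding sublevel_space_def by (rule kboundaries_mono) auto

lemma ksubquotient_Wt: "ksubquotient (Wt s t) (Bt t)"
proof
  show "kchain_space.subspace (Wt s t)"
    using kchain_space.subspace_sums[OF subspace_kcycles subspace_kboundaries] .
  show "Bt t \<subseteq> Wt s t"
    using kchain_space.subspace_0[OF subspace_kcycles] by force
qed (rule subspace_kboundaries)

lemma persistence_rank_eq_dim:
  assumes "s \<le> t"
  shows "persistence_rank (sublevel_homology p X f :: real \<Rightarrow> ('k, ('a, 'k) kchain set) module)
      (sublevel_map p X f) (ereal s) (ereal t) =
    vectorspace.dim class_ring (kquotient (Wt s t) (Bt t))"
proof -
  have "sublevel_map p X f s t (kcoset (Bt s) z) = kcoset (Bt t) z" for z
    unfolding sublevel_map_def khomology_incl_def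
    by (rule kcoset_incl[OF subspace_kboundaries sublevel_kboundaries_mono[OF assms] subspace_kboundaries])
  then have "sublevel_map p X f s t ` carrier (sublevel_homology p X f s) = kcoset (Bt t) ` Zt s"
    by (simp add: sublevel_homology_def khomology_def kquotient_def image_image)
  also have "\<dots> = kcoset (Bt t) ` Wt s t"
  proof -
    have "kcoset (Bt t) (z + b) = kcoset (Bt t) z" if "b \<in> Bt t" for z b
      using that by (simp add: kcoset_eq_iff[OF subspace_kboundaries])
    moreover have "z = z + 0" "0 \<in> Bt t" for z :: "('a, 'k) kchain"
      by (simp_all add: kchain_space.subspace_0[OF subspace_kboundaries])
    ultimately show ?thesis by (auto simp: image_iff)
  qed
  finally have im: "sublevel_map p X f s t ` carrier (sublevel_homology p X f s) = kcoset (Bt t) ` Wt s t" .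
  show ?thesis
    by (simp add: persistence_rank_def im)
      (simp add: sublevel_homology_def khomology_def kquotient_def)
qed

lemma fin_gen_mod_Wt:
  assumes "s \<le> t"
  shows "fin_gen_mod (Wt s t) (Bt t)"
proof -
  obtain S :: "('a, 'k) kchain set" where S: "finite S" "Zt s \<subseteq> kchain_space.span (S \<union> Bt s)"
    using fin_khomologyE[OF fin] by metis
  have "kchain_space.span (S \<union> Bt s) \<subseteq> kchain_space.span (S \<union> Bt t)"
    using sublevel_kboundaries_mono[OF assms] by (intro kchain_space.span_mono) auto
  then have "Wt s t \<subseteq> kchain_space.span (S \<union> Bt t)"
    using S(2) by (auto intro!: kchain_space.span_add intro: kchain_space.span_base)
  then show ?thesis
    using fin_gen_mod_subspace[OF S(1)] ksubquotient.Z[OF ksubquotient_Wt] by blast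
qed

text \<open>Homology at \<open>s\<close> surjects onto homology at \<open>s'\<close>, so both have
  the same image at level \<open>t\<close>: the spaces \<open>Wt s t\<close> and
  \<open>Wt s' t\<close> are equal.\<close>

lemma persistence_rank_cong_left:
  assumes "s < s'" "s' \<le> t" "{s<..s'} \<inter> C = {}"
  shows "persistence_rank (sublevel_homology p X f :: real \<Rightarrow> ('k, ('a, 'k) kchain set) module)
      (sublevel_map p X f) (ereal s) (ereal t) =
    persistence_rank (sublevel_homology p X f :: real \<Rightarrow> ('k, ('a, 'k) kchain set) module)
      (sublevel_map p X f) (ereal s') (ereal t)"
proof -
  have "Wt s' t \<subseteq> Wt s t"
  proof
    fix w assume "w \<in> Wt s' t"
    then obtain z b where w: "w = z + b" "z \<in> Zt s'" "b \<in> Bt t" by auto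
    then obtain z' where z': "z' \<in> Zt s" "z - z' \<in> Bt s'"
      using iso[OF assms(1,3)] unfolding kincl_iso_def by blast
    then have "z - z' + b \<in> Bt t"
      using sublevel_kboundaries_mono[OF assms(2)] w(3)
      by (intro kchain_space.subspace_add[OF subspace_kboundaries]) auto
    moreover have "w = z' + (z - z' + b)" using w(1) by simp
    ultimately show "w \<in> Wt s t" using z'(1) by blast
  qed
  moreover have "Wt s t \<subseteq> Wt s' t"
    using sublevel_kcycles_mono[of s s'] assms(1) by auto
  ultimately have "Wt s t = Wt s' t" by blast
  then show ?thesis using assms by (simp add: persistence_rank_eq_dim)
qed

text \<open>Homology at \<open>t\<close> injects into homology at \<open>t'\<close>, and so does the
  image of level \<open>s\<close>: the two subquotients are isomorphic, though not equal.\<close>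

lemma persistence_rank_cong_right:
  assumes "s \<le> t" "t < t'" "{t<..t'} \<inter> C = {}"
  shows "persistence_rank (sublevel_homology p X f :: real \<Rightarrow> ('k, ('a, 'k) kchain set) module)
      (sublevel_map p X f) (ereal s) (ereal t) =
    persistence_rank (sublevel_homology p X f :: real \<Rightarrow> ('k, ('a, 'k) kchain set) module)
      (sublevel_map p X f) (ereal s) (ereal t')"
proof -
  have Btt': "Bt t \<subseteq> Bt t'" using sublevel_kboundaries_mono assms(2) by simp
  have "vectorspace.dim class_ring (kquotient (Wt s t) (Bt t)) =
      vectorspace.dim class_ring (kquotient (Wt s t') (Bt t'))"
  proof (rule kquotient_incl_dim_eq[OF ksubquotient_Wt ksubquotient_Wt])
    show "Wt s t \<subseteq> Wt s t'" using Btt' by blast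
    have "Wt s t \<subseteq> Zt t"
      using sublevel_kcycles_mono[OF assms(1)] kboundaries_subset_kcycles
      by (auto intro!: kchain_space.subspace_add[OF subspace_kcycles])
    then show "Wt s t \<inter> Bt t' \<subseteq> Bt t"
      using iso[OF assms(2,3)] unfolding kincl_iso_def by blast
    show "Wt s t' \<subseteq> {z + b |z b. z \<in> Wt s t \<and> b \<in> Bt t'}"
    proof
      fix w assume "w \<in> Wt s t'"
      then obtain z b where "w = z + b" "z \<in> Zt s" "b \<in> Bt t'" by auto
      moreover from this have "z + 0 \<in> Wt s t"
        using kchain_space.subspace_0[OF subspace_kboundaries] by blast
      ultimately show "w \<in> {z + b |z b. z \<in> Wt s t \<and> b \<in> Bt t'}" by auto
    qed
  qed (use Btt' fin_gen_mod_Wt[OF assms(1)] in auto)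
  then show ?thesis using assms by (simp add: persistence_rank_eq_dim)
qed

text \<open>A multiplicity is a minimum, so one rectangle with alternating sum 0 makes it vanish. If
  \<open>b\<close> is not critical, a thin rectangle about \<open>b\<close> reaching up to infinity
  has equal ranks at its two lower corners and zero ranks at the upper ones; if \<open>d\<close> is
  not critical, a thin one about \<open>d\<close> starting at minus infinity works likewise.\<close>

lemma finite_persistence_diagram:
  "finite {q. persistence_diagram
     (sublevel_homology p X f :: real \<Rightarrow> ('k, ('a, 'k) kchain set) module)
     (sublevel_map p X f) q \<noteq> 0}"
proof -
  define r where "r s t = int (persistence_rank
     (sublevel_homology p X f :: real \<Rightarrow> ('k, ('a, 'k) kchain set) module) (sublevel_map p X f) s t)" for s t
  \<comment> \<open>With the infinities included, a coordinate outside \<open>E\<close> is a real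
    number and has a neighbourhood free of critical levels.\<close>
  define E where "E = {-\<infinity>, \<infinity>} \<union> ereal ` C"
  have isolated: "\<exists>\<epsilon>>0. {\<beta> - \<epsilon>..\<beta> + \<epsilon>} \<inter> C = {}" if \<beta>: "\<beta> \<notin> C" for \<beta>
  proof -
    have "open (- C)" using finC by (simp add: finite_imp_closed open_Compl)
    then obtain \<epsilon> where "\<epsilon> > 0" "cball \<beta> \<epsilon> \<subseteq> - C"
      using \<beta> unfolding open_contains_cball by blast
    then show ?thesis by (intro exI[of _ \<epsilon>]) (auto simp: cball_eq_atLeastAtMost)
  qed
  have zero: "persistence_diagram (sublevel_homology p X f :: real \<Rightarrow> ('k, ('a, 'k) kchain set) module)
     (sublevel_map p X f) (b, d) = 0"
    if "a < b'" "b' < c" "c < d'" "b \<in> interior {a..b'}" "d \<in> interior {c..d'}"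
      "r b' c - r a c - r b' d' + r a d' = 0" for a b b' c d d'
  proof (cases "b < d")
    case True
    have "(b, d) \<in> interior ({a..b'} \<times> {c..d'})"
      using that(4,5) by (simp add: interior_Times)
    then have "(LEAST m. \<exists>a b' c d'. a < b' \<and> b' < c \<and> c < d' \<and>
        (b, d) \<in> interior ({a..b'} \<times> {c..d'}) \<and> int m = r b' c - r a c - r b' d' + r a d') = 0"
      using that by (intro Least_eq_0 exI conjI) auto
    then show ?thesis
      by (simp add: persistence_diagram_def r_def)
  qed (simp add: persistence_diagram_def)
  have infty: "r s t = 0" if "\<bar>s\<bar> = \<infinity> \<or> \<bar>t\<bar> = \<infinity>" for s t
    using that by (auto simp: r_def persistence_rank_def)
  have below: "b \<in> interior {-\<infinity>..b'}" if "b < b'" for b b' :: ereal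
    by (rule interiorI[of "{..<b'}"]) (use that in auto)
  have above: "d \<in> interior {c..\<infinity>}" if "c < d" for c d :: ereal
    by (rule interiorI[of "{c<..}"]) (use that in auto)
  have between: "b \<in> interior {a..b'}" if "a < b" "b < b'" for a b b' :: ereal
    by (rule interiorI[of "{a<..<b'}"]) (use that in auto)
  have "(b, d) \<in> E \<times> E"
    if q: "persistence_diagram (sublevel_homology p X f :: real \<Rightarrow> ('k, ('a, 'k) kchain set) module)
      (sublevel_map p X f) (b, d) \<noteq> 0" for b d
  proof (rule ccontr)
    assume notE: "(b, d) \<notin> E \<times> E"
    have bd: "b < d"
      using q by (auto simp: persistence_diagram_def split: if_splits)
    show False
    proof (cases "b \<in> E")
      case False
      then obtain \<beta> where \<beta>: "b = ereal \<beta>" "\<beta> \<notin> C"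
        by (cases b) (auto simp: E_def)
      then obtain \<epsilon> where \<epsilon>: "\<epsilon> > 0" "{\<beta> - \<epsilon>..\<beta> + \<epsilon>} \<inter> C = {}" using isolated by blast
      obtain m where m: "b < m" "m < d" using bd dense by blast
      then obtain \<mu> where \<mu>: "m = ereal \<mu>" using \<beta> by (cases m) auto
      \<comment> \<open>The right side must stay both in the critical-free interval about
        \<open>\<beta>\<close> and strictly below \<open>d\<close>. As \<open>d\<close> may be
        infinite, the second bound is taken from the real number \<open>\<mu>\<close> between
        them.\<close>
      define \<beta>' where "\<beta>' = min (\<beta> + \<epsilon>) \<mu>"
      have bm: "ereal \<beta>' \<le> m" by (simp add: \<beta>'_def \<mu>)
      have \<beta>': "\<beta> < \<beta>'" "ereal \<beta>' < d" "\<beta>' \<le> \<beta> + \<epsilon>"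
        using \<epsilon>(1) m(1) \<beta>(1) le_less_trans[OF bm m(2)] by (simp_all add: \<beta>'_def \<mu> del: ereal_min)
      obtain c where c: "ereal \<beta>' < c" "c < d" using \<beta>'(2) dense by blast
      then obtain \<gamma> where \<gamma>: "c = ereal \<gamma>" by (cases c) auto
      have "{\<beta> - \<epsilon><..\<beta>'} \<subseteq> {\<beta> - \<epsilon>..\<beta> + \<epsilon>}" using \<beta>'(3) by auto
      then have "{\<beta> - \<epsilon><..\<beta>'} \<inter> C = {}" using \<epsilon>(2) by blast
      then have "r (ereal (\<beta> - \<epsilon>)) c = r (ereal \<beta>') c"
        unfolding r_def \<gamma> using \<epsilon>(1) \<beta>'(1) c(1) \<gamma> by (subst persistence_rank_cong_left) auto
      then show False
        using zero[of "ereal (\<beta> - \<epsilon>)" "ereal \<beta>'" c \<infinity> b d] between[of "ereal (\<beta> - \<epsilon>)" b "ereal \<beta>'"]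
          above[OF c(2)] c \<beta>(1) \<beta>'(1) \<epsilon>(1) infty q \<gamma> by auto
    next
      case True
      then have "d \<notin> E" using notE by auto
      then obtain \<delta> where \<delta>: "d = ereal \<delta>" "\<delta> \<notin> C"
        by (cases d) (auto simp: E_def)
      then obtain \<epsilon> where \<epsilon>: "\<epsilon> > 0" "{\<delta> - \<epsilon>..\<delta> + \<epsilon>} \<inter> C = {}" using isolated by blast
      obtain m where m: "b < m" "m < d" using bd dense by blast
      then obtain \<mu> where \<mu>: "m = ereal \<mu>" using \<delta> by (cases m) auto
      \<comment> \<open>Dual choice: \<open>\<gamma>\<close> stays within \<open>\<epsilon>\<close>
        of \<open>\<delta>\<close> and strictly above \<open>b\<close>, which may be minus
        infinity.\<close>
      define \<gamma> where "\<gamma> = max (\<delta> - \<epsilon>) \<mu>"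
      have mg: "m \<le> ereal \<gamma>" by (simp add: \<gamma>_def \<mu>)
      have \<gamma>: "\<gamma> < \<delta>" "b < ereal \<gamma>" "\<delta> - \<epsilon> \<le> \<gamma>"
        using \<epsilon>(1) m(2) \<delta>(1) less_le_trans[OF m(1) mg] by (simp_all add: \<gamma>_def \<mu> del: ereal_max)
      obtain b' where b': "b < b'" "b' < ereal \<gamma>" using \<gamma>(2) dense by blast
      then obtain \<beta> where \<beta>: "b' = ereal \<beta>" by (cases b') auto
      have "{\<gamma><..\<delta> + \<epsilon>} \<subseteq> {\<delta> - \<epsilon>..\<delta> + \<epsilon>}" using \<gamma>(3) by auto
      then have "{\<gamma><..\<delta> + \<epsilon>} \<inter> C = {}" using \<epsilon>(2) by blast
      then have "r b' (ereal \<gamma>) = r b' (ereal (\<delta> + \<epsilon>))"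
        unfolding r_def \<beta> using \<epsilon>(1) \<gamma>(1) b'(2) \<beta> by (subst persistence_rank_cong_right) auto
      then show False
        using zero[of "-\<infinity>" b' "ereal \<gamma>" "ereal (\<delta> + \<epsilon>)" b d] below[OF b'(1)]
          between[of "ereal \<gamma>" d "ereal (\<delta> + \<epsilon>)"] b' \<gamma> \<epsilon>(1) \<delta>(1) infty q \<beta> by auto
    qed
  qed
  then have "{q. persistence_diagram (sublevel_homology p X f :: real \<Rightarrow> ('k, ('a, 'k) kchain set) module)
     (sublevel_map p X f) q \<noteq> 0} \<subseteq> E \<times> E"
    by auto
  then show ?thesis
    by (rule finite_subset) (simp add: E_def finC)
qed

end


section \<open>Cellular retractions and the space of pairs\<close>

text \<open>One lemma for both dimensions: on a grid line the cells are segments and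
  \<open>G\<close> is the set of knots, on the triangle \<open>G\<close> is the union of the grid
  lines. The extensions are made cell by cell without regard to each other; they fit together
  because distinct cells meet only in \<open>G\<close>, where each equals
  \<open>\<rho>\<^sub>0\<close>.\<close>

lemma cellular_retraction:
  fixes cell :: "'i \<Rightarrow> 'e::euclidean_space set" and g :: "'e \<Rightarrow> real" and \<rho>\<^sub>0 :: "'e \<Rightarrow> 'e"
  assumes fin: "finite I"
    and closed: "\<And>i. i \<in> I \<Longrightarrow> closed (cell i)"
    and cont: "\<And>i. i \<in> I \<Longrightarrow> continuous_on (cell i) g"
    and conv: "\<And>i r. i \<in> I \<Longrightarrow> convex {x \<in> cell i. g x \<le> r}"
    and st: "s \<le> t"
    and crit: "\<And>i x. i \<in> I \<Longrightarrow> x \<in> cell i \<Longrightarrow> g x \<le> t \<Longrightarrow> \<exists>y\<in>cell i. g y \<le> s"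
    and G: "closed G"
    and meet: "\<And>i j x. i \<in> I \<Longrightarrow> j \<in> I \<Longrightarrow> i \<noteq> j \<Longrightarrow> x \<in> cell i \<Longrightarrow> x \<in> cell j \<Longrightarrow> x \<in> G"
    and cont\<^sub>0: "continuous_on {x \<in> \<Union>(cell ` I). x \<in> G \<and> g x \<le> t} \<rho>\<^sub>0"
    and into\<^sub>0: "\<And>i x. i \<in> I \<Longrightarrow> x \<in> cell i \<Longrightarrow> x \<in> G \<Longrightarrow> g x \<le> t \<Longrightarrow> \<rho>\<^sub>0 x \<in> cell i \<and> g (\<rho>\<^sub>0 x) \<le> s"
    and fix\<^sub>0: "\<And>i x. i \<in> I \<Longrightarrow> x \<in> cell i \<Longrightarrow> x \<in> G \<Longrightarrow> g x \<le> s \<Longrightarrow> \<rho>\<^sub>0 x = x"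
  obtains \<rho> where "continuous_on {x \<in> \<Union>(cell ` I). g x \<le> t} \<rho>"
    and "\<And>i x. i \<in> I \<Longrightarrow> x \<in> cell i \<Longrightarrow> g x \<le> t \<Longrightarrow> \<rho> x \<in> cell i \<and> g (\<rho> x) \<le> s"
    and "\<And>i x. i \<in> I \<Longrightarrow> x \<in> cell i \<Longrightarrow> g x \<le> s \<Longrightarrow> \<rho> x = x"
    and "\<And>i x. i \<in> I \<Longrightarrow> x \<in> cell i \<Longrightarrow> x \<in> G \<Longrightarrow> g x \<le> t \<Longrightarrow> \<rho> x = \<rho>\<^sub>0 x"
proof -
  let ?sub = "\<lambda>r i. {x \<in> cell i. g x \<le> r}"
  have closed_sub: "closed (?sub r i)" if "i \<in> I" for r i
    using continuous_on_closed_Collect_le[OF cont[OF that] _ closed[OF that], of "\<lambda>x. r"] by simp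
  define P where "P = (\<lambda>i \<rho>. continuous_on (?sub t i) \<rho> \<and> \<rho> ` ?sub t i \<subseteq> ?sub s i \<and>
      (\<forall>x\<in>?sub s i. \<rho> x = x) \<and> (\<forall>x\<in>G \<inter> ?sub t i. \<rho> x = \<rho>\<^sub>0 x))"
  \<comment> \<open>Dugundji's theorem needs a non-empty target. It is provided by
    \<open>crit\<close> if the cell meets the \<open>t\<close>-sublevel set; otherwise there is
    nothing to extend to.\<close>
  have ex: "\<exists>\<rho>. P i \<rho>" if i: "i \<in> I" for i
  proof (cases "?sub t i = {}")
    case True
    then have "?sub s i = {}" using st by fastforce
    with True show ?thesis by (auto simp: P_def)
  next
    case False
    let ?f = "\<lambda>x. if g x \<le> s then x else \<rho>\<^sub>0 x"
    let ?S = "?sub s i \<union> (G \<inter> ?sub t i)"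
    have "closed ?S"
      using closed_sub[OF i] G by (intro closed_Un closed_Int) auto
    then have S: "closedin (top_of_set (?sub t i)) ?S"
      using st by (intro closed_subset) auto
    have G0: "continuous_on (G \<inter> ?sub t i) \<rho>\<^sub>0"
      using i by (intro continuous_on_subset[OF cont\<^sub>0]) auto
    have f: "continuous_on ?S ?f"
    proof (rule continuous_on_cases)
      show "closed (?sub s i)" "closed (G \<inter> ?sub t i)"
        using closed_sub[OF i] G by auto
      show "\<forall>x. x \<in> ?sub s i \<and> \<not> g x \<le> s \<or> x \<in> G \<inter> ?sub t i \<and> g x \<le> s \<longrightarrow> x = \<rho>\<^sub>0 x"
        using fix\<^sub>0[OF i] by force
    qed (simp_all add: continuous_on_id G0)
    have "?f x \<in> ?sub s i" if "x \<in> ?S" for x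
    proof (cases "g x \<le> s")
      case True
      then show ?thesis using that by auto
    next
      case False
      then show ?thesis using that into\<^sub>0[OF i, of x] by simp
    qed
    then have im: "?f ` ?S \<subseteq> ?sub s i" by (rule image_subsetI)
    have ne: "?sub s i \<noteq> {}"
    proof -
      obtain x where "x \<in> cell i" "g x \<le> t" using False by blast
      then show ?thesis using crit[OF i] by blast
    qed
    obtain \<rho> where \<rho>: "continuous_on (?sub t i) \<rho>" "\<rho> ` ?sub t i \<subseteq> ?sub s i"
        "\<And>x. x \<in> ?S \<Longrightarrow> \<rho> x = ?f x"
      by (rule Dugundji[OF conv[OF i] ne S f im]) blast
    have "\<rho> x = \<rho>\<^sub>0 x" if "x \<in> G \<inter> ?sub t i" for x
      using \<rho>(3)[of x] that fix\<^sub>0[OF i, of x] by auto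
    with \<rho> show ?thesis unfolding P_def by (intro exI[of _ \<rho>]) auto
  qed
  define \<rho> where "\<rho> i = (SOME \<rho>. P i \<rho>)" for i
  have "P i (\<rho> i)" if "i \<in> I" for i
    unfolding \<rho>_def by (rule someI_ex[OF ex[OF that]])
  then have \<rho>: "\<And>i. i \<in> I \<Longrightarrow> continuous_on (?sub t i) (\<rho> i)"
      "\<And>i x. i \<in> I \<Longrightarrow> x \<in> ?sub t i \<Longrightarrow> \<rho> i x \<in> ?sub s i"
      "\<And>i x. i \<in> I \<Longrightarrow> x \<in> ?sub s i \<Longrightarrow> \<rho> i x = x"
      "\<And>i x. i \<in> I \<Longrightarrow> x \<in> G \<inter> ?sub t i \<Longrightarrow> \<rho> i x = \<rho>\<^sub>0 x"
    unfolding P_def image_subset_iff by simp_all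
  define r where "r x = \<rho> (SOME i. i \<in> I \<and> x \<in> cell i) x" for x
  have r: "r x = \<rho> i x" if "i \<in> I" "x \<in> ?sub t i" for i x
  proof -
    define j where "j = (SOME i. i \<in> I \<and> x \<in> cell i)"
    have j: "j \<in> I" "x \<in> cell j"
      using someI[of "\<lambda>i. i \<in> I \<and> x \<in> cell i" i] that by (auto simp: j_def)
    show ?thesis
    proof (cases "j = i")
      case True
      then show ?thesis by (simp add: r_def j_def)
    next
      case False
      then have "x \<in> G" using meet[OF j(1) that(1)] j(2) that(2) by simp
      then show ?thesis
        using \<rho>(4)[OF that(1), of x] \<rho>(4)[OF j(1), of x] j that by (simp add: r_def j_def)
    qed
  qed
  show thesis
  proof (rule that[of r])
    have "continuous_on (?sub t i) r" if "i \<in> I" for i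
      using \<rho>(1)[OF that] r[OF that] by (subst continuous_on_cong[OF refl]) auto
    then have "continuous_on (\<Union>i\<in>I. ?sub t i) r"
      using closed_sub by (intro continuous_on_closed_Union[OF fin])
    moreover have "{x \<in> \<Union>(cell ` I). g x \<le> t} = (\<Union>i\<in>I. ?sub t i)" by auto
    ultimately show "continuous_on {x \<in> \<Union>(cell ` I). g x \<le> t} r" by simp
  next
    fix i x assume i: "i \<in> I" "x \<in> cell i"
    show "r x \<in> cell i \<and> g (r x) \<le> s" if "g x \<le> t"
      using r[of i x] \<rho>(2)[of i x] i that by auto
    show "r x = x" if "g x \<le> s"
      using r[of i x] \<rho>(3)[of i x] i st that by auto
    show "r x = \<rho>\<^sub>0 x" if "x \<in> G" "g x \<le> t"
      using r[of i x] \<rho>(4)[of i x] i that by auto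
  qed
qed

text \<open>The infimum is attained and is at most \<open>g x\<close>, hence at most
  \<open>t\<close>; as it avoids the gap, the minimum point lies at or below
  \<open>s\<close>.\<close>

lemma exists_le_if_Inf_notin:
  fixes g :: "'a::topological_space \<Rightarrow> real"
  assumes "compact S" "continuous_on S g" "Inf (g ` S) \<notin> {s<..t}" "x \<in> S" "g x \<le> t"
  shows "\<exists>y\<in>S. g y \<le> s"
proof -
  have "S \<noteq> {}" using assms(4) by auto
  from continuous_attains_inf[OF assms(1) this assms(2)]
  obtain y where y: "y \<in> S" "\<And>z. z \<in> S \<Longrightarrow> g y \<le> g z" by blast
  then have "Inf (g ` S) = g y" by (intro cInf_eq_minimum) auto
  moreover have "g y \<le> t" using y(2)[OF assms(4)] assms(5) by simp
  ultimately have "g y \<le> s" using assms(3) by auto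
  then show ?thesis using y(1) by blast
qed

section \<open>The space of pairs of points of the circle\<close>

lemma topspace_circle [simp]: "topspace circle = sphere 0 1"
  by (simp add: circle_def)

lemma quotient_map_F2:
  "quotient_map (prod_topology X X) (F2 X) (\<lambda>(x, y). {x, y})"
  unfolding F2_def by (rule quotient_map_quotient_topology)

lemma topspace_F2': "topspace (F2 X) = {{x, y} |x y. x \<in> topspace X \<and> y \<in> topspace X}"
  by (auto simp: F2_def)

lemma compact_space_F2_circle: "compact_space (F2 circle)"
proof -
  have "compact_space circle"
    by (simp add: circle_def compact_space_subtopology)
  then have "compact_space (prod_topology circle circle)"
    by (simp add: compact_space_prod_topology)
  then have "compactin (F2 circle) ((\<lambda>(x, y). {x, y}) ` topspace (prod_topology circle circle))"
    by (intro image_compactin[OF _ quotient_imp_continuous_map[OF quotient_map_F2]])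
      (simp add: compact_space_def)
  then show ?thesis
    by (simp add: compact_space_def F2_def)
qed

text \<open>If \<open>d\<close> is a square root of \<open>b\<close>, the equation makes
  \<open>a * cnj d\<close> a real number \<open>r\<close> with absolute value at most 2. Writing
  \<open>r\<close> as twice the cosine of \<open>\<theta>\<close> gives the roots
  \<open>d * cis \<theta>\<close> and \<open>d * cis (- \<theta>)\<close>.\<close>

lemma unit_roots_exist:
  assumes "norm (b::complex) = 1" "a = cnj a * b" "norm a \<le> 2"
  obtains z w where "norm z = 1" "norm w = 1" "z + w = a" "z * w = b"
proof -
  define d where "d = csqrt b"
  have d2: "d * d = b" by (simp add: d_def flip: power2_eq_square)
  then have "norm d * norm d = 1" using assms(1) by (simp flip: norm_mult)
  then have nd: "norm d = 1"
    by (metis norm_ge_zero real_sqrt_abs2 real_sqrt_one abs_of_nonneg)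
  then have dc: "d * cnj d = 1" by (simp flip: complex_norm_square)
  have "cnj (a * cnj d) = cnj a * (d * d) * cnj d"
    using dc by (simp add: mult.assoc)
  also have "\<dots> = a * cnj d" using assms(2) d2 by simp
  finally have "a * cnj d \<in> \<real>" by (simp add: Reals_cnj_iff)
  then obtain r where r: "a * cnj d = of_real r" by (auto elim: Reals_cases)
  have a: "a = of_real r * d"
    using r dc by (metis mult.assoc mult.commute mult.right_neutral)
  then have "\<bar>r\<bar> \<le> 2" using assms(3) nd by (simp add: norm_mult)
  define \<theta> where "\<theta> = arccos (r / 2)"
  have cos: "cos \<theta> = r / 2" unfolding \<theta>_def using \<open>\<bar>r\<bar> \<le> 2\<close> by (intro cos_arccos) auto
  have "cis \<theta> + cis (- \<theta>) = of_real r"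
    using cos by (simp add: complex_eq_iff)
  then have "d * cis \<theta> + d * cis (- \<theta>) = a"
    by (simp add: a mult.commute flip: distrib_left)
  moreover have "(d * cis \<theta>) * (d * cis (- \<theta>)) = b"
  proof -
    have "(d * cis \<theta>) * (d * cis (- \<theta>)) = (d * d) * (cis \<theta> * cis (- \<theta>))" by (simp add: mult_ac)
    then show ?thesis by (simp add: d2 cis_mult)
  qed
  ultimately show thesis
    using nd by (intro that[of "d * cis \<theta>" "d * cis (- \<theta>)"]) (auto simp: norm_mult)
qed

text \<open>A pair of points of the circle is determined by its elementary symmetric functions
  \<open>a = z + w\<close> and \<open>b = z w\<close>. Their image is cut out by \<open>|b| = 1\<close>, \<open>a = cnj a * b\<close> and
  \<open>|a| \<le> 2\<close>: if \<open>b = d\<^sup>2\<close> with \<open>|d| = 1\<close>, the second equation says that \<open>a\<close> lies on the real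
  line through \<open>d\<close>. So one retracts by normalising \<open>b\<close>, projecting \<open>a\<close> to that line and
  clamping.\<close>

lemma F2_circle_open_retract:
  obtains E :: "complex set \<Rightarrow> complex \<times> complex" and \<psi>
  where "continuous_map (F2 circle) (top_of_set (UNIV \<times> - {0})) E"
    and "continuous_map (top_of_set (UNIV \<times> - {0})) (F2 circle) \<psi>"
    and "\<And>w. w \<in> topspace (F2 circle) \<Longrightarrow> \<psi> (E w) = w"
proof -
  let ?q = "\<lambda>(x, y). {x, y} :: complex set"
  let ?CC = "prod_topology circle circle"
  have CC: "?CC = top_of_set (sphere 0 1 \<times> sphere 0 1)"
    by (simp add: circle_def subtopology_Times)
  let ?e = "\<lambda>(z, w). (z + w, z * w) :: complex \<times> complex"
  have e: "continuous_map ?CC euclidean ?e"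
    unfolding CC case_prod_unfold continuous_map_iff_continuous
    by (intro continuous_intros)
  have sym: "?e x = ?e y" if "?q x = ?q y" for x y
    using that by (cases x; cases y) (auto simp: doubleton_eq_iff)
  obtain E where E: "continuous_map (F2 circle) euclidean E"
      and E_eq: "\<And>x. x \<in> topspace ?CC \<Longrightarrow> E (?q x) = ?e x"
    by (rule quotient_map_lift_exists[OF quotient_map_F2 e sym]) (auto simp: case_prod_unfold)
  have E_pair: "E {z, w} = (z + w, z * w)" if "norm z = 1" "norm w = 1" for z w
    using E_eq[of "(z, w)"] that by simp
  define M where "M = {(a, b). norm b = 1 \<and> a = cnj a * b \<and> norm (a :: complex) \<le> 2}"
  have EM: "E ` topspace (F2 circle) = M"
  proof
    show "E ` topspace (F2 circle) \<subseteq> M"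
    proof
      fix y assume "y \<in> E ` topspace (F2 circle)"
      then obtain z w where zw: "norm z = 1" "norm w = 1" "y = (z + w, z * w)"
        by (auto simp: topspace_F2' E_pair)
      then have "z * cnj z = 1" "w * cnj w = 1" by (simp_all flip: complex_norm_square)
      then have "(cnj z + cnj w) * (z * w) = z + w"
        by (simp add: algebra_simps)
      moreover have "norm (z + w) \<le> 2" using norm_triangle_ineq[of z w] zw by simp
      ultimately show "y \<in> M" using zw by (simp add: M_def norm_mult)
    qed
    show "M \<subseteq> E ` topspace (F2 circle)"
    proof
      fix y assume "y \<in> M"
      then obtain a b where y: "y = (a, b)" "norm b = 1" "a = cnj a * b" "norm a \<le> 2"
        by (auto simp: M_def)
      obtain z w where zw: "norm z = 1" "norm w = 1" "z + w = a" "z * w = b"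
        using unit_roots_exist[OF y(2-4)] by blast
      then have "y = E {z, w}" "{z, w} \<in> topspace (F2 circle)"
        by (auto simp: E_pair y(1) topspace_F2')
      then show "y \<in> E ` topspace (F2 circle)" by blast
    qed
  qed
  have "inj_on E (topspace (F2 circle))"
  proof (rule inj_onI)
    fix p q assume "p \<in> topspace (F2 circle)" "q \<in> topspace (F2 circle)" "E p = E q"
    then obtain z w z' w' where p: "p = {z, w}" "norm z = 1" "norm w = 1"
        and q: "q = {z', w'}" "norm z' = 1" "norm w' = 1"
        and "E {z, w} = E {z', w'}"
      by (auto simp: topspace_F2')
    then have eq: "z + w = z' + w'" "z * w = z' * w'" by (auto simp: E_pair)
    \<comment> \<open>Vieta: \<open>z\<close> is a root of the monic quadratic polynomial with roots
      \<open>z'\<close> and \<open>w'\<close>.\<close>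
    have "(z - z') * (z - w') = z * z - z * (z' + w') + z' * w'" by (simp add: algebra_simps)
    also have "\<dots> = 0" by (simp flip: eq) (simp add: algebra_simps)
    finally have "z = z' \<or> z = w'" by simp
    then show "p = q" using eq(1) p(1) q(1) by auto
  qed
  moreover have "compact_space (F2 circle)"
    by (rule compact_space_F2_circle)
  moreover have "continuous_map (F2 circle) (top_of_set M) E"
    using E EM by (auto simp: continuous_map_in_subtopology)
  ultimately have "homeomorphic_map (F2 circle) (top_of_set M) E"
    using EM by (intro continuous_imp_homeomorphic_map) (auto simp: Hausdorff_space_subtopology)
  then obtain E' where E': "homeomorphic_maps (F2 circle) (top_of_set M) E E'"
    by (auto simp: homeomorphic_map_maps)
  \<comment> \<open>The map sending \<open>a\<close> to \<open>cnj a * \<beta>\<close> is the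
    reflection in the real line through a square root of \<open>\<beta>\<close>. Averaging with the
    identity projects onto that line without a square root being chosen, which could not be done
    continuously. The factor \<open>2 / max 2 (norm a')\<close> is 1 on the disc of radius
    2.\<close>
  define R :: "complex \<times> complex \<Rightarrow> complex \<times> complex" where
    "R = (\<lambda>(a, b). let \<beta> = b / of_real (norm b); a' = (a + cnj a * \<beta>) / 2
            in (a' * of_real (2 / max 2 (norm a')), \<beta>))"
  have Rcont: "continuous_on (UNIV \<times> - {0}) R"
    unfolding R_def Let_def case_prod_unfold
    by (auto intro!: continuous_intros) 
  have RM: "R (a, b) \<in> M" if "b \<noteq> 0" for a b
  proof -
    define \<beta> where "\<beta> = b / of_real (norm b)"
    define a' where "a' = (a + cnj a * \<beta>) / 2"
    define k where "k = 2 / max 2 (norm a')"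
    have \<beta>: "norm \<beta> = 1" using that by (simp add: \<beta>_def norm_divide)
    then have "cnj \<beta> * \<beta> = 1" by (simp add: mult.commute flip: complex_norm_square)
    then have "cnj a' * \<beta> = a'" by (simp add: a'_def algebra_simps)
    then have "a' * of_real k = cnj (a' * of_real k) * \<beta>" by (simp add: mult_ac)
    moreover have "norm (a' * of_real k) \<le> 2"
    proof -
      have "k \<ge> 0" by (simp add: k_def)
      then have "norm (a' * of_real k) = norm a' * k" by (simp add: norm_mult)
      also have "\<dots> \<le> max 2 (norm a') * k" by (intro mult_right_mono) (auto simp: k_def)
      also have "\<dots> = 2" by (auto simp: k_def max_def)
      finally show ?thesis .
    qed
    moreover have "R (a, b) = (a' * of_real k, \<beta>)"
      by (simp only: R_def Let_def \<beta>_def a'_def k_def prod.case)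
    ultimately show ?thesis
      using \<beta> unfolding M_def by (simp only: mem_Collect_eq prod.case simp_thms)
  qed
  have RM_id: "R y = y" if "y \<in> M" for y
    using that by (auto simp: R_def Let_def M_def max_def)
  show thesis
  proof (rule that[of E "E' \<circ> R"])
    have "M \<subseteq> UNIV \<times> - {0}" by (auto simp: M_def)
    then show "continuous_map (F2 circle) (top_of_set (UNIV \<times> - {0})) E"
      using E EM by (auto simp: continuous_map_in_subtopology)
    have "continuous_map (top_of_set (UNIV \<times> - {0})) (top_of_set M) R"
      using Rcont RM by (auto simp: continuous_map_in_subtopology)
    from continuous_map_compose[OF this] show "continuous_map (top_of_set (UNIV \<times> - {0})) (F2 circle) (E' \<circ> R)"
      using E' by (auto simp: homeomorphic_maps_def)
    show "(E' \<circ> R) (E w) = w" if "w \<in> topspace (F2 circle)" for w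
      using that E' EM RM_id[of "E w"] by (auto simp: homeomorphic_maps_def)
  qed
qed

lemma Hausdorff_space_F2_circle: "Hausdorff_space (F2 circle)"
proof (rule F2_circle_open_retract)
  fix E :: "complex set \<Rightarrow> complex \<times> complex" and \<psi>
  assume E: "continuous_map (F2 circle) (top_of_set (UNIV \<times> - {0})) E"
    and inv: "\<And>w. w \<in> topspace (F2 circle) \<Longrightarrow> \<psi> (E w) = w"
  have "inj_on E (topspace (F2 circle))" using inv by (metis inj_on_inverseI)
  with E show ?thesis
    by (intro Hausdorff_space_injective_preimage[OF _ E]) (auto simp: Hausdorff_space_subtopology)
qed


section \<open>Sublevel sets for a piecewise linear loop\<close>

definition circle_point :: "real \<Rightarrow> complex" where
  "circle_point t = exp (2 * of_real pi * \<i> * of_real t)"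

lemma norm_circle_point [simp]: "norm (circle_point t) = 1"
  by (simp add: circle_point_def norm_exp_eq_Re)

lemma continuous_on_circle_point: "continuous_on S circle_point"
  unfolding circle_point_def by (intro continuous_intros)

lemma circle_point_0_1 [simp]: "circle_point 0 = 1" "circle_point 1 = 1"
  by (simp_all add: circle_point_def exp_eq_1)

lemma circle_point_eq_cases:
  assumes "circle_point a = circle_point b" "a \<in> {0..1}" "b \<in> {0..1}"
  shows "a = b \<or> (a = 0 \<and> b = 1) \<or> (a = 1 \<and> b = 0)"
proof -
  obtain k :: int where "2 * of_real pi * \<i> * of_real a =
      2 * of_real pi * \<i> * of_real b + (of_int (2 * k) * pi) * \<i>"
    using assms(1) by (auto simp: circle_point_def exp_eq)
  from arg_cong[OF this, of Im] have "2 * pi * a = 2 * pi * (b + of_int k)"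
    by (simp add: algebra_simps)
  then have k: "a = b + of_int k" by simp
  then have "-1 \<le> k" "k \<le> 1" using assms(2,3) by auto
  then have "k = -1 \<or> k = 0 \<or> k = 1" by linarith
  then show ?thesis using k assms(2,3) by auto
qed

lemma circle_point_surj:
  assumes "norm z = 1"
  obtains t where "t \<in> {0..1}" "circle_point t = z"
proof -
  obtain t where t: "0 \<le> t" "t < 2 * pi" "z = Complex (cos t) (sin t)"
    using complex_unimodular_polar[OF assms] by blast
  have "circle_point (t / (2 * pi)) = cis t"
    by (simp add: circle_point_def cis_conv_exp)
  also have "\<dots> = z" using t(3) by (simp add: complex_eq_iff)
  finally have "circle_point (t / (2 * pi)) = z" .
  moreover have "t / (2 * pi) \<in> {0..1}" using t(1,2) by simp
  ultimately show thesis by (intro that)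
qed

text \<open>The bound places both vectors in the ball of radius \<open>sqrt (2 * r)\<close> about 0,
  which is convex.\<close>

lemma half_square_le_convex:
  fixes v w :: "'a::real_normed_vector"
  assumes "(norm v)\<^sup>2 / 2 \<le> r" "(norm w)\<^sup>2 / 2 \<le> r" "0 \<le> u" "u \<le> 1"
  shows "(norm ((1 - u) *\<^sub>R v + u *\<^sub>R w))\<^sup>2 / 2 \<le> r"
proof -
  have "norm v \<le> sqrt (2 * r)" "norm w \<le> sqrt (2 * r)"
    using assms(1,2) by (auto intro: real_le_rsqrt)
  then have "(1 - u) * norm v + u * norm w \<le> sqrt (2 * r)"
    using assms(3,4) by (intro convex_bound_le) auto
  moreover have "norm ((1 - u) *\<^sub>R v + u *\<^sub>R w) \<le> (1 - u) * norm v + u * norm w"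
    using assms(3,4) by (intro order_trans[OF norm_triangle_ineq]) simp
  ultimately have "(norm ((1 - u) *\<^sub>R v + u *\<^sub>R w))\<^sup>2 \<le> (sqrt (2 * r))\<^sup>2"
    by (intro power_mono) auto
  moreover have "0 \<le> r" using assms(1) by (meson order_trans zero_le_divide_iff zero_le_power2 zero_le_numeral)
  ultimately show ?thesis by simp
qed

text \<open>The properties of the interpolation on which the argument rests: a continuous loop that
  is affine in the parameter between consecutive knots of the unit interval.\<close>

locale pl_loop =
  fixes n :: nat and L :: "nat \<Rightarrow> real" and \<gamma> :: "complex \<Rightarrow> 'e::real_normed_vector"
  assumes n_pos: "0 < n" and L_0: "L 0 = 0" and L_n: "L n = 1"
    and L_less: "\<And>i j. i < j \<Longrightarrow> j \<le> n \<Longrightarrow> L i < L j"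
    and \<gamma>_cont: "continuous_on (sphere 0 1) \<gamma>"
    and \<gamma>_affine: "\<And>i a b u. i < n \<Longrightarrow> a \<in> {L i..L (Suc i)} \<Longrightarrow> b \<in> {L i..L (Suc i)} \<Longrightarrow>
      0 \<le> u \<Longrightarrow> u \<le> 1 \<Longrightarrow> \<gamma> (circle_point ((1 - u) * a + u * b)) =
      (1 - u) *\<^sub>R \<gamma> (circle_point a) + u *\<^sub>R \<gamma> (circle_point b)"
begin

abbreviation \<Gamma> :: "real \<Rightarrow> 'e" where "\<Gamma> t \<equiv> \<gamma> (circle_point t)"

section \<open>The grid of knots on the triangle\<close>

definition seg :: "nat \<Rightarrow> real set" where "seg i = {L i..L (Suc i)}"

definition knots :: "real set" where "knots = L ` {..n}"

text \<open>The function along a grid line, indexed by the point \<open>v\<close> of the loop and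
  not by its parameter. By symmetry it describes both the line \<open>a = k\<close> and the line
  \<open>b = k\<close>, and it is the same for the knots 0 and 1.\<close>

definition h :: "'e \<Rightarrow> real \<Rightarrow> real" where "h v b = (norm (v - \<Gamma> b))\<^sup>2 / 2"

definition g :: "real \<times> real \<Rightarrow> real" where "g p = h (\<Gamma> (fst p)) (snd p)"

definition triangle :: "(real \<times> real) set" where
  "triangle = {(a, b). 0 \<le> a \<and> a \<le> b \<and> b \<le> 1}"

definition cell :: "nat \<times> nat \<Rightarrow> (real \<times> real) set" where
  "cell = (\<lambda>(i, j). seg i \<times> seg j \<inter> triangle)"

definition cell_index :: "(nat \<times> nat) set" where
  "cell_index = {(i, j). i \<le> j \<and> j < n}"

text \<open>Since \<open>g\<close> is symmetric, edges in one direction suffice if they range over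
  the whole square: each edge \<open>seg j \<times> {L i}\<close> mirrors a listed one. The
  hypotenuses of the triangular cells do not occur, since no two cells are joined along
  them.\<close>

definition critical_values :: "real set" where
  "critical_values = (\<lambda>F. Inf (g ` F)) `
     ((\<lambda>(i, j). {(L i, L j)}) ` ({..n} \<times> {..n}) \<union>
      (\<lambda>(i, j). {L i} \<times> seg j) ` ({..n} \<times> {..<n}) \<union> cell ` cell_index)"

lemma finite_cell_index: "finite cell_index"
  by (rule finite_subset[of _ "{..n} \<times> {..n}"]) (auto simp: cell_index_def)

lemma finite_critical_values: "finite critical_values"
  unfolding critical_values_def using finite_cell_index by auto

lemma L_le: "i \<le> j \<Longrightarrow> j \<le> n \<Longrightarrow> L i \<le> L j"
  using L_less by (cases "i = j") (auto simp: less_imp_le)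

lemma seg_subset: "i < n \<Longrightarrow> seg i \<subseteq> {0..1}"
  using L_le[of 0 i] L_le[of "Suc i" n] by (auto simp: seg_def L_0 L_n)

lemma seg_cover:
  assumes "t \<in> {0..1}"
  obtains i where "i < n" "t \<in> seg i"
proof -
  have "\<exists>i<m. t \<in> seg i" if "0 < m" "m \<le> n" "t \<le> L m" for m
    using that
  proof (induction m)
    case (Suc m)
    show ?case
    proof (cases "0 < m \<and> t \<le> L m")
      case True
      then show ?thesis using Suc by (meson Suc_leD less_SucI)
    next
      case False
      then have "L m \<le> t" using assms L_0 by (cases "m = 0") auto
      then show ?thesis using Suc.prems by (auto simp: seg_def)
    qed
  qed simp
  from this[of n] obtain i where "i < n" "t \<in> seg i" using assms n_pos L_n by auto
  then show thesis by (rule that)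
qed

lemma seg_meet:
  assumes "i < n" "j < n" "i \<noteq> j" "t \<in> seg i" "t \<in> seg j"
  shows "t \<in> knots"
proof -
  have "t \<in> knots" if "i < j" "j < n" "t \<in> seg i" "t \<in> seg j" for i j
  proof -
    have "t = L j" using that L_le[of "Suc i" j] by (auto simp: seg_def)
    then show ?thesis using that by (auto simp: knots_def)
  qed
  then show ?thesis using assms by (cases i j rule: linorder_cases) auto
qed

lemma seg_knot:
  assumes "t \<in> knots" "t \<in> seg i" "i < n"
  shows "t = L i \<or> t = L (Suc i)"
proof -
  obtain k where k: "k \<le> n" "t = L k" using assms(1) by (auto simp: knots_def)
  have "\<not> k < i" using L_less[of k i] k assms by (auto simp: seg_def)
  moreover have "\<not> Suc i < k" using L_less[of "Suc i" k] k assms by (auto simp: seg_def)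
  ultimately have "k = i \<or> k = Suc i" by auto
  then show ?thesis using k by auto
qed

lemma finite_knots: "finite knots" by (simp add: knots_def)

lemma knots_0_1: "0 \<in> knots" "1 \<in> knots"
  using L_0 L_n by (force simp: knots_def)+

section \<open>Continuity, convexity and compactness on the cells\<close>

lemma continuous_on_\<Gamma>: "continuous_on S \<Gamma>"
  by (rule continuous_on_compose2[OF \<gamma>_cont continuous_on_circle_point]) auto

lemma continuous_on_h: "continuous_on S (h v)"
  unfolding h_def by (intro continuous_intros continuous_on_\<Gamma>) simp

lemma continuous_on_g: "continuous_on S g"
proof -
  have "continuous_on S (\<lambda>p. \<Gamma> (fst p))" "continuous_on S (\<lambda>p. \<Gamma> (snd p))"
    by (rule continuous_on_compose2[OF continuous_on_\<Gamma>[of UNIV]]; auto intro: continuous_intros)+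
  then show ?thesis unfolding g_def h_def by (intro continuous_intros) auto
qed

lemma g_pair: "g (a, b) = h (\<Gamma> a) b" by (simp add: g_def)

lemma g_commute: "g (a, b) = h (\<Gamma> b) a" by (simp add: g_def h_def norm_minus_commute)

lemma convex_sublevel_seg:
  assumes "i < n"
  shows "convex {b \<in> seg i. h v b \<le> r}"
  unfolding convex_alt
proof (intro ballI allI impI)
  fix x y u :: real assume xy: "x \<in> {b \<in> seg i. h v b \<le> r}" "y \<in> {b \<in> seg i. h v b \<le> r}" and u: "0 \<le> u \<and> u \<le> 1"
  have "v - \<Gamma> ((1 - u) * x + u * y) = (1 - u) *\<^sub>R (v - \<Gamma> x) + u *\<^sub>R (v - \<Gamma> y)"
    using \<gamma>_affine[OF assms, of x y u] xy u by (auto simp: seg_def algebra_simps)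
  moreover have "(1 - u) * x + u * y \<in> seg i"
    using xy u convex_closed_interval[of "L i" "L (Suc i)"] unfolding seg_def convex_alt by auto
  ultimately show "(1 - u) *\<^sub>R x + u *\<^sub>R y \<in> {b \<in> seg i. h v b \<le> r}"
    using half_square_le_convex[of "v - \<Gamma> x" r "v - \<Gamma> y" u] xy u by (auto simp: h_def)
qed

lemma convex_triangle: "convex triangle"
  unfolding convex_alt
proof (intro ballI allI impI)
  fix x y :: "real \<times> real" and u :: real
  assume "x \<in> triangle" "y \<in> triangle" and u: "0 \<le> u \<and> u \<le> 1"
  then have xy: "0 \<le> fst x" "fst x \<le> snd x" "snd x \<le> 1" "0 \<le> fst y" "fst y \<le> snd y" "snd y \<le> 1"
    by (auto simp: triangle_def)
  have "0 \<le> (1 - u) * fst x + u * fst y"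
    using xy u by simp
  moreover have "(1 - u) * fst x + u * fst y \<le> (1 - u) * snd x + u * snd y"
    using xy u by (intro add_mono mult_left_mono) auto
  moreover have "(1 - u) * snd x + u * snd y \<le> 1"
    using xy u by (intro convex_bound_le) auto
  ultimately show "(1 - u) *\<^sub>R x + u *\<^sub>R y \<in> triangle"
    by (simp add: triangle_def case_prod_unfold)
qed

lemma convex_sublevel_cell:
  assumes "c \<in> cell_index"
  shows "convex {p \<in> cell c. g p \<le> r}"
  unfolding convex_alt
proof (intro ballI allI impI)
  fix x y :: "real \<times> real" and u :: real
  assume x: "x \<in> {p \<in> cell c. g p \<le> r}" and y: "y \<in> {p \<in> cell c. g p \<le> r}" and u: "0 \<le> u \<and> u \<le> 1"
  obtain i j where c: "c = (i, j)" "i < n" "j < n" using assms by (auto simp: cell_index_def)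
  let ?z = "(1 - u) *\<^sub>R x + u *\<^sub>R y"
  have seg: "fst x \<in> seg i" "snd x \<in> seg j" "fst y \<in> seg i" "snd y \<in> seg j"
    using x y c by (auto simp: cell_def)
  have "convex (seg i \<times> seg j)" by (intro convex_Times) (auto simp: seg_def)
  then have "convex (cell c)" unfolding c cell_def by (auto intro: convex_Int convex_triangle)
  then have "?z \<in> cell c" using x y u unfolding convex_alt by blast
  moreover have "\<Gamma> (fst ?z) - \<Gamma> (snd ?z) =
      (1 - u) *\<^sub>R (\<Gamma> (fst x) - \<Gamma> (snd x)) + u *\<^sub>R (\<Gamma> (fst y) - \<Gamma> (snd y))"
    using \<gamma>_affine[OF c(2), of "fst x" "fst y" u] \<gamma>_affine[OF c(3), of "snd x" "snd y" u] seg u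
    by (simp add: seg_def algebra_simps)
  ultimately show "?z \<in> {p \<in> cell c. g p \<le> r}"
    using half_square_le_convex[of "\<Gamma> (fst x) - \<Gamma> (snd x)" r "\<Gamma> (fst y) - \<Gamma> (snd y)" u] x y u
    by (simp add: g_def h_def)
qed

lemma closed_triangle: "closed triangle"
proof -
  have "triangle = {p. 0 \<le> fst p} \<inter> {p. fst p \<le> snd p} \<inter> {p. snd p \<le> 1}"
    by (auto simp: triangle_def)
  moreover have "closed \<dots>"
    by (intro closed_Int closed_Collect_le continuous_intros)
  ultimately show ?thesis by simp
qed

lemma compact_triangle: "compact triangle"
proof -
  have "triangle = ({0..1} \<times> {0..1}) \<inter> triangle" by (auto simp: triangle_def)
  then show ?thesis
    by (metis closed_triangle compact_Icc compact_Int_closed compact_Times)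
qed

lemma compact_cell: "compact (cell c)"
  by (auto simp: cell_def seg_def case_prod_unfold intro!: compact_Int_closed compact_Times closed_triangle)

lemma cell_cover: "\<Union>(cell ` cell_index) = triangle"
proof
  show "\<Union>(cell ` cell_index) \<subseteq> triangle" by (auto simp: cell_def)
  show "triangle \<subseteq> \<Union>(cell ` cell_index)"
  proof
    fix p assume p: "p \<in> triangle"
    then obtain a b where ab: "p = (a, b)" "0 \<le> a" "a \<le> b" "b \<le> 1" by (auto simp: triangle_def)
    obtain i where i: "i < n" "a \<in> seg i" using seg_cover[of a] ab by auto
    obtain j where j: "j < n" "b \<in> seg j" using seg_cover[of b] ab by auto
    show "p \<in> \<Union>(cell ` cell_index)"
    proof (cases "i \<le> j")
      case True
      then show ?thesis using i j ab p by (auto simp: cell_def cell_index_def)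
    next
      case False
      \<comment> \<open>Now \<open>b \<le> L (Suc j) \<le> L i \<le> a \<le> b\<close>, so
        \<open>a\<close> and \<open>b\<close> coincide and the triangular cell \<open>(i, i)\<close>
        contains the point.\<close>
      then have "L (Suc j) \<le> L i" using i by (intro L_le) auto
      then have "b \<in> seg i" using i j ab by (auto simp: seg_def)
      then show ?thesis using i ab p by (auto simp: cell_def cell_index_def)
    qed
  qed
qed

text \<open>The value at a vertex is the infimum over a one-point face, so it cannot lie in the gap.
  This allows the retractions to fix all vertices.\<close>

lemma knot_pair_le:
  assumes "critical_values \<inter> {s<..t} = {}" "a \<in> knots" "b \<in> knots" "g (a, b) \<le> t"
  shows "g (a, b) \<le> s"
proof -
  obtain i j where ij: "i \<le> n" "j \<le> n" "a = L i" "b = L j" using assms(2,3) by (auto simp: knots_def)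
  have "Inf (g ` {(L i, L j)}) \<in> critical_values"
    unfolding critical_values_def using ij by (intro imageI UnI1) auto
  then show ?thesis using assms(1,4) ij by (auto simp: disjoint_iff not_le)
qed

text \<open>The one-dimensional case of \<open>cellular_retraction\<close>, on the grid line over
  the knot \<open>k\<close>; the map prescribed on the knots is the identity, by
  \<open>knot_pair_le\<close>.\<close>

lemma vertex_retraction:
  assumes st: "s \<le> t" and nc: "critical_values \<inter> {s<..t} = {}" and k: "k \<in> knots"
  obtains R where "continuous_on {b \<in> {0..1}. h (\<Gamma> k) b \<le> t} R"
    "\<And>j b. j < n \<Longrightarrow> b \<in> seg j \<Longrightarrow> h (\<Gamma> k) b \<le> t \<Longrightarrow> R b \<in> seg j \<and> h (\<Gamma> k) (R b) \<le> s"
    "\<And>b. b \<in> {0..1} \<Longrightarrow> h (\<Gamma> k) b \<le> s \<Longrightarrow> R b = b"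
proof -
  obtain i where i: "i \<le> n" "k = L i" using k by (auto simp: knots_def)
  have cover: "\<Union>(seg ` {..<n}) = {0..1}"
  proof
    show "\<Union>(seg ` {..<n}) \<subseteq> {0..1}" using seg_subset by (intro UN_least) simp
    show "{0..1} \<subseteq> \<Union>(seg ` {..<n})"
    proof
      fix b :: real assume "b \<in> {0..1}"
      then obtain j where "j < n" "b \<in> seg j" by (rule seg_cover)
      then show "b \<in> \<Union>(seg ` {..<n})" by blast
    qed
  qed
  have crit: "\<exists>y\<in>seg j. h (\<Gamma> k) y \<le> s" if b: "j < n" "b \<in> seg j" "h (\<Gamma> k) b \<le> t" for j b
  proof -
    have "Inf (g ` ({L i} \<times> seg j)) \<in> critical_values"
      unfolding critical_values_def using i b(1) by (intro imageI UnI1 UnI2) auto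
    then have "Inf (g ` ({L i} \<times> seg j)) \<notin> {s<..t}" using nc by blast
    moreover have "compact ({L i} \<times> seg j)" by (intro compact_Times) (auto simp: seg_def)
    ultimately have "\<exists>y\<in>{L i} \<times> seg j. g y \<le> s"
      using b i by (intro exists_le_if_Inf_notin[OF _ continuous_on_g, of _ s t "(L i, b)"]) (auto simp: g_pair)
    then show ?thesis by (auto simp: g_pair i)
  qed
  show thesis
  proof (rule cellular_retraction[of "{..<n}" seg "h (\<Gamma> k)" s t knots "\<lambda>b. b"])
    fix R
    assume cont: "continuous_on {x \<in> \<Union>(seg ` {..<n}). h (\<Gamma> k) x \<le> t} R"
      and into: "\<And>i x. i \<in> {..<n} \<Longrightarrow> x \<in> seg i \<Longrightarrow> h (\<Gamma> k) x \<le> t \<Longrightarrow> R x \<in> seg i \<and> h (\<Gamma> k) (R x) \<le> s"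
      and id: "\<And>i x. i \<in> {..<n} \<Longrightarrow> x \<in> seg i \<Longrightarrow> h (\<Gamma> k) x \<le> s \<Longrightarrow> R x = x"
    show thesis
    proof (rule that[of R])
      show "continuous_on {b \<in> {0..1}. h (\<Gamma> k) b \<le> t} R" using cont unfolding cover .
      show "R b \<in> seg j \<and> h (\<Gamma> k) (R b) \<le> s" if "j < n" "b \<in> seg j" "h (\<Gamma> k) b \<le> t" for j b
        using into[of j b] that by simp
      show "R b = b" if b: "b \<in> {0..1}" "h (\<Gamma> k) b \<le> s" for b
      proof -
        obtain j where "j < n" "b \<in> seg j" using b(1) by (rule seg_cover)
        then show ?thesis using id b(2) by simp
      qed
    qed
  next
    fix j b assume "j \<in> {..<n}" "b \<in> seg j" "b \<in> knots" "h (\<Gamma> k) b \<le> t"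
    then show "b \<in> seg j \<and> h (\<Gamma> k) b \<le> s"
      using knot_pair_le[OF nc k, of b] by (simp add: g_pair)
  next
    fix i j b assume "i \<in> {..<n}" "j \<in> {..<n}" "i \<noteq> j" "b \<in> seg i" "b \<in> seg j"
    then show "b \<in> knots" using seg_meet by simp
  next
    fix j b assume "j \<in> {..<n}" "b \<in> seg j" "h (\<Gamma> k) b \<le> t"
    then show "\<exists>y\<in>seg j. h (\<Gamma> k) y \<le> s" using crit by simp
  next
    show "closed knots" by (simp add: finite_knots finite_imp_closed)
  next
    show "convex {b \<in> seg j. h (\<Gamma> k) b \<le> r}" if "j \<in> {..<n}" for j r
      using convex_sublevel_seg that by simp
    show "closed (seg j)" for j by (simp add: seg_def)
  qed (simp_all add: st continuous_on_h continuous_on_id)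
qed

text \<open>The last two properties are there for the gluing: the sides \<open>a = 0\<close> and
  \<open>b = 1\<close> carry the same map \<open>R\<close>, and \<open>R\<close> fixes the
  parameters 0 and 1, which are one point of the circle.\<close>

lemma triangle_retraction:
  assumes st: "s \<le> t" and nc: "critical_values \<inter> {s<..t} = {}"
  obtains \<rho> R where "continuous_on {p \<in> triangle. g p \<le> t} \<rho>"
    and "\<And>p u. p \<in> triangle \<Longrightarrow> g p \<le> t \<Longrightarrow> 0 \<le> u \<Longrightarrow> u \<le> 1 \<Longrightarrow>
      (1 - u) *\<^sub>R p + u *\<^sub>R \<rho> p \<in> triangle \<and> g ((1 - u) *\<^sub>R p + u *\<^sub>R \<rho> p) \<le> t"
    and "\<And>p. p \<in> triangle \<Longrightarrow> g p \<le> t \<Longrightarrow> g (\<rho> p) \<le> s"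
    and "\<And>p. p \<in> triangle \<Longrightarrow> g p \<le> s \<Longrightarrow> \<rho> p = p"
    and "\<And>c. c \<in> {0..1} \<Longrightarrow> g (0, c) \<le> t \<Longrightarrow> \<rho> (0, c) = (0, R c) \<and> \<rho> (c, 1) = (R c, 1)"
    and "0 \<le> t \<Longrightarrow> R 0 = 0 \<and> R 1 = 1"
proof -
  define P where "P = (\<lambda>v R. continuous_on {b \<in> {0..1}. h v b \<le> t} R \<and>
    (\<forall>j b. j < n \<longrightarrow> b \<in> seg j \<longrightarrow> h v b \<le> t \<longrightarrow> R b \<in> seg j \<and> h v (R b) \<le> s) \<and>
    (\<forall>b. b \<in> {0..1} \<longrightarrow> h v b \<le> s \<longrightarrow> R b = b))"
  have ex: "\<exists>R. P (\<Gamma> k) R" if k: "k \<in> knots" for k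
  proof (rule vertex_retraction[OF st nc k])
    fix R assume R: "continuous_on {b \<in> {0..1}. h (\<Gamma> k) b \<le> t} R"
      "\<And>j b. j < n \<Longrightarrow> b \<in> seg j \<Longrightarrow> h (\<Gamma> k) b \<le> t \<Longrightarrow> R b \<in> seg j \<and> h (\<Gamma> k) (R b) \<le> s"
      "\<And>b. b \<in> {0..1} \<Longrightarrow> h (\<Gamma> k) b \<le> s \<Longrightarrow> R b = b"
    show ?thesis unfolding P_def using R by (intro exI[of _ R]) simp
  qed
  \<comment> \<open>Choosing by the point \<open>v\<close> gives the knots 0 and 1 the same map,
    because \<open>\<Gamma> 0\<close> and \<open>\<Gamma> 1\<close> are equal.\<close>
  define R where "R v = (SOME R. P v R)" for v
  have "P (\<Gamma> k) (R (\<Gamma> k))" if "k \<in> knots" for k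
    unfolding R_def by (rule someI_ex[OF ex[OF that]])
  then have R_cont: "\<And>k. k \<in> knots \<Longrightarrow> continuous_on {b \<in> {0..1}. h (\<Gamma> k) b \<le> t} (R (\<Gamma> k))"
    and R_into: "\<And>k j b. k \<in> knots \<Longrightarrow> j < n \<Longrightarrow> b \<in> seg j \<Longrightarrow> h (\<Gamma> k) b \<le> t \<Longrightarrow>
      R (\<Gamma> k) b \<in> seg j \<and> h (\<Gamma> k) (R (\<Gamma> k) b) \<le> s"
    and R_id: "\<And>k b. k \<in> knots \<Longrightarrow> b \<in> {0..1} \<Longrightarrow> h (\<Gamma> k) b \<le> s \<Longrightarrow> R (\<Gamma> k) b = b"
    unfolding P_def by blast+
  have knots_01: "k \<in> {0..1}" if "k \<in> knots" for k
    using that L_le[of 0] L_le[of _ n] by (auto simp: knots_def L_0 L_n)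
  have R_knot: "R (\<Gamma> k) b = b" if "k \<in> knots" "b \<in> knots" "g (k, b) \<le> t" for k b
    using R_id[OF that(1) knots_01[OF that(2)]] knot_pair_le[OF nc that] by (simp add: g_pair)
  define G :: "(real \<times> real) set" where "G = {p. fst p \<in> knots \<or> snd p \<in> knots}"
  \<comment> \<open>Points on a grid line move along it. At a crossing of two grid lines in the
    \<open>t\<close>-sublevel set both formulas return the point itself, by
    \<open>R_knot\<close>.\<close>
  define \<rho>\<^sub>0 where "\<rho>\<^sub>0 p = (if fst p \<in> knots then (fst p, R (\<Gamma> (fst p)) (snd p))
      else (R (\<Gamma> (snd p)) (fst p), snd p))" for p
  have closed_knots: "closed knots" by (simp add: finite_knots finite_imp_closed)
  have closed_sub: "closed {p \<in> triangle. g p \<le> t}"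
    using continuous_on_closed_Collect_le[OF continuous_on_g _ closed_triangle, of "\<lambda>p. t"] by simp
  have G: "closed G"
  proof -
    have "G = knots \<times> UNIV \<union> UNIV \<times> knots" by (auto simp: G_def)
    then show ?thesis using closed_knots by (simp add: closed_Times closed_Un)
  qed
  have fst_eq: "{p :: real \<times> real. fst p = k} = {k} \<times> UNIV" and snd_eq: "{p :: real \<times> real. snd p = k} = UNIV \<times> {k}" for k
    by auto
  have cont1: "continuous_on (\<Union>k\<in>knots. {p \<in> triangle. g p \<le> t} \<inter> {p. fst p = k})
      (\<lambda>p. (fst p, R (\<Gamma> (fst p)) (snd p)))"
  proof (rule continuous_on_closed_Union[OF finite_knots])
    fix k assume k: "k \<in> knots"
    show "closed ({p \<in> triangle. g p \<le> t} \<inter> {p. fst p = k})"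
      unfolding fst_eq by (intro closed_Int closed_sub closed_Times) auto
    have "continuous_on ({p \<in> triangle. g p \<le> t} \<inter> {p. fst p = k}) (\<lambda>p. R (\<Gamma> k) (snd p))"
      by (rule continuous_on_compose2[OF R_cont[OF k] continuous_on_snd[OF continuous_on_id]])
        (auto simp: triangle_def g_pair)
    then have "continuous_on ({p \<in> triangle. g p \<le> t} \<inter> {p. fst p = k}) (\<lambda>p. (fst p, R (\<Gamma> k) (snd p)))"
      by (intro continuous_on_Pair continuous_on_fst continuous_on_id)
    then show "continuous_on ({p \<in> triangle. g p \<le> t} \<inter> {p. fst p = k}) (\<lambda>p. (fst p, R (\<Gamma> (fst p)) (snd p)))"
      by (rule continuous_on_eq) auto
  qed
  have cont2: "continuous_on (\<Union>k\<in>knots. {p \<in> triangle. g p \<le> t} \<inter> {p. snd p = k})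
      (\<lambda>p. (R (\<Gamma> (snd p)) (fst p), snd p))"
  proof (rule continuous_on_closed_Union[OF finite_knots])
    fix k assume k: "k \<in> knots"
    show "closed ({p \<in> triangle. g p \<le> t} \<inter> {p. snd p = k})"
      unfolding snd_eq by (intro closed_Int closed_sub closed_Times) auto
    have "continuous_on ({p \<in> triangle. g p \<le> t} \<inter> {p. snd p = k}) (\<lambda>p. R (\<Gamma> k) (fst p))"
      by (rule continuous_on_compose2[OF R_cont[OF k] continuous_on_fst[OF continuous_on_id]])
        (auto simp: triangle_def g_commute)
    then have "continuous_on ({p \<in> triangle. g p \<le> t} \<inter> {p. snd p = k}) (\<lambda>p. (R (\<Gamma> k) (fst p), snd p))"
      by (intro continuous_on_Pair continuous_on_snd continuous_on_id)
    then show "continuous_on ({p \<in> triangle. g p \<le> t} \<inter> {p. snd p = k}) (\<lambda>p. (R (\<Gamma> (snd p)) (fst p), snd p))"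
      by (rule continuous_on_eq) auto
  qed
  have cont0: "continuous_on {p \<in> triangle. p \<in> G \<and> g p \<le> t} \<rho>\<^sub>0"
  proof -
    have eq: "{p \<in> triangle. p \<in> G \<and> g p \<le> t} =
        (\<Union>k\<in>knots. {p \<in> triangle. g p \<le> t} \<inter> {p. fst p = k}) \<union>
        (\<Union>k\<in>knots. {p \<in> triangle. g p \<le> t} \<inter> {p. snd p = k})"
      by (auto simp: G_def)
    show ?thesis unfolding eq \<rho>\<^sub>0_def
    proof (rule continuous_on_cases[OF _ _ cont1 cont2])
      show "closed (\<Union>k\<in>knots. {p \<in> triangle. g p \<le> t} \<inter> {p. fst p = k})"
        unfolding fst_eq by (intro closed_UN finite_knots ballI closed_Int closed_sub closed_Times) auto
      show "closed (\<Union>k\<in>knots. {p \<in> triangle. g p \<le> t} \<inter> {p. snd p = k})"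
        unfolding snd_eq by (intro closed_UN finite_knots ballI closed_Int closed_sub closed_Times) auto
      have "(fst p, R (\<Gamma> (fst p)) (snd p)) = (R (\<Gamma> (snd p)) (fst p), snd p)"
        if p: "fst p \<in> knots" "snd p \<in> knots" "g p \<le> t" for p
      proof -
        have "g (fst p, snd p) \<le> t" "g (snd p, fst p) \<le> t"
          using p(3) by (simp_all add: g_def h_def norm_minus_commute)
        then show ?thesis using R_knot p(1,2) by simp
      qed
      then show "\<forall>p. p \<in> (\<Union>k\<in>knots. {p \<in> triangle. g p \<le> t} \<inter> {p. fst p = k}) \<and> fst p \<notin> knots \<or>
          p \<in> (\<Union>k\<in>knots. {p \<in> triangle. g p \<le> t} \<inter> {p. snd p = k}) \<and> fst p \<in> knots \<longrightarrow>
          (fst p, R (\<Gamma> (fst p)) (snd p)) = (R (\<Gamma> (snd p)) (fst p), snd p)"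
        by auto
    qed
  qed
  \<comment> \<open>The danger is that a point crosses the diagonal. For \<open>i < j\<close> the
    whole rectangle lies on one side. In a triangular cell the grid lines are the legs
    \<open>a = L i\<close> and \<open>b = L (Suc i)\<close>, along which the segment stays in the
    triangle, and at the other corners the point is fixed.\<close>
  have into0: "\<rho>\<^sub>0 p \<in> cell c \<and> g (\<rho>\<^sub>0 p) \<le> s" if c: "c \<in> cell_index" "p \<in> cell c" "p \<in> G" "g p \<le> t" for c p
  proof -
    obtain i j a b where ij: "c = (i, j)" "i \<le> j" "i < n" "j < n" and p: "p = (a, b)"
      using c(1) by (cases p) (auto simp: cell_index_def)
    have ab: "a \<in> seg i" "b \<in> seg j" "a \<le> b" "g (a, b) \<le> t"
      using c(2,4) ij p by (auto simp: cell_def triangle_def)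
    have seg_le: "x \<le> y" if "i < j" "x \<in> seg i" "y \<in> seg j" for x y
      using that L_le[of "Suc i" j] ij by (auto simp: seg_def)
    have tri: "(x, y) \<in> cell c" if "x \<in> seg i" "y \<in> seg j" "x \<le> y" for x y
      using that seg_subset[OF ij(3)] seg_subset[OF ij(4)] ij by (auto simp: cell_def triangle_def)
    show ?thesis
    proof (cases "a \<in> knots")
      case True
      let ?b = "R (\<Gamma> a) b"
      have b': "?b \<in> seg j" "h (\<Gamma> a) ?b \<le> s"
        using R_into[OF True ij(4) ab(2)] ab(4) by (auto simp: g_pair)
      have "a \<le> ?b"
      proof (cases "i < j")
        case True
        then show ?thesis using seg_le ab(1) b'(1) by blast
      next
        case False
        then have "j = i" using ij by simp
        show ?thesis
        proof (cases "a = L i")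
          case True
          then show ?thesis using b'(1) \<open>j = i\<close> by (simp add: seg_def)
        next
          case False
          then have "a = L (Suc i)" using seg_knot[OF \<open>a \<in> knots\<close> ab(1) ij(3)] by simp
          then have "b = a" using ab(2,3) \<open>j = i\<close> by (simp add: seg_def)
          then show ?thesis using R_knot[OF True, of b] True ab(4) by simp
        qed
      qed
      then show ?thesis
        using tri[OF ab(1) b'(1)] b'(2) True by (simp add: \<rho>\<^sub>0_def p g_pair)
    next
      case False
      then have bk: "b \<in> knots" using c(3) p by (simp add: G_def)
      let ?a = "R (\<Gamma> b) a"
      have a': "?a \<in> seg i" "h (\<Gamma> b) ?a \<le> s"
        using R_into[OF bk ij(3) ab(1)] ab(4) by (auto simp: g_commute)
      have "?a \<le> b"
      proof (cases "i < j")
        case True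
        then show ?thesis using seg_le ab(2) a'(1) by blast
      next
        case False
        then have "j = i" using ij by simp
        have "b \<noteq> L i"
        proof
          assume "b = L i"
          then have "a = b" using ab(1,3) by (simp add: seg_def)
          then show False using bk \<open>a \<notin> knots\<close> by simp
        qed
        then have "b = L (Suc i)" using seg_knot[OF bk ab(2) ij(4)] \<open>j = i\<close> by simp
        then show ?thesis using a'(1) by (simp add: seg_def)
      qed
      then show ?thesis
        using tri[OF a'(1) ab(2)] a'(2) False by (simp add: \<rho>\<^sub>0_def p g_commute)
    qed
  qed
  have fix0: "\<rho>\<^sub>0 p = p" if c: "p \<in> triangle" "p \<in> G" "g p \<le> s" for p
  proof -
    obtain a b where p: "p = (a, b)" by (cases p)
    have ab: "a \<in> {0..1}" "b \<in> {0..1}" using c(1) p by (auto simp: triangle_def)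
    have gs: "g (a, b) \<le> s" using c(3) p by simp
    have hs: "h (\<Gamma> a) b \<le> s" "h (\<Gamma> b) a \<le> s"
      using gs by (simp only: g_pair) (use gs in \<open>simp only: g_commute\<close>)
    show ?thesis
    proof (cases "a \<in> knots")
      case True
      then show ?thesis using R_id[OF True ab(2) hs(1)] by (simp add: \<rho>\<^sub>0_def p)
    next
      case False
      then have "b \<in> knots" using c(2) p by (simp add: G_def)
      then show ?thesis using R_id[OF _ ab(1) hs(2)] False by (simp add: \<rho>\<^sub>0_def p)
    qed
  qed
  have cell_tri: "cell c \<subseteq> triangle" for c by (cases c) (auto simp: cell_def)
  have crit: "\<exists>y\<in>cell c. g y \<le> s" if c: "c \<in> cell_index" "p \<in> cell c" "g p \<le> t" for c p
  proof -
    have "Inf (g ` cell c) \<in> critical_values"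
      unfolding critical_values_def using c(1) by (intro imageI UnI2)
    then have "Inf (g ` cell c) \<notin> {s<..t}" using nc by blast
    then show ?thesis by (rule exists_le_if_Inf_notin[OF compact_cell continuous_on_g _ c(2,3)])
  qed
  have meet: "p \<in> G" if c: "c \<in> cell_index" "d \<in> cell_index" "c \<noteq> d" "p \<in> cell c" "p \<in> cell d" for c d p
  proof -
    obtain i j i' j' where eq: "c = (i, j)" "d = (i', j')" by (cases c; cases d)
    then have lt: "i < n" "j < n" "i' < n" "j' < n" using c by (auto simp: cell_index_def)
    have "fst p \<in> seg i" "fst p \<in> seg i'" "snd p \<in> seg j" "snd p \<in> seg j'" using c eq by (auto simp: cell_def)
    moreover have "i \<noteq> i' \<or> j \<noteq> j'" using c(3) eq by auto
    ultimately show ?thesis using seg_meet lt unfolding G_def by blast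
  qed
  show thesis
  proof (rule cellular_retraction[of cell_index cell g s t G \<rho>\<^sub>0])
    fix \<rho>
    assume cont: "continuous_on {x \<in> \<Union>(cell ` cell_index). g x \<le> t} \<rho>"
      and into: "\<And>i x. i \<in> cell_index \<Longrightarrow> x \<in> cell i \<Longrightarrow> g x \<le> t \<Longrightarrow> \<rho> x \<in> cell i \<and> g (\<rho> x) \<le> s"
      and id: "\<And>i x. i \<in> cell_index \<Longrightarrow> x \<in> cell i \<Longrightarrow> g x \<le> s \<Longrightarrow> \<rho> x = x"
      and ext: "\<And>i x. i \<in> cell_index \<Longrightarrow> x \<in> cell i \<Longrightarrow> x \<in> G \<Longrightarrow> g x \<le> t \<Longrightarrow> \<rho> x = \<rho>\<^sub>0 x"
    have in_cell: "\<exists>c\<in>cell_index. p \<in> cell c" if "p \<in> triangle" for p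
      using that cell_cover by blast
    show thesis
    proof (rule that[of \<rho> "R (\<Gamma> 0)"])
      show "continuous_on {p \<in> triangle. g p \<le> t} \<rho>" using cont unfolding cell_cover .
    next
      fix p :: "real \<times> real" and u :: real
      assume p: "p \<in> triangle" "g p \<le> t" and u: "0 \<le> u" "u \<le> 1"
      obtain c where c: "c \<in> cell_index" "p \<in> cell c" using in_cell p(1) by blast
      have "p \<in> {p \<in> cell c. g p \<le> t}" "\<rho> p \<in> {p \<in> cell c. g p \<le> t}"
        using into[OF c p(2)] c(2) p(2) st by auto
      then have "(1 - u) *\<^sub>R p + u *\<^sub>R \<rho> p \<in> {p \<in> cell c. g p \<le> t}"
        using convex_sublevel_cell[OF c(1), of t] u unfolding convex_alt by blast
      then show "(1 - u) *\<^sub>R p + u *\<^sub>R \<rho> p \<in> triangle \<and> g ((1 - u) *\<^sub>R p + u *\<^sub>R \<rho> p) \<le> t"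
        using cell_tri by blast
    next
      fix p assume p: "p \<in> triangle" "g p \<le> t"
      then show "g (\<rho> p) \<le> s" using in_cell into by blast
    next
      fix p assume p: "p \<in> triangle" "g p \<le> s"
      then show "\<rho> p = p" using in_cell id by blast
    next
      fix c :: real assume c: "c \<in> {0..1}" "g (0, c) \<le> t"
      have tri: "(0, c) \<in> triangle" "(c, 1) \<in> triangle" using c(1) by (auto simp: triangle_def)
      have gc: "g (c, 1) \<le> t" using c(2) by (simp add: g_def h_def norm_minus_commute)
      have "(0, c) \<in> G" "(c, 1) \<in> G" using knots_0_1 by (auto simp: G_def)
      then have eq: "\<rho> (0, c) = \<rho>\<^sub>0 (0, c)" "\<rho> (c, 1) = \<rho>\<^sub>0 (c, 1)"
        using ext in_cell tri c(2) gc by blast+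
      have "\<rho>\<^sub>0 (c, 1) = (R (\<Gamma> 0) c, 1)"
      proof (cases "c \<in> knots")
        \<comment> \<open>Here \<open>\<rho>\<^sub>0\<close> moves along the line
          \<open>a = c\<close> and not along \<open>b = 1\<close>; the point is a vertex, so both
          maps fix it.\<close>
        case True
        then have "R (\<Gamma> c) 1 = 1" "R (\<Gamma> 0) c = c"
          using R_knot[OF True knots_0_1(2) gc] R_knot[OF knots_0_1(1) True c(2)] by auto
        then show ?thesis using True by (simp add: \<rho>\<^sub>0_def)
      next
        case False
        then show ?thesis by (simp add: \<rho>\<^sub>0_def)
      qed
      then show "\<rho> (0, c) = (0, R (\<Gamma> 0) c) \<and> \<rho> (c, 1) = (R (\<Gamma> 0) c, 1)"
        using eq knots_0_1 by (simp add: \<rho>\<^sub>0_def)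
    next
      assume "0 \<le> t"
      then have "g (0, 0) \<le> t" "g (0, 1) \<le> t" by (simp_all add: g_def h_def)
      then show "R (\<Gamma> 0) 0 = 0 \<and> R (\<Gamma> 0) 1 = 1"
        using R_knot[OF knots_0_1(1)] knots_0_1 by blast
    qed
  next
    show "continuous_on {x \<in> \<Union>(cell ` cell_index). x \<in> G \<and> g x \<le> t} \<rho>\<^sub>0"
      using cont0 unfolding cell_cover .
  next
    fix c p assume "c \<in> cell_index" "p \<in> cell c" "p \<in> G" "g p \<le> s"
    then show "\<rho>\<^sub>0 p = p" using fix0 cell_tri by blast
  next
    show "closed (cell c)" for c by (rule compact_imp_closed[OF compact_cell])
    show "convex {p \<in> cell c. g p \<le> r}" if "c \<in> cell_index" for c r
      by (rule convex_sublevel_cell[OF that])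
  next
    fix c p assume "c \<in> cell_index" "p \<in> cell c" "g p \<le> t"
    then show "\<exists>y\<in>cell c. g y \<le> s" by (rule crit)
  next
    fix c d p assume "c \<in> cell_index" "d \<in> cell_index" "c \<noteq> d" "p \<in> cell c" "p \<in> cell d"
    then show "p \<in> G" by (rule meet)
  next
    fix c p assume "c \<in> cell_index" "p \<in> cell c" "p \<in> G" "g p \<le> t"
    then show "\<rho>\<^sub>0 p \<in> cell c \<and> g (\<rho>\<^sub>0 p) \<le> s" by (rule into0)
  qed (rule finite_cell_index continuous_on_g st G)+
qed

end

section \<open>Descent from the triangle to the space of pairs\<close>

lemma F2_pair_continuous:
  "continuous_map (prod_topology X X) (F2 X) (\<lambda>(x, y). {x, y})"
  by (rule quotient_imp_continuous_map[OF quotient_map_F2])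

context pl_loop
begin

definition pair :: "real \<times> real \<Rightarrow> complex set" where
  "pair p = {circle_point (fst p), circle_point (snd p)}"

abbreviation sublevel :: "real \<Rightarrow> complex set topology" where
  "sublevel t \<equiv> sublevel_space (F2 circle) (T_fun \<gamma>) t"

lemma T_fun_pair: "T_fun \<gamma> (pair p) = g p"
  by (simp add: pair_def T_fun_eq g_def h_def)

lemma continuous_map_pair: "continuous_map (top_of_set S) (F2 circle) pair"
proof -
  have "continuous_on S (\<lambda>p. circle_point (fst p))" "continuous_on S (\<lambda>p. circle_point (snd p))"
    by (rule continuous_on_compose2[OF continuous_on_circle_point[of UNIV]]; auto intro: continuous_intros)+
  then have "continuous_map (top_of_set S) (prod_topology circle circle)
      (\<lambda>p. (circle_point (fst p), circle_point (snd p)))"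
    by (auto simp: continuous_map_pairwise o_def circle_def continuous_map_in_subtopology
        intro: continuous_on_Pair)
  from continuous_map_compose[OF this F2_pair_continuous]
  show ?thesis by (simp add: o_def pair_def[abs_def])
qed

lemma pair_image_triangle: "pair ` triangle = topspace (F2 circle)"
proof
  show "pair ` triangle \<subseteq> topspace (F2 circle)"
  proof (rule image_subsetI)
    fix p
    show "pair p \<in> topspace (F2 circle)"
      unfolding topspace_F2' pair_def
      by (intro CollectI exI[of _ "circle_point (fst p)"] exI[of _ "circle_point (snd p)"]) simp
  qed
  show "topspace (F2 circle) \<subseteq> pair ` triangle"
  proof
    fix w assume "w \<in> topspace (F2 circle)"
    then obtain y z where yz: "norm y = 1" "norm z = 1" "w = {y, z}"
      by (auto simp: topspace_F2')
    obtain a where a: "a \<in> {0..1}" "circle_point a = y" using circle_point_surj[OF yz(1)] .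
    obtain b where b: "b \<in> {0..1}" "circle_point b = z" using circle_point_surj[OF yz(2)] .
    have "w = pair (min a b, max a b)" using a b yz by (auto simp: pair_def min_def max_def)
    moreover have "(min a b, max a b) \<in> triangle" using a b by (auto simp: triangle_def)
    ultimately show "w \<in> pair ` triangle" by blast
  qed
qed

lemma topspace_sublevel: "topspace (sublevel t) = pair ` {p \<in> triangle. g p \<le> t}"
  unfolding sublevel_space_def topspace_subtopology pair_image_triangle[symmetric]
  by (auto simp: T_fun_pair)

lemma continuous_map_T_fun: "continuous_map (F2 circle) euclideanreal (T_fun \<gamma>)"
proof -
  have CC: "prod_topology circle circle = top_of_set (sphere 0 1 \<times> sphere 0 1)"
    by (simp add: circle_def subtopology_Times)
  have "continuous_on (sphere 0 1 \<times> sphere 0 1) (\<lambda>p. \<gamma> (fst p))"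
    "continuous_on (sphere 0 1 \<times> sphere 0 1) (\<lambda>p. \<gamma> (snd p))"
    by (rule continuous_on_compose2[OF \<gamma>_cont]; auto intro: continuous_intros)+
  then have "continuous_on (sphere 0 1 \<times> sphere 0 1) (\<lambda>p. (norm (\<gamma> (fst p) - \<gamma> (snd p)))\<^sup>2 / 2)"
    by (intro continuous_intros) auto
  then have "continuous_map (prod_topology circle circle) euclideanreal (T_fun \<gamma> \<circ> (\<lambda>(x, y). {x, y}))"
    unfolding CC by (simp add: o_def case_prod_unfold T_fun_eq)
  then show ?thesis
    using continuous_compose_quotient_map_eq[OF quotient_map_F2] by blast
qed

lemma compact_space_sublevel: "compact_space (sublevel t)"
proof -
  have "closedin (F2 circle) {w \<in> topspace (F2 circle). T_fun \<gamma> w \<in> {..t}}"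
    by (rule closedin_continuous_map_preimage[OF continuous_map_T_fun]) simp
  then have "compactin (F2 circle) {w \<in> topspace (F2 circle). T_fun \<gamma> w \<le> t}"
    by (simp add: closedin_compact_space compact_space_F2_circle)
  then show ?thesis unfolding sublevel_space_def by (rule compact_space_subtopology)
qed

lemma Hausdorff_space_sublevel: "Hausdorff_space (sublevel t)"
  unfolding sublevel_space_def by (rule Hausdorff_space_subtopology[OF Hausdorff_space_F2_circle])

text \<open>Identifications happen only on the sides \<open>a = 0\<close> and \<open>b = 1\<close>.
  The parameters \<open>c\<close> and \<open>c'\<close> can differ, namely as 0 and 1, because all
  three corners go to the same one-point set.\<close>

lemma pair_eq_cases:
  assumes "p \<in> triangle" "p' \<in> triangle" "pair p = pair p'"
  shows "p = p' \<or> (\<exists>c c'. (p = (0, c) \<or> p = (c, 1)) \<and> (p' = (0, c') \<or> p' = (c', 1)) \<and>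
    c \<in> {0..1} \<and> c' \<in> {0..1} \<and> circle_point c = circle_point c')"
proof -
  obtain a b a' b' where p: "p = (a, b)" "p' = (a', b')" by (cases p; cases p')
  then have le: "0 \<le> a" "a \<le> b" "b \<le> 1" "0 \<le> a'" "a' \<le> b'" "b' \<le> 1"
    using assms by (auto simp: triangle_def)
  have eq: "x = y \<or> (x = 0 \<and> y = 1) \<or> (x = 1 \<and> y = 0)"
    if "circle_point x = circle_point y" "0 \<le> x" "x \<le> 1" "0 \<le> y" "y \<le> 1" for x y
    using circle_point_eq_cases[OF that(1)] that by auto
  have "circle_point a = circle_point a' \<and> circle_point b = circle_point b' \<or>
      circle_point a = circle_point b' \<and> circle_point b = circle_point a'"
    using assms(3) by (auto simp: pair_def p doubleton_eq_iff)
  then show ?thesis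
  proof
    assume *: "circle_point a = circle_point a' \<and> circle_point b = circle_point b'"
    have "a = a' \<or> (a = 0 \<and> a' = 1) \<or> (a = 1 \<and> a' = 0)"
      by (rule eq) (use * le in simp_all)
    moreover have "b = b' \<or> (b = 0 \<and> b' = 1) \<or> (b = 1 \<and> b' = 0)"
      by (rule eq) (use * le in simp_all)
    ultimately show ?thesis using le * unfolding p by auto
  next
    assume *: "circle_point a = circle_point b' \<and> circle_point b = circle_point a'"
    have "a = b' \<or> (a = 0 \<and> b' = 1) \<or> (a = 1 \<and> b' = 0)"
      by (rule eq) (use * le in simp_all)
    moreover have "b = a' \<or> (b = 0 \<and> a' = 1) \<or> (b = 1 \<and> a' = 0)"
      by (rule eq) (use * le in simp_all)
    ultimately show ?thesis using le * unfolding p by auto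
  qed
qed

text \<open>The straight-line homotopy descends through \<open>pair\<close>: on the glued sides it
  keeps one point of the pair at 1 and moves the other by the same \<open>R\<close>.\<close>

lemma sublevel_deformation_retraction:
  assumes st: "s \<le> t" and nc: "critical_values \<inter> {s<..t} = {}"
  obtains r where "continuous_map (sublevel t) (sublevel s) r"
    and "\<And>w. w \<in> topspace (sublevel s) \<Longrightarrow> r w = w"
    and "homotopic_with (\<lambda>h. True) (sublevel t) (sublevel t) r id"
proof (rule triangle_retraction[OF st nc])
  fix \<rho> :: "real \<times> real \<Rightarrow> real \<times> real" and R :: "real \<Rightarrow> real"
  let ?D = "{p \<in> triangle. g p \<le> t}"
  assume cont: "continuous_on ?D \<rho>"
    and seg: "\<And>p u. p \<in> triangle \<Longrightarrow> g p \<le> t \<Longrightarrow> 0 \<le> u \<Longrightarrow> u \<le> 1 \<Longrightarrow>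
      (1 - u) *\<^sub>R p + u *\<^sub>R \<rho> p \<in> triangle \<and> g ((1 - u) *\<^sub>R p + u *\<^sub>R \<rho> p) \<le> t"
    and into: "\<And>p. p \<in> triangle \<Longrightarrow> g p \<le> t \<Longrightarrow> g (\<rho> p) \<le> s"
    and id: "\<And>p. p \<in> triangle \<Longrightarrow> g p \<le> s \<Longrightarrow> \<rho> p = p"
    and edge: "\<And>c. c \<in> {0..1} \<Longrightarrow> g (0, c) \<le> t \<Longrightarrow> \<rho> (0, c) = (0, R c) \<and> \<rho> (c, 1) = (R c, 1)"
    and R01: "0 \<le> t \<Longrightarrow> R 0 = 0 \<and> R 1 = 1"
  define H where "H = (\<lambda>(u, p). (1 - u) *\<^sub>R p + u *\<^sub>R \<rho> p)"
  let ?C = "cylinder (top_of_set ?D)"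
  have C: "?C = top_of_set ({0..1} \<times> ?D)" by (simp add: subtopology_Times)
  have compD: "compact ?D"
  proof -
    have "closed ?D"
      using continuous_on_closed_Collect_le[OF continuous_on_g _ closed_triangle, of "\<lambda>p. t"] by simp
    then have "compact (triangle \<inter> ?D)" by (rule compact_Int_closed[OF compact_triangle])
    moreover have "triangle \<inter> ?D = ?D" by auto
    ultimately show ?thesis by simp
  qed
  have edge_pair: "pair (H (u, p)) = {1, circle_point ((1 - u) * c + u * R c)}"
    if c: "c \<in> {0..1}" "p = (0, c) \<or> p = (c, 1)" "g p \<le> t" for u p c
  proof -
    have "g (0, c) \<le> t" using c by (auto simp: g_def h_def norm_minus_commute)
    then show ?thesis using edge[OF c(1)] c(2) by (auto simp: H_def pair_def insert_commute)
  qed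
  have compat: "pair (H (u, p)) = pair (H (u, p'))"
    if p: "p \<in> ?D" "p' \<in> ?D" "pair p = pair p'" for u p p'
  proof (cases "p = p'")
    case False
    then obtain c c' where c: "p = (0, c) \<or> p = (c, 1)" "p' = (0, c') \<or> p' = (c', 1)"
        "c \<in> {0..1}" "c' \<in> {0..1}" "circle_point c = circle_point c'"
      using pair_eq_cases[of p p'] p by blast
    \<comment> \<open>A point in the sublevel set forces \<open>0 \<le> t\<close>, so
      \<open>R\<close> fixes 0 and 1; this covers the case in which \<open>c\<close> and
      \<open>c'\<close> are the two ends.\<close>
    have "g p \<ge> 0" by (simp add: g_def h_def)
    then have R: "R 0 = 0" "R 1 = 1" using R01 p(1) by auto
    have "circle_point ((1 - u) * c + u * R c) = circle_point ((1 - u) * c' + u * R c')"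
      using circle_point_eq_cases[OF c(5,3,4)] R by auto
    then show ?thesis
      using edge_pair[OF c(3,1)] edge_pair[OF c(4,2)] p(1,2) by simp
  qed simp
  have pair_map: "continuous_map (top_of_set ?D) (sublevel t) pair"
    unfolding sublevel_space_def continuous_map_in_subtopology
    using continuous_map_pair[of ?D] pair_image_triangle by (auto simp: T_fun_pair)
  \<comment> \<open>A continuous surjection from a compact space to a Hausdorff space is a quotient
    map, so a continuous homotopy compatible with \<open>pair\<close> factors continuously.\<close>
  have quot: "quotient_map ?C (cylinder (sublevel t)) (map_prod id pair)"
  proof (rule continuous_imp_quotient_map)
    show "continuous_map ?C (cylinder (sublevel t)) (map_prod id pair)"
      by (rule continuous_map_prod_id[OF pair_map])
    show "compact_space ?C"
      unfolding C using compD by (intro compact_space_subtopology) (simp add: compact_Times)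
    show "Hausdorff_space (cylinder (sublevel t))"
      by (simp add: Hausdorff_space_prod_topology Hausdorff_space_sublevel Hausdorff_space_subtopology)
    show "map_prod id pair ` topspace ?C = topspace (cylinder (sublevel t))"
      by (simp add: topspace_sublevel map_prod_surj_on)
  qed
  have Hcont: "continuous_on ({0..1} \<times> ?D) H"
  proof -
    have "continuous_on ({0..1} \<times> ?D) (\<lambda>z. \<rho> (snd z))"
      by (rule continuous_on_compose2[OF cont]) (auto intro: continuous_intros)
    then show ?thesis
      unfolding H_def case_prod_unfold by (intro continuous_intros)
  qed
  have Hmap: "continuous_map ?C (sublevel t) (pair \<circ> H)"
  proof (rule continuous_map_compose[OF _ pair_map])
    show "continuous_map ?C (top_of_set ?D) H"
      unfolding C continuous_map_in_subtopology using Hcont seg by (auto simp: H_def)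
  qed
  have comp: "(pair \<circ> H) y = (pair \<circ> H) z"
    if "y \<in> topspace ?C" "z \<in> topspace ?C" "map_prod id pair y = map_prod id pair z" for y z
    using that compat[of "snd y" "snd z" "fst y"] by (cases y; cases z) auto
  obtain hb where hb: "continuous_map (cylinder (sublevel t)) (sublevel t) hb"
      and hb_eq: "\<And>y. y \<in> topspace ?C \<Longrightarrow> hb (map_prod id pair y) = (pair \<circ> H) y"
    by (rule quotient_map_lift_exists[OF quot Hmap comp]) blast+
  have hb_pair: "hb (u, pair p) = pair ((1 - u) *\<^sub>R p + u *\<^sub>R \<rho> p)" if "0 \<le> u" "u \<le> 1" "p \<in> ?D" for u p
    using hb_eq[of "(u, p)"] that by (simp add: H_def)
  have hb_end: "continuous_map (sublevel t) (sublevel t) (\<lambda>w. hb (u, w))" if "u \<in> {0..1}" for u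
    using continuous_map_compose[OF continuous_map_Pair_cylinder[OF that] hb] by (simp add: o_def)
  show thesis
  proof (rule that[of "\<lambda>w. hb (1, w)"])
    have "hb (1, w) \<in> topspace (sublevel s)" if w: "w \<in> topspace (sublevel t)" for w
    proof -
      obtain p where p: "p \<in> ?D" "w = pair p" using w unfolding topspace_sublevel by blast
      then have "hb (1, w) = pair (\<rho> p)" using hb_pair[of 1 p] by simp
      moreover have "\<rho> p \<in> triangle" using seg[of p 1] p(1) by simp
      ultimately show ?thesis using into p(1) unfolding topspace_sublevel by blast
    qed
    then show "continuous_map (sublevel t) (sublevel s) (\<lambda>w. hb (1, w))"
      using hb_end[of 1] unfolding sublevel_space_def by (auto simp: continuous_map_in_subtopology)
    show "hb (1, w) = w" if w: "w \<in> topspace (sublevel s)" for w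
    proof -
      obtain p where p: "p \<in> triangle" "g p \<le> s" "w = pair p" using w unfolding topspace_sublevel by blast
      then show ?thesis using hb_pair[of 1 p] id[of p] st by simp
    qed
    have "hb (0, w) = w" if w: "w \<in> topspace (sublevel t)" for w
    proof -
      obtain p where p: "p \<in> ?D" "w = pair p" using w unfolding topspace_sublevel by blast
      then show ?thesis using hb_pair[of 0 p] by simp
    qed
    then have "homotopic_with (\<lambda>h. True) (sublevel t) (sublevel t) (\<lambda>w. hb (0, w)) id"
      using hb_end[of 0] by (intro homotopic_with_equal) auto
    moreover have "homotopic_with (\<lambda>h. True) (sublevel t) (sublevel t) (\<lambda>w. hb (0, w)) (\<lambda>w. hb (1, w))"
      unfolding homotopic_with_def using hb by blast
    ultimately show "homotopic_with (\<lambda>h. True) (sublevel t) (sublevel t) (\<lambda>w. hb (1, w)) id"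
      using homotopic_with_trans homotopic_with_symD by blast
  qed
qed

lemma kincl_iso_sublevel:
  assumes "s < t" "{s<..t} \<inter> critical_values = {}"
  shows "kincl_iso TYPE('k::field) p (sublevel s) (sublevel t)"
proof (rule sublevel_deformation_retraction[of s t])
  show "s \<le> t" "critical_values \<inter> {s<..t} = {}" using assms by auto
next
  fix r assume "continuous_map (sublevel t) (sublevel s) r"
    "\<And>w. w \<in> topspace (sublevel s) \<Longrightarrow> r w = w"
    "homotopic_with (\<lambda>h. True) (sublevel t) (sublevel t) r id"
  moreover have "continuous_map (sublevel s) (sublevel t) id"
    using assms(1) unfolding sublevel_space_def
    by (auto simp: continuous_map_in_subtopology continuous_map_from_subtopology)
  ultimately show ?thesis by (intro kincl_iso_deformation_retract)
qed

text \<open>Where the pulled-back function is below \<open>t'\<close>, the retraction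
  \<open>\<psi>\<close> lands in the \<open>t'\<close>-sublevel set, and \<open>r\<close> continues
  to the \<open>t\<close>-sublevel set. So the latter is a retract of the open set \<open>U\<close>,
  and \<open>fin_khomology_open_retract\<close> applies.\<close>

lemma fin_khomology_sublevel: "fin_khomology TYPE('k::field) p (sublevel t)"
proof -
  obtain t' where t': "t < t'" "critical_values \<inter> {t<..t'} = {}"
  proof -
    \<comment> \<open>The level \<open>t\<close> is taken out because it may be critical; only an
      interval above it has to be free of critical values.\<close>
    have "closed (critical_values - {t})"
      using finite_critical_values by (intro finite_imp_closed) auto
    then have "open (- (critical_values - {t}))" by (rule open_Compl)
    moreover have "t \<in> - (critical_values - {t})" by simp
    ultimately obtain e where e: "e > 0" "cball t e \<subseteq> - (critical_values - {t})"
      unfolding open_contains_cball by blast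
    have "x \<notin> critical_values" if "x \<in> {t<..t + e}" for x
    proof -
      have "x \<in> cball t e" "x \<noteq> t" using that by (auto simp: dist_real_def)
      then show ?thesis using e(2) by blast
    qed
    then show thesis using e(1) by (intro that[of "t + e"]) auto
  qed
  obtain r where r: "continuous_map (sublevel t') (sublevel t) r"
      "\<And>w. w \<in> topspace (sublevel t) \<Longrightarrow> r w = w"
    using sublevel_deformation_retraction[of t t'] t' by (metis less_imp_le)
  obtain E :: "complex set \<Rightarrow> complex \<times> complex" and \<psi>
    where E: "continuous_map (F2 circle) (top_of_set (UNIV \<times> - {0})) E"
      and \<psi>: "continuous_map (top_of_set (UNIV \<times> - {0})) (F2 circle) \<psi>"
      and \<psi>E: "\<And>w. w \<in> topspace (F2 circle) \<Longrightarrow> \<psi> (E w) = w"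
    by (rule F2_circle_open_retract) blast
  define U where "U = {y \<in> UNIV \<times> - {0}. T_fun \<gamma> (\<psi> y) < t'}"
  have "openin (top_of_set (UNIV \<times> - {0})) {y \<in> topspace (top_of_set (UNIV \<times> - {0})). (T_fun \<gamma> \<circ> \<psi>) y \<in> {..<t'}}"
    by (rule openin_continuous_map_preimage[OF continuous_map_compose[OF \<psi> continuous_map_T_fun]]) simp
  then have "openin (top_of_set (UNIV \<times> - {0})) U" by (simp add: U_def)
  moreover have "open (UNIV \<times> - {0} :: (complex \<times> complex) set)" by (intro open_Times) auto
  ultimately have U: "open U" using openin_open_eq by blast
  have sub: "topspace (sublevel t) \<subseteq> topspace (F2 circle)" by (auto simp: sublevel_space_def)
  have i: "continuous_map (sublevel t) (top_of_set U) E"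
  proof -
    have "continuous_map (sublevel t) (top_of_set (UNIV \<times> - {0})) E"
      unfolding sublevel_space_def by (rule continuous_map_from_subtopology[OF E])
    moreover have "E w \<in> U" if "w \<in> topspace (sublevel t)" for w
    proof -
      have w: "w \<in> topspace (F2 circle)" "T_fun \<gamma> w \<le> t" using that by (auto simp: sublevel_space_def)
      then have "E w \<in> UNIV \<times> - {0}" using E by (auto simp: continuous_map_def)
      then show ?thesis using w t'(1) \<psi>E by (simp add: U_def)
    qed
    ultimately show ?thesis by (auto simp: continuous_map_in_subtopology)
  qed
  have "continuous_map (top_of_set U) (sublevel t') \<psi>"
  proof -
    have "U \<subseteq> UNIV \<times> - {0}" by (auto simp: U_def)
    then have "continuous_map (top_of_set U) (F2 circle) \<psi>"
      using continuous_map_from_subtopology[OF \<psi>, of U] by (simp add: subtopology_subtopology inf.absorb2)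
    moreover have "\<psi> y \<in> topspace (F2 circle)" if "y \<in> U" for y
      using \<psi> that by (auto simp: U_def continuous_map_def)
    ultimately show ?thesis
      by (auto simp: sublevel_space_def continuous_map_in_subtopology U_def)
  qed
  from continuous_map_compose[OF this r(1)]
  have "continuous_map (top_of_set U) (sublevel t) (r \<circ> \<psi>)" .
  then show ?thesis
    using r(2) \<psi>E sub by (intro fin_khomology_open_retract[OF compact_space_sublevel U i]) auto
qed

end

section \<open>The piecewise linear interpolation as a loop affine between knots\<close>

lemma pl_loop_pl_interpolation:
  fixes x :: "nat \<Rightarrow> 'a::real_normed_vector"
  assumes "n > 1" "inj_on x {..<n}" "continuous_on (sphere 0 1) (pl_interpolation n x)"
  shows "pl_loop n (knot n x) (pl_interpolation n x)"
proof
  show "0 < n" using assms(1) by simp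
  show "knot n x 0 = 0" by (rule knot_0[OF assms(1,2)])
  show "knot n x n = 1" by (rule knot_n[OF assms(1,2)])
  show "knot n x i < knot n x j" if "i < j" "j \<le> n" for i j
    using knot_less[OF assms(1,2), of i j] that by simp
  show "continuous_on (sphere 0 1) (pl_interpolation n x)" by fact
  fix i a b and u :: real
  assume i: "i < n" and a: "a \<in> {knot n x i..knot n x (Suc i)}" and b: "b \<in> {knot n x i..knot n x (Suc i)}"
    and u: "0 \<le> u" "u \<le> 1"
  have c: "(1 - u) * a + u * b \<in> {knot n x i..knot n x (Suc i)}"
    using convex_closed_interval[of "knot n x i" "knot n x (Suc i)"] a b u unfolding convex_alt by auto
  define k where "k = total_len n x / edge_len n x i"
  have val: "pl_interpolation n x (circle_point s) = (k * (s - knot n x i)) *\<^sub>R edge_vec n x i + x i"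
    if "s \<in> {knot n x i..knot n x (Suc i)}" for s
    using pl_interpolation_eq[OF assms(1,2) i that] by (simp add: circle_point_def k_def)
  have "k * ((1 - u) * a + u * b - knot n x i) =
      (1 - u) * (k * (a - knot n x i)) + u * (k * (b - knot n x i))"
    by (simp add: algebra_simps)
  then show "pl_interpolation n x (circle_point ((1 - u) * a + u * b)) =
      (1 - u) *\<^sub>R pl_interpolation n x (circle_point a) + u *\<^sub>R pl_interpolation n x (circle_point b)"
    unfolding val[OF a] val[OF b] val[OF c]
    by (simp add: scaleR_add_left scaleR_add_right scaleR_diff_left)
qed

theorem corollary5p7:
  fixes n :: nat and x :: "nat \<Rightarrow> real ^ 'd" and p :: nat
  assumes "n > 3"
    and "inj_on x {..<n}"
    and "embedding_map circle euclidean (pl_interpolation n x)"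
  shows "(\<forall>t. vectorspace.fin_dim (class_ring :: 'k::field ring)
            (sublevel_homology p (F2 circle) (T_fun (pl_interpolation n x)) t))
       \<and> finite {q. persistence_diagram
            (sublevel_homology p (F2 circle) (T_fun (pl_interpolation n x)) ::
               real \<Rightarrow> ('k, (complex set, 'k) kchain set) module)
            (sublevel_map p (F2 circle) (T_fun (pl_interpolation n x))) q \<noteq> 0}"
proof -
  have "continuous_map circle euclidean (pl_interpolation n x)"
    using assms(3) unfolding embedding_map_def
    by (rule continuous_map_into_fulltopology[OF homeomorphic_imp_continuous_map])
  then have "continuous_on (sphere 0 1) (pl_interpolation n x)" by (simp add: circle_def)
  then interpret pl_loop n "knot n x" "pl_interpolation n x"
    using assms(1,2) by (intro pl_loop_pl_interpolation) auto
  have "vectorspace.fin_dim (class_ring :: 'k ring)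
      (sublevel_homology p (F2 circle) (T_fun (pl_interpolation n x)) t)" for t
    unfolding sublevel_homology_def by (rule fin_dim_khomology[OF fin_khomology_sublevel])
  moreover have "finite {q. persistence_diagram
      (sublevel_homology p (F2 circle) (T_fun (pl_interpolation n x)) ::
         real \<Rightarrow> ('k, (complex set, 'k) kchain set) module)
      (sublevel_map p (F2 circle) (T_fun (pl_interpolation n x))) q \<noteq> 0}"
    by (rule finite_persistence_diagram[OF fin_khomology_sublevel finite_critical_values kincl_iso_sublevel])
  ultimately show ?thesis by blast
qed

end
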